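(* Let $r>0$, $s>1$, $t>0$. Let $\mathcal{G}$ be a map from a subset of $\mathcal{X}$ containing $\tilde C_r^s(\mathcal{X})$ into $\mathcal{Y}$, and assume that there exist $M<\infty$ and an open set $O_{\mathbb{C}}\subseteq\mathcal{X}_{\mathbb{C}}$ containing $\tilde C_r^{s}(\mathcal{X})$ such that $\mathcal{G}$ extends to a holomorphic map $\mathcal{G}:O_{\mathbb{C}}\to\mathcal{Y}_{\mathbb{C}}$ with $\sup_{a\in O_{\mathbb{C}}}\|\mathcal{G}(a)\|_{\mathcal{Y}^t_{\mathbb{C}}}\le M$. Let $(\chi_j)_{j\in\mathbb{N}_0}\subseteq[-1,1]$ be a sequence of distinct points such that, for some fixed $\tau>0$, the Lebesgue constants satisfy $L((\chi_j)_{j=0}^n)\le(1+n)^\tau$ for all $n\in\mathbb{N}_0$. Fix $\delta>0$ (arbitrarily small). Then there exists a constant $C>0$ (depending on $\delta,\tau,s,t,r$) such that for every $N\in\mathbb{N}$ there exist downward closed index sets $(\Lambda_{N,j})_{j\le N}$, $\Lambda_{N,j}\subseteq\mathcal{F}$, such that $\sum_{j=1}^N|\Lambda_{N,j}|\le N$ and such that, with $u(\boldsymbol y)=\mathcal{G}(\sigma_r^s(\boldsymbol y))$ and the interpolated coefficients $p_N(\boldsymbol y)=\big(I_{\Lambda_{N,j}}\langle u(\boldsymbol y),\tilde\eta_j\rangle\big)_{j\le N}$, $$\sup_{\boldsymbol y\in U}\big\|\mathcal{G}(\sigma_r^s(\boldsymbol y))-\mathcal{D}(p_N(\boldsymbol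 y))\big\|_{\mathcal{Y}}\le C N^{-\min\{s-1,t\}+\delta}.$$
   Context: $\mathbb{N}=\{1,2,\dots\}$, $\mathbb{N}_0=\{0,1,2,\dots\}$. $\mathcal{X},\mathcal{Y}$ are separable real Hilbert spaces; the subscript $\mathbb{C}$ denotes complexification. $(\psi_j)_{j\in\mathbb{N}}$ is a frame of $\mathcal{X}$, and $(\eta_j)_{j\in\mathbb{N}}$ is a frame of $\mathcal{Y}$ with canonical dual frame $(\tilde\eta_j)_{j\in\mathbb{N}}$. (A sequence $(\eta_j)$ is a frame of $\mathcal{Y}$ if the analysis operator $F:\mathcal{Y}\to\ell^2(\mathbb{N})$, $v\mapsto(\langle v,\eta_j\rangle)_j$, is bounded and boundedly invertible onto its range; the canonical dual frame is $\tilde\eta_j=(F'F)^{-1}\eta_j$ with $F'$ the adjoint of $F$.) Decoder: $\mathcal{D}:\ell^2(\mathbb{N})\to\mathcal{Y}$, $\mathcal{D}((y_j)_j)=\sum_{j\in\mathbb{N}}y_j\eta_j$; finite vectors are padded with zeros before applying $\mathcal{D}$. $(w_j)_{j\in\mathbb{N}}$ is a fixed strictly positive, monotonically decreasing sequence with $(w_j^{1+\epsilon})_j\in\ell^1(\mathbb{N})$ for all $\epsilon>0$. For $t\ge0$, $\|y\|_{\mathcal{Y}^t}^2=\sum_j|\langle y,\tilde\eta_j\rangle|^2w_j^{-2t}$, $\mathcal{Y}^t=\{y\in\mathcal{Y}:\|y\|_{\mathcal{Y}^t}<\infty\}$, and $\mathcal{Y}^t_{\mathbb{C}}$ is its complexification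 (same norm formula). $U=[-1,1]^{\mathbb{N}}$, $\sigma_r^s:U\to\mathcal{X}$, $\sigma_r^s(\boldsymbol y)=r\sum_{j\in\mathbb{N}}w_j^sy_j\psi_j$, and $\tilde C_r^s(\mathcal{X})=\{\sigma_r^s(\boldsymbol y):\boldsymbol y\in U\}$. $\mathcal{F}$ is the set of multiindices $\boldsymbol\nu=(\nu_j)_{j\in\mathbb{N}}\in\mathbb{N}_0^{\mathbb{N}}$ with $|\boldsymbol\nu|=\sum_j\nu_j<\infty$. $\boldsymbol\mu\le\boldsymbol\nu$ means $\mu_j\le\nu_j$ for all $j$; $\Lambda\subseteq\mathcal{F}$ is downward closed if $\boldsymbol\nu\in\Lambda$ and $\boldsymbol\mu\le\boldsymbol\nu$ imply $\boldsymbol\mu\in\Lambda$. The Lebesgue constant of distinct points $\chi_0,\dots,\chi_n$ is $L((\chi_j)_{j=0}^n)=\sup_{x\in[-1,1]}\sum_{k=0}^n\prod_{i\ne k}\left|\frac{x-\chi_i}{\chi_k-\chi_i}\right|$. For $\boldsymbol\nu\in\mathcal{F}$ and $u:U\to\mathbb{R}$, $$(I_{\boldsymbol\nu}u)(\boldsymbol y)=\sum_{\{\boldsymbol\mu\in\mathcal{F}:\boldsymbol\mu\le\boldsymbol\nu\}}u((\chi_{\mu_j})_{j\in\mathbb{N}})\prod_{j\in\mathbb{N}}\prod_{i=0,\,i\ne\mu_j}^{\nu_j}\frac{y_j-\chi_i}{\chi_{\mu_j}-\chi_i}.$$ For a finite downward closed $\Lambda\subseteq\mathcal{F}$ the Smolyak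 interpolant is $I_\Lambda=\sum_{\boldsymbol\nu\in\Lambda}\varsigma_{\Lambda,\boldsymbol\nu}I_{\boldsymbol\nu}$ with $\varsigma_{\Lambda,\boldsymbol\nu}=\sum_{\{\boldsymbol e\in\{0,1\}^{\mathbb{N}}:\boldsymbol\nu+\boldsymbol e\in\Lambda\}}(-1)^{|\boldsymbol e|}$ (so $I_\emptyset=0$). *)

theory Defs
  imports "HOL-Analysis.Analysis"
begin

text \<open>
  Sequences that are indexed by the positive integers on paper are indexed by \<^typ>\<open>nat\<close> here,
  starting at 0; a range of indices \<open>j \<le> N\<close> accordingly becomes \<open>j < N\<close>.  The interpolation
  points \<open>\<xi>\<close> are indexed from 0 in both versions.
\<close>

subsection \<open>The Hilbert space of square summable real sequences\<close>

typedef ell2 = "{x :: nat \<Rightarrow> real. summable (\<lambda>j. (x j)\<^sup>2)}"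
  morphisms ell2_nth Abs_ell2
  by (rule exI[of _ "\<lambda>_. 0"]) simp

setup_lifting type_definition_ell2

lemma summable_ell2: "summable (\<lambda>j. (ell2_nth x j)\<^sup>2)"
  using ell2_nth[of x] by simp

lemma summable_mult_of_squares:
  fixes x y :: "nat \<Rightarrow> real"
  assumes "summable (\<lambda>j. (x j)\<^sup>2)" "summable (\<lambda>j. (y j)\<^sup>2)"
  shows "summable (\<lambda>j. x j * y j)"
proof (rule summable_comparison_test')
  show "summable (\<lambda>j. (x j)\<^sup>2 + (y j)\<^sup>2)"
    using assms by (rule summable_add)
  fix j :: nat
  have "0 \<le> (\<bar>x j\<bar> - \<bar>y j\<bar>)\<^sup>2" by simp
  then have "2 * (\<bar>x j\<bar> * \<bar>y j\<bar>) \<le> (x j)\<^sup>2 + (y j)\<^sup>2"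
    by (simp add: power2_diff)
  moreover have "0 \<le> \<bar>x j\<bar> * \<bar>y j\<bar>" by simp
  ultimately have "\<bar>x j\<bar> * \<bar>y j\<bar> \<le> (x j)\<^sup>2 + (y j)\<^sup>2" by linarith
  then show "norm (x j * y j) \<le> (x j)\<^sup>2 + (y j)\<^sup>2"
    by (simp add: abs_mult)
qed

lemma summable_ell2_mult: "summable (\<lambda>j. ell2_nth x j * ell2_nth y j)"
  by (intro summable_mult_of_squares summable_ell2)

instantiation ell2 :: real_vector
begin

lift_definition zero_ell2 :: ell2 is "\<lambda>_. 0" by simp

lift_definition plus_ell2 :: "ell2 \<Rightarrow> ell2 \<Rightarrow> ell2" is "\<lambda>x y j. x j + y j"
proof -
  fix x y :: "nat \<Rightarrow> real"
  assume *: "summable (\<lambda>j. (x j)\<^sup>2)" "summable (\<lambda>j. (y j)\<^sup>2)"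
  have "summable (\<lambda>j. (x j)\<^sup>2 + (y j)\<^sup>2 + 2 * (x j * y j))"
    by (intro summable_add summable_mult summable_mult_of_squares *)
  then show "summable (\<lambda>j. (x j + y j)\<^sup>2)"
    by (simp add: power2_sum algebra_simps)
qed

lift_definition uminus_ell2 :: "ell2 \<Rightarrow> ell2" is "\<lambda>x j. - x j" by simp

lift_definition scaleR_ell2 :: "real \<Rightarrow> ell2 \<Rightarrow> ell2" is "\<lambda>c x j. c * x j"
  by (simp add: power_mult_distrib summable_mult)

definition minus_ell2 :: "ell2 \<Rightarrow> ell2 \<Rightarrow> ell2" where
  "minus_ell2 x y = x + - y"

instance
proof
  fix a b :: real and x y z :: ell2
  show "x + y + z = x + (y + z)" by transfer (simp add: add.assoc)
  show "x + y = y + x" by transfer (simp add: add.commute)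
  show "0 + x = x" by transfer simp
  show "- x + x = 0" by transfer simp
  show "x - y = x + - y" by (rule minus_ell2_def)
  show "a *\<^sub>R (x + y) = a *\<^sub>R x + a *\<^sub>R y" by transfer (simp add: distrib_left)
  show "(a + b) *\<^sub>R x = a *\<^sub>R x + b *\<^sub>R x" by transfer (simp add: distrib_right)
  show "a *\<^sub>R b *\<^sub>R x = (a * b) *\<^sub>R x" by transfer (simp add: mult.assoc)
  show "1 *\<^sub>R x = x" by transfer simp
qed

end

instantiation ell2 :: real_inner
begin

definition inner_ell2 :: "ell2 \<Rightarrow> ell2 \<Rightarrow> real" where
  "inner_ell2 x y = (\<Sum>j. ell2_nth x j * ell2_nth y j)"

definition norm_ell2 :: "ell2 \<Rightarrow> real" where
  "norm_ell2 x = sqrt (inner x x)"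

definition dist_ell2 :: "ell2 \<Rightarrow> ell2 \<Rightarrow> real" where
  "dist_ell2 x y = norm (x - y)"

definition sgn_ell2 :: "ell2 \<Rightarrow> ell2" where
  "sgn_ell2 x = x /\<^sub>R norm x"

definition uniformity_ell2 :: "(ell2 \<times> ell2) filter" where
  "uniformity_ell2 = (INF e\<in>{0<..}. principal {(x, y). dist x y < e})"

definition open_ell2 :: "ell2 set \<Rightarrow> bool" where
  "open_ell2 A \<longleftrightarrow> (\<forall>x\<in>A. eventually (\<lambda>(x', y). x' = x \<longrightarrow> y \<in> A) uniformity)"

instance
proof
  fix x y z :: ell2 and c :: real
  show "inner x y = inner y x"
    by (simp add: inner_ell2_def mult.commute)
  show "inner (x + y) z = inner x z + inner y z"
    by (simp add: inner_ell2_def plus_ell2.rep_eq distrib_right suminf_add summable_ell2_mult)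
  show "inner (c *\<^sub>R x) y = c * inner x y"
    by (simp add: inner_ell2_def scaleR_ell2.rep_eq mult.assoc suminf_mult summable_ell2_mult)
  show "0 \<le> inner x x"
    by (simp add: inner_ell2_def suminf_nonneg summable_ell2_mult)
  show "inner x x = 0 \<longleftrightarrow> x = 0"
    using suminf_eq_zero_iff[OF summable_ell2_mult[of x x]]
    by (auto simp: inner_ell2_def zero_ell2.rep_eq fun_eq_iff simp flip: ell2_nth_inject)
qed (rule sgn_ell2_def dist_ell2_def norm_ell2_def uniformity_ell2_def open_ell2_def)+

end

subsection \<open>Frames\<close>

text \<open>
  The value of \<open>analysis_op\<close> is meaningful only if all the sequences involved are square
  summable; \<open>frame\<close> requires this explicitly.
\<close>

definition analysis_op :: "(nat \<Rightarrow> 'a::real_inner) \<Rightarrow> 'a \<Rightarrow> ell2" where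
  "analysis_op \<eta> v = Abs_ell2 (\<lambda>j. inner v (\<eta> j))"

definition frame :: "(nat \<Rightarrow> 'a::real_inner) \<Rightarrow> bool" where
  "frame \<eta> \<longleftrightarrow>
     (\<forall>v. summable (\<lambda>j. (inner v (\<eta> j))\<^sup>2)) \<and>
     bounded_linear (analysis_op \<eta>) \<and>
     inj (analysis_op \<eta>) \<and>
     (\<exists>K. \<forall>z\<in>range (analysis_op \<eta>). norm (inv (analysis_op \<eta>) z) \<le> K * norm z)"

definition canonical_dual :: "(nat \<Rightarrow> 'a::real_inner) \<Rightarrow> nat \<Rightarrow> 'a" where
  "canonical_dual \<eta> j = inv (adjoint (analysis_op \<eta>) \<circ> analysis_op \<eta>) (\<eta> j)"

definition decoder :: "(nat \<Rightarrow> 'a::real_inner) \<Rightarrow> ell2 \<Rightarrow> 'a" where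
  "decoder \<eta> y = (\<Sum>j. ell2_nth y j *\<^sub>R \<eta> j)"

lift_definition zero_pad :: "nat \<Rightarrow> (nat \<Rightarrow> real) \<Rightarrow> ell2" is
  "\<lambda>N p j. if j < N then p j else 0"
proof -
  fix N and p :: "nat \<Rightarrow> real"
  show "summable (\<lambda>j. (if j < N then p j else 0)\<^sup>2)"
    by (rule summable_finite[of "{..<N}"]) auto
qed

subsection \<open>Complexification and holomorphic maps\<close>

text \<open>
  The complexification of a real Hilbert space \<open>'a\<close> is \<open>'a \<times> 'a\<close>, where \<open>(a, b)\<close> stands for
  \<open>a + i b\<close>.  The product norm is the Hilbert space norm of the complexification, and \<open>a\<close> is
  identified with \<open>(a, 0)\<close>.
\<close>

type_synonym 'a complexified = "'a \<times> 'a"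

definition embed_real :: "'a::real_inner \<Rightarrow> 'a complexified" where
  "embed_real a = (a, 0)"

definition scaleC :: "complex \<Rightarrow> 'a::real_inner complexified \<Rightarrow> 'a complexified" where
  "scaleC c z = (Re c *\<^sub>R fst z - Im c *\<^sub>R snd z, Re c *\<^sub>R snd z + Im c *\<^sub>R fst z)"

text \<open>The complex inner product of \<open>z\<close> with the real vector \<open>v\<close> (linear in \<open>z\<close>).\<close>

definition innerC :: "'a::real_inner complexified \<Rightarrow> 'a \<Rightarrow> complex" where
  "innerC z v = Complex (inner (fst z) v) (inner (snd z) v)"

text \<open>Complex Frechet differentiability: the derivative is bounded and complex linear.\<close>

definition holomorphicC_on ::
  "('a::real_inner complexified \<Rightarrow> 'b::real_inner complexified) \<Rightarrow> 'a complexified set \<Rightarrow> bool"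
  where
  "holomorphicC_on f S \<longleftrightarrow>
     open S \<and>
     (\<forall>a\<in>S. \<exists>D. (f has_derivative D) (at a) \<and> (\<forall>c v. D (scaleC c v) = scaleC c (D v)))"

subsection \<open>Smoothness spaces and the cubes of inputs\<close>

definition weight_seq :: "(nat \<Rightarrow> real) \<Rightarrow> bool" where
  "weight_seq w \<longleftrightarrow>
     (\<forall>j. 0 < w j) \<and> decseq w \<and> (\<forall>\<epsilon>>0. summable (\<lambda>j. w j powr (1 + \<epsilon>)))"

definition smooth_space ::
  "(nat \<Rightarrow> real) \<Rightarrow> (nat \<Rightarrow> 'a::real_inner) \<Rightarrow> real \<Rightarrow> 'a set" where
  "smooth_space w \<eta> t =
     {y. summable (\<lambda>j. \<bar>inner y (canonical_dual \<eta> j)\<bar>\<^sup>2 * w j powr (- 2 * t))}"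

definition smooth_spaceC ::
  "(nat \<Rightarrow> real) \<Rightarrow> (nat \<Rightarrow> 'a::real_inner) \<Rightarrow> real \<Rightarrow> 'a complexified set" where
  "smooth_spaceC w \<eta> t = smooth_space w \<eta> t \<times> smooth_space w \<eta> t"

definition smooth_normC ::
  "(nat \<Rightarrow> real) \<Rightarrow> (nat \<Rightarrow> 'a::real_inner) \<Rightarrow> real \<Rightarrow> 'a complexified \<Rightarrow> real" where
  "smooth_normC w \<eta> t z =
     sqrt (\<Sum>j. (cmod (innerC z (canonical_dual \<eta> j)))\<^sup>2 * w j powr (- 2 * t))"

definition cube :: "(nat \<Rightarrow> real) set" where
  "cube = {y. \<forall>j. y j \<in> {-1..1}}"

definition sigma_map ::
  "(nat \<Rightarrow> real) \<Rightarrow> (nat \<Rightarrow> 'a::real_inner) \<Rightarrow> real \<Rightarrow> real \<Rightarrow> (nat \<Rightarrow> real) \<Rightarrow> 'a" where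
  "sigma_map w \<psi> r s y = r *\<^sub>R (\<Sum>j. (w j powr s * y j) *\<^sub>R \<psi> j)"

definition sigma_cube ::
  "(nat \<Rightarrow> real) \<Rightarrow> (nat \<Rightarrow> 'a::real_inner) \<Rightarrow> real \<Rightarrow> real \<Rightarrow> 'a set" where
  "sigma_cube w \<psi> r s = sigma_map w \<psi> r s ` cube"

subsection \<open>Multiindices and Smolyak interpolation\<close>

text \<open>
  A series of natural numbers is summable in \<^typ>\<open>nat\<close> (with its discrete topology) iff its sum
  is finite.
\<close>

definition multiindices :: "(nat \<Rightarrow> nat) set" where
  "multiindices = {\<nu>. summable \<nu>}"

lemma multiindices_iff: "\<nu> \<in> multiindices \<longleftrightarrow> finite {j. \<nu> j \<noteq> 0}"
proof
  assume "finite {j. \<nu> j \<noteq> 0}"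
  then have "summable \<nu>"
    by (rule summable_finite) simp
  then show "\<nu> \<in> multiindices"
    by (simp add: multiindices_def)
next
  assume "\<nu> \<in> multiindices"
  then obtain l where "(\<lambda>n. \<Sum>j<n. \<nu> j) \<longlonglongrightarrow> l"
    by (auto simp: multiindices_def summable_def sums_def)
  then have "\<forall>\<^sub>F n in sequentially. (\<Sum>j<n. \<nu> j) = l"
    by (simp add: tendsto_discrete)
  then obtain m where m: "(\<Sum>j<n. \<nu> j) = l" if "n \<ge> m" for n
    by (auto simp: eventually_sequentially)
  have "j < m" if "\<nu> j \<noteq> 0" for j
  proof (rule ccontr)
    assume "\<not> j < m"
    then have "(\<Sum>i<j. \<nu> i) = l" "(\<Sum>i<Suc j. \<nu> i) = l"
      using m[of j] m[of "Suc j"] by linarith+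
    then show False
      using that by (simp only: sum.lessThan_Suc)
  qed
  then have "{j. \<nu> j \<noteq> 0} \<subseteq> {..<m}"
    by blast
  then show "finite {j. \<nu> j \<noteq> 0}"
    by (rule finite_subset) simp
qed

text \<open>Multiindices are compared componentwise, by the library order on \<^typ>\<open>nat \<Rightarrow> nat\<close>.\<close>

definition downward_closed :: "(nat \<Rightarrow> nat) set \<Rightarrow> bool" where
  "downward_closed \<Lambda> \<longleftrightarrow>
     \<Lambda> \<subseteq> multiindices \<and> (\<forall>\<nu>\<in>\<Lambda>. \<forall>\<mu>\<in>multiindices. \<mu> \<le> \<nu> \<longrightarrow> \<mu> \<in> \<Lambda>)"

definition lebesgue_constant :: "(nat \<Rightarrow> real) \<Rightarrow> nat \<Rightarrow> real" where
  "lebesgue_constant \<xi> n =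
     (SUP x\<in>{-1..1}. \<Sum>k=0..n. \<Prod>i\<in>{0..n} - {k}. \<bar>(x - \<xi> i) / (\<xi> k - \<xi> i)\<bar>)"

text \<open>All but finitely many factors of the outer product are empty products.\<close>

definition tensor_interpolant ::
  "(nat \<Rightarrow> real) \<Rightarrow> (nat \<Rightarrow> nat) \<Rightarrow> ((nat \<Rightarrow> real) \<Rightarrow> real) \<Rightarrow> (nat \<Rightarrow> real) \<Rightarrow> real" where
  "tensor_interpolant \<xi> \<nu> u y =
     (\<Sum>\<mu> | \<mu> \<in> multiindices \<and> \<mu> \<le> \<nu>.
        u (\<lambda>j. \<xi> (\<mu> j)) *
        (\<Prod>j. \<Prod>i\<in>{0..\<nu> j} - {\<mu> j}. (y j - \<xi> i) / (\<xi> (\<mu> j) - \<xi> i)))"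

definition smolyak_coeff :: "(nat \<Rightarrow> nat) set \<Rightarrow> (nat \<Rightarrow> nat) \<Rightarrow> real" where
  "smolyak_coeff \<Lambda> \<nu> =
     (\<Sum>e | (\<forall>j. e j \<in> {0, 1}) \<and> (\<lambda>j. \<nu> j + e j) \<in> \<Lambda>. (- 1) ^ (\<Sum>j. e j))"

definition smolyak_interpolant ::
  "(nat \<Rightarrow> real) \<Rightarrow> (nat \<Rightarrow> nat) set \<Rightarrow> ((nat \<Rightarrow> real) \<Rightarrow> real) \<Rightarrow> (nat \<Rightarrow> real) \<Rightarrow> real" where
  "smolyak_interpolant \<xi> \<Lambda> u y =
     (\<Sum>\<nu>\<in>\<Lambda>. smolyak_coeff \<Lambda> \<nu> * tensor_interpolant \<xi> \<nu> u y)"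

end

theory Submission
  imports Defs "HOL-Complex_Analysis.Complex_Analysis" "HOL-Real_Asymp.Real_Asymp"
begin

text \<open>
  Write \<open>I\<^sub>\<Lambda> = \<Sum>\<nu>\<in>\<Lambda>. \<Delta>\<^sub>\<nu>\<close> with tensor products \<open>\<Delta>\<^sub>\<nu>\<close> of differences of one-dimensional
  interpolation operators.  For a scalar function that is holomorphic and bounded by \<open>M\<close> near the cube,
  \<open>\<Delta>\<^sub>\<nu>\<close> is bounded by \<open>M * \<beta>\<^sub>\<nu>\<close>, where the size of the polydisc depends on \<open>\<nu>\<close>: only the \<open>n\<close>
  coordinates in the support of \<open>\<nu>\<close> get a radius of order \<open>1 / (n * w\<^sub>j powr s)\<close>.  This makes
  \<open>\<Sum>\<nu>. (\<Prod>j. 1 + \<nu>\<^sub>j) * \<beta>\<^sub>\<nu> powr p\<close> finite for every \<open>p < 1\<close> with \<open>s * p > 1\<close>.  The set \<open>\<Lambda>\<^sub>j\<close>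
  is the downward closure of all \<open>\<nu>\<close> for which \<open>\<beta>\<^sub>\<nu> powr p * w\<^sub>j powr (1 + \<epsilon>)\<close> is at least a constant
  over \<open>N\<close>, so the cardinalities add up to at most \<open>N\<close>.  The coefficients are not estimated one by one:
  by duality, the \<open>\<ell>\<^sup>2\<close> error is a sum over \<open>\<nu>\<close> of \<open>\<Delta>\<^sub>\<nu>\<close> applied to linear combinations of those
  coefficients with \<open>\<nu> \<notin> \<Lambda>\<^sub>j\<close>, and the smoothness of the output bounds each of them
  by \<open>M\<close> times the supremum of \<open>w\<^sub>j powr t\<close> over these \<open>j\<close>.
\<close>

subsection \<open>One-dimensional interpolation of holomorphic functions\<close>

text \<open>A polydisc fixed once for all \<open>\<nu>\<close> needs radii rho_j for which the sum
  of rho_j * w_j powr s stays bounded, so rho_j cannot be as large as 1 / w_j powr s and summability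
  is lost. Choosing the radii after \<open>\<nu>\<close> restores w_j powr s, at the price of a
  factor n^n in \<beta>_\<nu>. Its p-th power n^(p n) competes with about 1/n! from summing over
  n-element supports, so p < 1 decides. A common part of all radii, independent of j and
  \<open>\<nu>\<close>, supplies geometric decay in every \<nu>_j. About the nodes only distinctness
  and the Lebesgue constants are known, so a one-dimensional difference enters as a functional that
  annihilates low degrees; Chebyshev polynomials turn this into decay. Duality avoids a loss in j:
  bounding coefficient j by M * w_j powr t and summing squares would need the sum of w_j powr (2 t),
  which may diverge for small t. The error is of order N powr (-\<theta>). The relation \<theta>
  \<le> 1/p - 1 leaves \<beta>_\<nu> at least to the power p, which is summable, and \<theta> (1 +
  \<epsilon>) \<le> t lets the output smoothness pay for the thresholds. With p near 1/s this gives
  min (s - 1) t up to \<delta>.\<close>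

fun chebyshev :: "nat \<Rightarrow> complex poly" where
  "chebyshev 0 = 1"
| "chebyshev (Suc 0) = [:0, 1:]"
| "chebyshev (Suc (Suc n)) = [:0, 2:] * chebyshev (Suc n) - chebyshev n"

lemma degree_chebyshev: "degree (chebyshev n) \<le> n"
proof (induction n rule: chebyshev.induct)
  case (3 n)
  have "degree ([:0, 2:] * chebyshev (Suc n)) \<le> Suc (Suc n)"
    using degree_mult_le[of "[:0, 2:]" "chebyshev (Suc n)"] 3(1) by simp
  then show ?case
    using 3(2) by (simp add: degree_diff_le)
qed auto

text \<open>Both sides satisfy the same three-term recurrence because w * v = 1. It is used with w
  on the unit circle for points of the interval, and with cmod w at least 1 for points away from
  it.\<close>

lemma poly_chebyshev_joukowski:
  assumes "w * v = 1"
  shows "poly (chebyshev n) ((w + v) / 2) = (w ^ n + v ^ n) / 2"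
proof (induction n rule: chebyshev.induct)
  case (3 n)
  have "(w + v) * (w ^ Suc n + v ^ Suc n) = w ^ Suc (Suc n) + v ^ Suc (Suc n) + (w * v) * (w ^ n + v ^ n)"
    by (simp add: algebra_simps)
  then have eq: "(w + v) * (w ^ Suc n + v ^ Suc n) - (w ^ n + v ^ n) = w ^ Suc (Suc n) + v ^ Suc (Suc n)"
    using assms by simp
  have "poly (chebyshev (Suc (Suc n))) ((w + v) / 2) =
      (w + v) * ((w ^ Suc n + v ^ Suc n) / 2) - (w ^ n + v ^ n) / 2"
    by (simp only: chebyshev.simps poly_diff poly_mult 3) simp
  also have "\<dots> = ((w + v) * (w ^ Suc n + v ^ Suc n) - (w ^ n + v ^ n)) / 2"
    by (simp only: diff_divide_distrib times_divide_eq_right)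
  finally show ?case by (simp only: eq)
qed auto

lemma norm_chebyshev_le_1:
  assumes "x \<in> {-1..1}"
  shows "cmod (poly (chebyshev n) (of_real x)) \<le> 1"
proof -
  define w where "w = cis (arccos x)"
  have wv: "w * cnj w = 1"
    by (simp add: w_def cis_cnj cis_mult)
  have "of_real x = (w + cnj w) / 2"
    using assms by (simp add: w_def complex_eq_iff)
  then have "poly (chebyshev n) (of_real x) = (w ^ n + cnj w ^ n) / 2"
    using poly_chebyshev_joukowski[OF wv] by metis
  also have "cmod \<dots> \<le> (cmod (w ^ n) + cmod (cnj w ^ n)) / 2"
    using norm_triangle_ineq by (simp add: norm_divide)
  also have "\<dots> = 1"
    by (simp add: norm_power w_def)
  finally show ?thesis .
qed

text \<open>Write z = (w + 1/w) / 2 with R = cmod w \<ge> 1. The real part of w / R lies in the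
  interval and has distance at most R - 1 from z, hence R \<ge> 1 + d, and the Chebyshev value is at
  least (R^k - R^(-k)) / 2.\<close>

lemma norm_chebyshev_ge:
  assumes d: "d > 0" "\<And>x. x \<in> {-1..1} \<Longrightarrow> d \<le> cmod (z - of_real x)" and k: "k \<ge> 1"
  shows "(1 + d) ^ k * (d / (2 * (1 + d))) \<le> cmod (poly (chebyshev k) z)"
proof -
  \<comment> \<open>The two solutions of the quadratic equation have product 1, so one of them has
    modulus at least 1.\<close>
  obtain w where w: "w + 1 / w = 2 * z" "w \<noteq> 0" "cmod w \<ge> 1"
  proof -
    define a where "a = z + csqrt (z\<^sup>2 - 1)"
    define b where "b = z - csqrt (z\<^sup>2 - 1)"
    have ab: "a * b = 1" "a + b = 2 * z"
      using power2_csqrt[of "z\<^sup>2 - 1"] by (simp_all add: a_def b_def algebra_simps power2_eq_square)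
    have inv: "1 / a = b" "1 / b = a"
      using ab by (metis div_by_0 nonzero_eq_divide_eq mult.commute mult_zero_left zero_neq_one)+
    have "cmod a * cmod b = 1"
      using ab by (metis norm_mult norm_one)
    then have "cmod a \<ge> 1 \<or> cmod b \<ge> 1"
      using mult_strict_mono'[of "cmod a" 1 "cmod b" 1] by fastforce
    then show ?thesis
      using that[of a] that[of b] ab inv by (metis add.commute mult_zero_left mult_zero_right zero_neq_one)
  qed
  define R where "R = cmod w"
  define u where "u = w / of_real R"
  have R: "R \<ge> 1" using w by (simp add: R_def)
  have u: "cmod u = 1" using R by (simp add: u_def norm_divide) (simp add: R_def)
  have wu: "w = of_real R * u" using R by (simp add: u_def)
  have cu: "1 / u = cnj u"
    using u complex_norm_square[of u] by (metis divide_conv_cnj div_by_1 mult_1 of_real_1 power_one)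
  have uc: "u + cnj u = 2 * of_real (Re u)"
    by (simp add: complex_eq_iff)
  have "z - of_real (Re u) = (of_real (R - 1) * u - of_real (1 - 1 / R) * cnj u) / 2"
  proof -
    have "1 / w = of_real (1 / R) * cnj u"
      using cu R by (simp add: wu flip: cu)
    then have "2 * z = of_real R * u + of_real (1 / R) * cnj u"
      using w(1) wu by simp
    then have "2 * (z - of_real (Re u)) = of_real (R - 1) * u - of_real (1 - 1 / R) * cnj u"
      using uc by (simp add: algebra_simps)
    then show ?thesis by (simp add: field_simps)
  qed
  also have "cmod \<dots> \<le> (cmod (of_real (R - 1) * u) + cmod (of_real (1 - 1 / R) * cnj u)) / 2"
    using norm_triangle_ineq4 by (simp add: norm_divide)
  also have "\<dots> = ((R - 1) + (1 - 1 / R)) / 2"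
  proof -
    have "cmod (of_real (R - 1) * u) = R - 1" "cmod (of_real (1 - 1 / R) * cnj u) = 1 - 1 / R"
      using R u by (simp_all only: norm_mult norm_of_real complex_mod_cnj) auto
    then show ?thesis by simp
  qed
  also have "\<dots> \<le> R - 1"
  proof -
    have "0 \<le> (R - 1)\<^sup>2 / R" using R by simp
    also have "(R - 1)\<^sup>2 / R = R + 1 / R - 2" using R by (simp add: field_simps power2_eq_square)
    finally show ?thesis by simp
  qed
  finally have "cmod (z - of_real (Re u)) \<le> R - 1" .
  moreover have "Re u \<in> {-1..1}"
    using abs_Re_le_cmod[of u] u by auto
  ultimately have dR: "1 + d \<le> R"
    using d(2) by fastforce
  have "z = (w + 1 / w) / 2" using w by simp
  then have "cmod (poly (chebyshev k) z) = cmod (w ^ k + (1 / w) ^ k) / 2"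
    using poly_chebyshev_joukowski[of w "1 / w" k] w(2) by (simp add: norm_divide del: divide_eq_eq_numeral1 eq_divide_eq_numeral1)
  moreover have "cmod (w ^ k + (1 / w) ^ k) \<ge> R ^ k - (1 / R) ^ k"
    using norm_diff_ineq[of "w ^ k" "(1 / w) ^ k"] by (simp add: norm_power norm_divide R_def)
  moreover have "(1 / R) ^ k \<le> R ^ k * (1 / R)"
  proof -
    have "(1 / R) ^ k \<le> (1 / R) ^ 1"
      using R k by (intro power_decreasing) auto
    also have "\<dots> \<le> R ^ k * (1 / R)"
      using R one_le_power[of R k] by (simp add: divide_right_mono)
    finally show ?thesis .
  qed
  ultimately have le: "R ^ k * (1 - 1 / R) / 2 \<le> cmod (poly (chebyshev k) z)"
    by (simp add: algebra_simps)
  have "(1 + d) ^ k * (d / (2 * (1 + d))) = (1 + d) ^ k * (1 - 1 / (1 + d)) / 2"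
    using d by (simp add: field_simps)
  also have "\<dots> \<le> R ^ k * (1 - 1 / R) / 2"
    using d dR R by (intro divide_right_mono mult_mono power_mono diff_mono divide_left_mono) auto
  finally show ?thesis using le by (rule order.trans)
qed

text \<open>With T the Chebyshev polynomial of degree k, the kernels 1 / (z - x) and T(x) / (T(z) (z
  - x)) differ by a polynomial in x of degree less than k, which the functional annihilates. The
  second kernel is small: T is at most 1 on the interval and T(z) grows geometrically in k.\<close>

lemma cauchy_kernel_functional_bound:
  fixes c :: "nat \<Rightarrow> complex" and p :: "nat \<Rightarrow> real"
  assumes I: "finite I" "\<And>i. i \<in> I \<Longrightarrow> p i \<in> {-1..1}"
    and exact: "\<And>P :: complex poly. degree P < k \<Longrightarrow> (\<Sum>i\<in>I. c i * poly P (of_real (p i))) = 0"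
    and k: "k \<ge> 1" and L: "(\<Sum>i\<in>I. cmod (c i)) \<le> L"
    and d: "d > 0" "\<And>x. x \<in> {-1..1} \<Longrightarrow> d \<le> cmod (z - of_real x)"
  shows "cmod (\<Sum>i\<in>I. c i / (z - of_real (p i))) \<le> L * (2 * (1 + d) / (d\<^sup>2 * (1 + d) ^ k))"
proof -
  define T where "T = chebyshev k"
  define a where "a = poly T z"
  have a: "(1 + d) ^ k * (d / (2 * (1 + d))) \<le> cmod a"
    unfolding a_def T_def by (rule norm_chebyshev_ge[OF d k])
  moreover have pos: "0 < (1 + d) ^ k * (d / (2 * (1 + d)))" using d by simp
  ultimately have a0: "a \<noteq> 0" by auto
  \<comment> \<open>Division of T - T(z) by the linear factor gives the quotient Q; the two kernels
    differ by Q / T(z).\<close>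
  have "poly (T - [:a:]) z = 0" by (simp add: a_def)
  then obtain Q where Q: "T - [:a:] = [:-z, 1:] * Q"
    by (metis poly_eq_0_iff_dvd dvdE)
  have "degree Q < k"
  proof (cases "Q = 0")
    case False
    then have "degree ([:-z, 1:] * Q) = 1 + degree Q"
      by (subst degree_mult_eq) auto
    moreover have "degree (T - [:a:]) \<le> k"
      using degree_chebyshev[of k] by (intro degree_diff_le) (auto simp: T_def)
    ultimately show ?thesis using Q by simp
  qed (use k in simp)
  then have ex: "(\<Sum>i\<in>I. c i * poly Q (of_real (p i))) = 0" by (rule exact)
  have ne: "z - of_real (p i) \<noteq> 0" if "i \<in> I" for i
    using d(2)[OF I(2)[OF that]] d(1) by auto
  have eq: "c i / (z - of_real (p i)) =
      c i * (poly T (of_real (p i)) / (a * (z - of_real (p i)))) + c i * poly Q (of_real (p i)) / a"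
    if "i \<in> I" for i
  proof -
    have "poly (T - [:a:]) (of_real (p i)) = (of_real (p i) - z) * poly Q (of_real (p i))"
      by (simp add: Q algebra_simps)
    then have "poly T (of_real (p i)) = a + (of_real (p i) - z) * poly Q (of_real (p i))"
      by (simp add: algebra_simps)
    then show ?thesis
      using ne[OF that] a0 by (simp add: divide_simps) (simp add: algebra_simps)
  qed
  have "(\<Sum>i\<in>I. c i / (z - of_real (p i))) =
      (\<Sum>i\<in>I. c i * (poly T (of_real (p i)) / (a * (z - of_real (p i)))))"
    using ex by (simp add: eq sum.distrib flip: sum_divide_distrib)
  also have "cmod \<dots> \<le> (\<Sum>i\<in>I. cmod (c i) * (2 * (1 + d) / (d\<^sup>2 * (1 + d) ^ k)))"
  proof (rule sum_norm_le)
    fix i assume i: "i \<in> I"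
    have "cmod (poly T (of_real (p i))) \<le> 1"
      unfolding T_def by (rule norm_chebyshev_le_1[OF I(2)[OF i]])
    moreover have "(1 + d) ^ k * (d / (2 * (1 + d))) * d \<le> cmod a * cmod (z - of_real (p i))"
      using a pos d d(2)[OF I(2)[OF i]] by (intro mult_mono) auto
    ultimately have "cmod (poly T (of_real (p i))) / (cmod a * cmod (z - of_real (p i)))
        \<le> 1 / ((1 + d) ^ k * (d / (2 * (1 + d))) * d)"
      using pos d by (intro frac_le) auto
    also have "\<dots> = 2 * (1 + d) / (d\<^sup>2 * (1 + d) ^ k)"
      using d by (simp add: field_simps power2_eq_square)
    finally show "cmod (c i * (poly T (of_real (p i)) / (a * (z - of_real (p i)))))
        \<le> cmod (c i) * (2 * (1 + d) / (d\<^sup>2 * (1 + d) ^ k))"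
      by (subst norm_mult, intro mult_left_mono) (simp_all add: norm_mult norm_divide)
  qed
  also have "\<dots> \<le> L * (2 * (1 + d) / (d\<^sup>2 * (1 + d) ^ k))"
    unfolding sum_distrib_right[symmetric] using L d by (intro mult_right_mono) auto
  finally show ?thesis .
qed

lemma has_contour_integral_bound_rectpath:
  assumes f: "(f has_contour_integral I) (rectpath a b)" and ab: "Re a \<le> Re b" "Im a \<le> Im b"
    and B: "\<And>z. z \<in> path_image (rectpath a b) \<Longrightarrow> cmod (f z) \<le> B" "0 \<le> B"
  shows "cmod I \<le> B * (2 * (Re b - Re a) + 2 * (Im b - Im a))"
proof -
  define p where "p = Complex (Re b) (Im a)"
  define q where "q = Complex (Re a) (Im b)"
  have rp: "rectpath a b = linepath a p +++ linepath p b +++ linepath b q +++ linepath q a"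
    by (simp add: rectpath_def p_def q_def Let_def)
  have int: "f contour_integrable_on rectpath a b"
    using f by (rule has_contour_integral_integrable)
  have i1: "f contour_integrable_on linepath a p"
    and r1: "f contour_integrable_on (linepath p b +++ linepath b q +++ linepath q a)"
    using int unfolding rp by (auto dest: contour_integrable_joinD1 contour_integrable_joinD2)
  have i2: "f contour_integrable_on linepath p b"
    and r2: "f contour_integrable_on (linepath b q +++ linepath q a)"
    using r1 by (auto dest: contour_integrable_joinD1 contour_integrable_joinD2)
  have i3: "f contour_integrable_on linepath b q" and i4: "f contour_integrable_on linepath q a"
    using r2 by (auto dest: contour_integrable_joinD1 contour_integrable_joinD2)
  have "(f has_contour_integral (contour_integral (linepath a p) f + (contour_integral (linepath p b) f +
      (contour_integral (linepath b q) f + contour_integral (linepath q a) f)))) (rectpath a b)"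
    unfolding rp by (intro has_contour_integral_join has_contour_integral_integral i1 i2 i3 i4)
      (auto intro!: valid_path_join)
  then have I: "I = contour_integral (linepath a p) f + (contour_integral (linepath p b) f +
      (contour_integral (linepath b q) f + contour_integral (linepath q a) f))"
    using f contour_integral_unique by blast
  have pim: "path_image (rectpath a b) = closed_segment a p \<union> closed_segment p b \<union>
      closed_segment b q \<union> closed_segment q a"
    unfolding rp by (simp add: path_image_join Un_assoc)
  have "cmod (contour_integral (linepath a p) f) \<le> B * cmod (p - a)"
    "cmod (contour_integral (linepath p b) f) \<le> B * cmod (b - p)"
    "cmod (contour_integral (linepath b q) f) \<le> B * cmod (q - b)"
    "cmod (contour_integral (linepath q a) f) \<le> B * cmod (a - q)"
    using B by (intro has_contour_integral_bound_linepath[of f] has_contour_integral_integral i1 i2 i3 i4;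
        simp add: pim)+
  moreover have "cmod (p - a) = Re b - Re a" "cmod (b - p) = Im b - Im a"
    "cmod (q - b) = Re b - Re a" "cmod (a - q) = Im b - Im a"
    using ab by (simp_all add: p_def q_def cmod_def real_sqrt_abs)
  moreover have "cmod I \<le> cmod (contour_integral (linepath a p) f) + (cmod (contour_integral (linepath p b) f) +
      (cmod (contour_integral (linepath b q) f) + cmod (contour_integral (linepath q a) f)))"
    unfolding I by (intro order.trans[OF norm_triangle_ineq] add_left_mono order_refl)
  ultimately show ?thesis by (simp add: algebra_simps)
qed

section \<open>Functionals on functions holomorphic near the interval\<close>

definition interval_nbhd :: "real \<Rightarrow> complex set" where
  "interval_nbhd e = {z. \<exists>x\<in>{-1..1}. cmod (z - of_real x) < e}"

lemma of_real_in_interval_nbhd: "x \<in> {-1..1} \<Longrightarrow> 0 < e \<Longrightarrow> of_real x \<in> interval_nbhd e"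
  by (auto simp: interval_nbhd_def intro: bexI[of _ x])

text \<open>Cauchy's formula over a rectangle around the interval reduces the functional at g to its
  values at the Cauchy kernels. The radius d will grow without bound with the coordinate, so apart
  from (1 + d)^k the constant depends only on the lower bound d0.\<close>

lemma exact_functional_bound:
  fixes c :: "nat \<Rightarrow> complex" and p :: "nat \<Rightarrow> real"
  assumes I: "finite I" "\<And>i. i \<in> I \<Longrightarrow> p i \<in> {-1..1}"
    and exact: "\<And>P :: complex poly. degree P < k \<Longrightarrow> (\<Sum>i\<in>I. c i * poly P (of_real (p i))) = 0"
    and k: "k \<ge> 1" and L: "(\<Sum>i\<in>I. cmod (c i)) \<le> L"
    and d: "0 < d0" "d0 \<le> d"
    and g: "g holomorphic_on interval_nbhd (2 * d)" "\<And>z. z \<in> interval_nbhd (2 * d) \<Longrightarrow> cmod (g z) \<le> B"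
  shows "cmod (\<Sum>i\<in>I. c i * g (of_real (p i))) \<le> B * (L * ((4 / d0 + 8) * (1 / d0 + 1)) / (1 + d) ^ k)"
proof -
  \<comment> \<open>The boundary of this rectangle keeps distance d from the interval, while its
    corners are at distance sqrt 2 * d < 2 * d and so remain in the domain of g.\<close>
  define a where "a = Complex (-1 - d) (- d)"
  define b where "b = Complex (1 + d) d"
  have d1: "d > 0" using d by simp
  have "of_real 0 \<in> interval_nbhd (2 * d)" using d1 by (intro of_real_in_interval_nbhd) auto
  then have B0: "0 \<le> B" using g(2) norm_ge_zero order_trans by blast
  have L0: "0 \<le> L" using L by (smt (verit) norm_ge_zero sum_nonneg)
  have sub: "cbox a b \<subseteq> interval_nbhd (2 * d)"
  proof
    fix z assume "z \<in> cbox a b"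
    then have z: "- 1 - d \<le> Re z" "Re z \<le> 1 + d" "- d \<le> Im z" "Im z \<le> d"
      by (auto simp: a_def b_def in_cbox_complex_iff)
    define x where "x = max (-1) (min 1 (Re z))"
    have x: "x \<in> {-1..1}" "\<bar>Re z - x\<bar> \<le> d" using z d1 by (auto simp: x_def)
    have "(cmod (z - of_real x))\<^sup>2 = \<bar>Re z - x\<bar>\<^sup>2 + \<bar>Im z\<bar>\<^sup>2"
      by (simp add: cmod_power2)
    also have "\<dots> \<le> d\<^sup>2 + d\<^sup>2"
      using x z by (intro add_mono power_mono) auto
    also have "\<dots> < (2 * d)\<^sup>2" using d1 by (simp add: power2_eq_square)
    finally have "cmod (z - of_real x) < 2 * d"
      by (rule power2_less_imp_less) (use d1 in simp)
    then show "z \<in> interval_nbhd (2 * d)" using x by (auto simp: interval_nbhd_def)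
  qed
  have ab: "Re a \<le> Re b" "Im a \<le> Im b" using d1 by (auto simp: a_def b_def)
  have pim: "path_image (rectpath a b) = cbox a b - box a b"
    by (rule path_image_rectpath_cbox_minus_box[OF ab])
  have far: "d \<le> cmod (z - of_real x)" if "z \<in> path_image (rectpath a b)" "x \<in> {-1..1}" for z x
  proof -
    have "z \<in> cbox a b - box a b" using that pim by simp
    then have "d \<le> \<bar>Re (z - of_real x)\<bar> \<or> d \<le> \<bar>Im (z - of_real x)\<bar>"
      using that d1 by (auto simp: a_def b_def in_cbox_complex_iff in_box_complex_iff)
    then show ?thesis using abs_Re_le_cmod abs_Im_le_cmod order_trans by blast
  qed
  have inbox: "of_real (p i) \<in> box a b" if "i \<in> I" for i
    using I(2)[OF that] d1 by (auto simp: a_def b_def in_box_complex_iff)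
  have "((\<lambda>w. \<Sum>i\<in>I. c i * (g w / (w - of_real (p i)))) has_contour_integral
      (\<Sum>i\<in>I. c i * (complex_of_real (2 * pi) * \<i> * winding_number (rectpath a b) (of_real (p i)) * g (of_real (p i)))))
      (rectpath a b)"
  proof (intro has_contour_integral_sum has_contour_integral_lmul I)
    fix i assume i: "i \<in> I"
    show "((\<lambda>w. g w / (w - of_real (p i))) has_contour_integral
      complex_of_real (2 * pi) * \<i> * winding_number (rectpath a b) (of_real (p i)) * g (of_real (p i))) (rectpath a b)"
    proof (rule Cauchy_integral_formula_convex_simple)
      show "g holomorphic_on cbox a b" using g(1) sub by (rule holomorphic_on_subset)
      show "of_real (p i) \<in> interior (cbox a b)" using inbox[OF i] by (simp add: interior_cbox)
      show "path_image (rectpath a b) \<subseteq> cbox a b - {of_real (p i)}" using pim inbox[OF i] by auto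
    qed auto
  qed
  moreover have "(\<Sum>i\<in>I. c i * (complex_of_real (2 * pi) * \<i> * winding_number (rectpath a b) (of_real (p i)) * g (of_real (p i))))
      = 2 * pi * \<i> * (\<Sum>i\<in>I. c i * g (of_real (p i)))"
    unfolding sum_distrib_left by (rule sum.cong) (simp_all add: winding_number_rectpath inbox)
  ultimately have int: "((\<lambda>w. \<Sum>i\<in>I. c i * (g w / (w - of_real (p i)))) has_contour_integral
      2 * pi * \<i> * (\<Sum>i\<in>I. c i * g (of_real (p i)))) (rectpath a b)" by simp
  have "cmod (2 * pi * \<i> * (\<Sum>i\<in>I. c i * g (of_real (p i)))) \<le>
      (B * (L * (2 * (1 + d) / (d\<^sup>2 * (1 + d) ^ k)))) * (2 * (Re b - Re a) + 2 * (Im b - Im a))"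
  proof (rule has_contour_integral_bound_rectpath[OF int ab])
    fix z assume z: "z \<in> path_image (rectpath a b)"
    have "(\<Sum>i\<in>I. c i * (g z / (z - of_real (p i)))) = g z * (\<Sum>i\<in>I. c i / (z - of_real (p i)))"
      by (simp add: sum_distrib_left mult.commute)
    also have "cmod \<dots> = cmod (g z) * cmod (\<Sum>i\<in>I. c i / (z - of_real (p i)))"
      by (rule norm_mult)
    also have "\<dots> \<le> B * (L * (2 * (1 + d) / (d\<^sup>2 * (1 + d) ^ k)))"
      using z pim sub
      by (intro mult_mono g cauchy_kernel_functional_bound[OF I exact k L d1 far[OF z]] B0) auto
    finally show "cmod (\<Sum>i\<in>I. c i * (g z / (z - of_real (p i)))) \<le> B * (L * (2 * (1 + d) / (d\<^sup>2 * (1 + d) ^ k)))" .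
  qed (use B0 L0 d1 in simp)
  moreover have "cmod (2 * pi * \<i> * (\<Sum>i\<in>I. c i * g (of_real (p i)))) = 2 * pi * cmod (\<Sum>i\<in>I. c i * g (of_real (p i)))"
    by (simp add: norm_mult)
  moreover have "2 * cmod (\<Sum>i\<in>I. c i * g (of_real (p i))) \<le> 2 * pi * cmod (\<Sum>i\<in>I. c i * g (of_real (p i)))"
    using pi_ge_two by (intro mult_right_mono) auto
  ultimately have "2 * cmod (\<Sum>i\<in>I. c i * g (of_real (p i))) \<le>
     (B * (L * (2 * (1 + d) / (d\<^sup>2 * (1 + d) ^ k)))) * (2 * (Re b - Re a) + 2 * (Im b - Im a))"
    by linarith
  \<comment> \<open>The perimeter is 4 + 8 * d. Absorbing the d^2 of the kernel bound leaves a
    factor that decreases in d, so d0 may replace d there.\<close>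
  also have "\<dots> = 2 * (B * (L * ((4 / d + 8) * (1 / d + 1)) / (1 + d) ^ k))"
    using d1 by (simp add: a_def b_def field_simps power2_eq_square)
  also have "\<dots> \<le> 2 * (B * (L * ((4 / d0 + 8) * (1 / d0 + 1)) / (1 + d) ^ k))"
    using d d1 B0 L0 by (intro mult_left_mono divide_right_mono mult_mono add_right_mono divide_left_mono) auto
  finally show ?thesis by simp
qed

text \<open>The value 0 for i > k lets interpolants of different degrees be written as sums over one
  common index range.\<close>

definition lagrange_basis :: "(nat \<Rightarrow> real) \<Rightarrow> nat \<Rightarrow> nat \<Rightarrow> real \<Rightarrow> real" where
  "lagrange_basis \<xi> k i x =
     (if i \<le> k then \<Prod>j\<in>{0..k} - {i}. (x - \<xi> j) / (\<xi> i - \<xi> j) else 0)"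

lemma sum_abs_lagrange_basis_le:
  assumes "x \<in> {-1..1}"
  shows "(\<Sum>i\<le>k. \<bar>lagrange_basis \<xi> k i x\<bar>) \<le> lebesgue_constant \<xi> k"
proof -
  define h where "h = (\<lambda>x. \<Sum>i=0..k. \<Prod>j\<in>{0..k} - {i}. \<bar>(x - \<xi> j) / (\<xi> i - \<xi> j)\<bar>)"
  have "continuous_on {-1..1} h"
    unfolding h_def divide_inverse by (intro continuous_intros)
  then have "compact (h ` {-1..1})" by (intro compact_continuous_image) auto
  then have "bdd_above (h ` {-1..1})" by (simp add: bounded_imp_bdd_above compact_imp_bounded)
  then have "h x \<le> (SUP x\<in>{-1..1}. h x)" using assms by (intro cSUP_upper)
  moreover have "(\<Sum>i\<le>k. \<bar>lagrange_basis \<xi> k i x\<bar>) = h x"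
    unfolding h_def atMost_atLeast0 by (rule sum.cong) (auto simp: lagrange_basis_def abs_prod)
  ultimately show ?thesis by (simp add: lebesgue_constant_def h_def)
qed

text \<open>The difference of the two sides has degree at most k and k + 1 distinct zeros.\<close>

lemma lagrange_exact:
  fixes P :: "complex poly"
  assumes "inj \<xi>" and P: "degree P \<le> k"
  shows "(\<Sum>i\<le>k. of_real (lagrange_basis \<xi> k i x) * poly P (of_real (\<xi> i))) = poly P (of_real x)"
proof -
  define l where "l = (\<lambda>i. \<Prod>j\<in>{0..k} - {i}. [:- of_real (\<xi> j), 1:] :: complex poly)"
  define c where "c = (\<lambda>i. \<Prod>j\<in>{0..k} - {i}. complex_of_real (\<xi> i - \<xi> j))"
  have lag: "of_real (lagrange_basis \<xi> k i y) = poly (l i) (of_real y) / c i" if "i \<le> k" for i y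
    using that by (simp add: lagrange_basis_def l_def c_def poly_prod prod_dividef)
  have deg: "degree (l i) \<le> k" if "i \<le> k" for i
  proof -
    have "degree (l i) \<le> (\<Sum>j\<in>{0..k} - {i}. degree [:- complex_of_real (\<xi> j), 1:])"
      unfolding l_def by (rule degree_prod_sum_le[simplified o_def]) auto
    also have "\<dots> = k" using that by simp
    finally show ?thesis .
  qed
  define D where "D = (\<Sum>i\<le>k. smult (poly P (of_real (\<xi> i)) / c i) (l i)) - P"
  have degD: "degree D \<le> k"
    unfolding D_def
    by (intro degree_diff_le P degree_sum_le) (auto simp: deg)
  have D: "poly D (of_real y) =
      (\<Sum>i\<le>k. of_real (lagrange_basis \<xi> k i y) * poly P (of_real (\<xi> i))) - poly P (of_real y)" for y
    by (auto simp: D_def poly_sum lag intro!: sum.cong)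
  have "D = 0"
  proof (rule ccontr)
    assume "D \<noteq> 0"
    have "poly D (of_real (\<xi> m)) = 0" if m: "m \<le> k" for m
    proof -
      have "lagrange_basis \<xi> k i (\<xi> m) = (if i = m then 1 else 0)" if "i \<le> k" for i
        using that m inj_eq[OF assms(1)] by (auto simp: lagrange_basis_def intro!: prod.neutral)
      then have "(\<Sum>i\<le>k. of_real (lagrange_basis \<xi> k i (\<xi> m)) * poly P (of_real (\<xi> i))) =
        (\<Sum>i\<le>k. if i = m then poly P (of_real (\<xi> m)) else 0)"
        by (intro sum.cong) auto
      then show ?thesis using m by (simp add: D)
    qed
    then have "(\<lambda>m. complex_of_real (\<xi> m)) ` {..k} \<subseteq> {z. poly D z = 0}" by auto
    then have "card ((\<lambda>m. complex_of_real (\<xi> m)) ` {..k}) \<le> card {z. poly D z = 0}"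
      by (intro card_mono poly_roots_finite[OF \<open>D \<noteq> 0\<close>])
    also have "\<dots> \<le> degree D" by (rule card_poly_roots_bound[OF \<open>D \<noteq> 0\<close>])
    also have "card ((\<lambda>m. complex_of_real (\<xi> m)) ` {..k}) = Suc k"
      using assms(1) by (subst card_image) (auto simp: inj_on_def)
    finally show False using degD by simp
  qed
  then show ?thesis using D[of x] by simp
qed

text \<open>Weights of the difference of the interpolation operators of degrees k and k - 1, with
  the operator of degree -1 taken to be 0.\<close>

definition lagrange_diff :: "(nat \<Rightarrow> real) \<Rightarrow> nat \<Rightarrow> nat \<Rightarrow> real \<Rightarrow> real" where
  "lagrange_diff \<xi> k i x =
     lagrange_basis \<xi> k i x - (if k = 0 then 0 else lagrange_basis \<xi> (k - 1) i x)"

lemma sum_lagrange_diff: "(\<Sum>k\<le>n. lagrange_diff \<xi> k i x) = lagrange_basis \<xi> n i x"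
  by (induction n) (simp_all add: lagrange_diff_def)

lemma lagrange_basis_eq_0: "k < i \<Longrightarrow> lagrange_basis \<xi> k i x = 0"
  by (simp add: lagrange_basis_def)

lemma lagrange_diff_eq_0: "k < i \<Longrightarrow> lagrange_diff \<xi> k i x = 0"
  by (auto simp: lagrange_diff_def lagrange_basis_def)

text \<open>The constant of \<open>exact_functional_bound\<close>. The leading 2 comes from the
  weights, whose absolute sum is at most twice (1 + k) powr \<tau>.\<close>

definition node_const :: "real \<Rightarrow> real" where
  "node_const d0 = 2 * ((4 / d0 + 8) * (1 / d0 + 1))"

locale interpolation_nodes =
  fixes \<xi> :: "nat \<Rightarrow> real" and \<tau> :: real
  assumes nodes: "\<xi> i \<in> {-1..1}" and inj_nodes: "inj \<xi>" and tau: "\<tau> \<ge> 0"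
    and lebesgue: "lebesgue_constant \<xi> n \<le> (1 + real n) powr \<tau>"
begin

lemma sum_abs_basis_le:
  assumes "x \<in> {-1..1}" "k \<le> K"
  shows "(\<Sum>i\<le>K. \<bar>lagrange_basis \<xi> k i x\<bar>) \<le> (1 + real k) powr \<tau>"
proof -
  have "(\<Sum>i\<le>K. \<bar>lagrange_basis \<xi> k i x\<bar>) = (\<Sum>i\<le>k. \<bar>lagrange_basis \<xi> k i x\<bar>)"
    using assms by (intro sum.mono_neutral_right) (auto simp: lagrange_basis_eq_0)
  then show ?thesis
    using sum_abs_lagrange_basis_le[OF assms(1), of \<xi> k] lebesgue[of k] by simp
qed

lemma basis_exact:
  fixes P :: "complex poly"
  assumes "degree P \<le> k" "k \<le> K"
  shows "(\<Sum>i\<le>K. of_real (lagrange_basis \<xi> k i x) * poly P (of_real (\<xi> i))) = poly P (of_real x)"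
proof -
  have "(\<Sum>i\<le>K. of_real (lagrange_basis \<xi> k i x) * poly P (of_real (\<xi> i))) =
      (\<Sum>i\<le>k. of_real (lagrange_basis \<xi> k i x) * poly P (of_real (\<xi> i)))"
    using assms by (intro sum.mono_neutral_right) (auto simp: lagrange_basis_eq_0)
  then show ?thesis
    using lagrange_exact[OF inj_nodes assms(1)] by simp
qed

text \<open>Interpolation of degree k and of degree k - 1 both reproduce polynomials of degree less
  than k, so their difference is a functional to which \<open>exact_functional_bound\<close>
  applies.\<close>

lemma diff_functional_bound:
  assumes x: "x \<in> {-1..1}" and k: "1 \<le> k" "k \<le> K" and d: "0 < d0" "d0 \<le> d"
    and g: "g holomorphic_on interval_nbhd (2 * d)" "\<And>z. z \<in> interval_nbhd (2 * d) \<Longrightarrow> cmod (g z) \<le> B"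
  shows "cmod (\<Sum>i\<le>K. of_real (lagrange_diff \<xi> k i x) * g (of_real (\<xi> i)))
    \<le> B * (node_const d0 * (1 + real k) powr \<tau> / (1 + d) ^ k)"
proof -
  have "cmod (\<Sum>i\<in>{..K}. of_real (lagrange_diff \<xi> k i x) * g (of_real (\<xi> i))) \<le>
     B * ((2 * (1 + real k) powr \<tau>) * ((4 / d0 + 8) * (1 / d0 + 1)) / (1 + d) ^ k)"
  proof (rule exact_functional_bound[OF _ nodes _ k(1) _ d g])
    fix P :: "complex poly" assume P: "degree P < k"
    show "(\<Sum>i\<in>{..K}. of_real (lagrange_diff \<xi> k i x) * poly P (of_real (\<xi> i))) = 0"
      using P k basis_exact[of P k K x] basis_exact[of P "k - 1" K x]
      by (simp add: lagrange_diff_def algebra_simps sum_subtractf)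
  next
    have "(\<Sum>i\<le>K. cmod (of_real (lagrange_diff \<xi> k i x))) \<le>
        (\<Sum>i\<le>K. \<bar>lagrange_basis \<xi> k i x\<bar> + \<bar>lagrange_basis \<xi> (k - 1) i x\<bar>)"
      by (intro sum_mono) (auto simp: lagrange_diff_def simp flip: of_real_diff)
    also have "\<dots> \<le> (1 + real k) powr \<tau> + (1 + real (k - 1)) powr \<tau>"
      unfolding sum.distrib using k by (intro add_mono sum_abs_basis_le x) auto
    also have "(1 + real (k - 1)) powr \<tau> \<le> (1 + real k) powr \<tau>"
      using tau by (intro powr_mono2) auto
    finally show "(\<Sum>i\<in>{..K}. cmod (of_real (lagrange_diff \<xi> k i x))) \<le> 2 * (1 + real k) powr \<tau>"
      by simp
  qed simp
  then show ?thesis by (simp add: node_const_def mult_ac)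
qed

lemma basis_functional_bound:
  assumes x: "x \<in> {-1..1}" and k: "k \<le> K" and d: "0 < d"
    and g: "\<And>z. z \<in> interval_nbhd (2 * d) \<Longrightarrow> cmod (g z) \<le> B"
  shows "cmod (\<Sum>i\<le>K. of_real (lagrange_basis \<xi> k i x) * g (of_real (\<xi> i))) \<le> B * (1 + real k) powr \<tau>"
proof -
  have gn: "cmod (g (of_real (\<xi> i))) \<le> B" for i
    using g of_real_in_interval_nbhd[OF nodes[of i], of "2 * d"] d by simp
  then have "B \<ge> 0" using norm_ge_zero order_trans by blast
  have "cmod (\<Sum>i\<le>K. of_real (lagrange_basis \<xi> k i x) * g (of_real (\<xi> i))) \<le>
      (\<Sum>i\<le>K. \<bar>lagrange_basis \<xi> k i x\<bar> * B)"
    by (intro sum_norm_le) (simp add: norm_mult mult_left_mono gn)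
  also have "\<dots> \<le> B * (1 + real k) powr \<tau>"
    using mult_left_mono[OF sum_abs_basis_le[OF x k] \<open>B \<ge> 0\<close>] by (simp add: sum_distrib_left mult.commute)
  finally show ?thesis .
qed

text \<open>The error is itself such a functional once the evaluation point x is added to the nodes,
  under the index \<open>Suc k\<close> and with weight -1.\<close>

lemma interpolation_error_bound:
  assumes x: "x \<in> {-1..1}" and k: "1 \<le> k" and d: "0 < d"
    and g: "g holomorphic_on interval_nbhd (2 * d)" "\<And>z. z \<in> interval_nbhd (2 * d) \<Longrightarrow> cmod (g z) \<le> B"
  shows "cmod ((\<Sum>i\<le>k. of_real (lagrange_basis \<xi> k i x) * g (of_real (\<xi> i))) - g (of_real x))
    \<le> B * (node_const d * (1 + real k) powr \<tau> / (1 + d) ^ k)"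
proof -
  define c where "c = (\<lambda>i. if i = Suc k then -1 else of_real (lagrange_basis \<xi> k i x) :: complex)"
  define p where "p = (\<lambda>i. if i = Suc k then x else \<xi> i)"
  have sum_eq: "(\<Sum>i\<in>{..Suc k}. c i * h (of_real (p i))) =
      (\<Sum>i\<le>k. of_real (lagrange_basis \<xi> k i x) * h (of_real (\<xi> i))) - h (of_real x)" for h
    by (simp add: c_def p_def)
  have "cmod (\<Sum>i\<in>{..Suc k}. c i * g (of_real (p i))) \<le>
     B * ((2 * (1 + real k) powr \<tau>) * ((4 / d + 8) * (1 / d + 1)) / (1 + d) ^ k)"
  proof (rule exact_functional_bound[OF _ _ _ k _ d order.refl g])
    fix P :: "complex poly" assume P: "degree P < k"
    show "(\<Sum>i\<in>{..Suc k}. c i * poly P (of_real (p i))) = 0"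
      unfolding sum_eq using basis_exact[of P k k x] P by simp
  next
    have "1 \<le> (1 + real k) powr \<tau>" using tau by (simp add: ge_one_powr_ge_zero)
    then show "(\<Sum>i\<in>{..Suc k}. cmod (c i)) \<le> 2 * (1 + real k) powr \<tau>"
      using sum_abs_basis_le[OF x, of k k] by (simp add: c_def)
  qed (use x nodes in \<open>auto simp: p_def\<close>)
  then show ?thesis unfolding sum_eq by (simp add: node_const_def mult_ac)
qed

end

subsection \<open>Tensor products and the Smolyak interpolant\<close>

text \<open>A finite product of sets is represented by functions on all of \<open>nat\<close> that
  vanish from m on, so that boxes of different dimensions consist of multiindices and can be
  compared.\<close>

definition index_box :: "nat \<Rightarrow> (nat \<Rightarrow> nat set) \<Rightarrow> (nat \<Rightarrow> nat) set" where
  "index_box m B = {\<mu>. (\<forall>j<m. \<mu> j \<in> B j) \<and> (\<forall>j\<ge>m. \<mu> j = 0)}"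

lemma index_box_0 [simp]: "index_box 0 B = {\<lambda>_. 0}"
  by (auto simp: index_box_def)

lemma index_box_Suc: "index_box (Suc m) B = (\<lambda>(\<mu>, i). \<mu>(m := i)) ` (index_box m B \<times> B m)"
proof (intro equalityI subsetI)
  fix \<mu> assume "\<mu> \<in> index_box (Suc m) B"
  then have "(\<mu>(m := 0), \<mu> m) \<in> index_box m B \<times> B m"
    by (auto simp: index_box_def)
  then show "\<mu> \<in> (\<lambda>(\<mu>, i). \<mu>(m := i)) ` (index_box m B \<times> B m)"
    by (rule rev_image_eqI) auto
qed (auto simp: index_box_def less_Suc_eq)

lemma inj_on_index_box_upd: "inj_on (\<lambda>(\<mu>, i). \<mu>(m := i)) (index_box m B \<times> A)"
proof (rule inj_onI, clarify)
  fix \<mu> \<mu>' :: "nat \<Rightarrow> nat" and i i' :: nat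
  assume *: "\<mu> \<in> index_box m B" "\<mu>' \<in> index_box m B" "\<mu>(m := i) = \<mu>'(m := i')"
  have "\<mu> j = \<mu>' j" for j
    using fun_cong[OF *(3), of j] *(1,2) by (cases "j = m") (auto simp: index_box_def)
  then show "\<mu> = \<mu>' \<and> i = i'" using fun_cong[OF *(3), of m] by auto
qed

lemma finite_index_box: "(\<And>j. finite (B j)) \<Longrightarrow> finite (index_box m B)"
  by (induction m) (auto simp: index_box_Suc)

lemma sum_index_box_Suc:
  "(\<Sum>\<mu>\<in>index_box (Suc m) B. f \<mu>) = (\<Sum>\<mu>\<in>index_box m B. \<Sum>i\<in>B m. f (\<mu>(m := i)))"
  unfolding index_box_Suc
  by (subst sum.reindex[OF inj_on_index_box_upd])
     (simp add: case_prod_unfold sum.cartesian_product)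

lemma prod_sum_index_box:
  fixes f :: "nat \<Rightarrow> nat \<Rightarrow> 'a::comm_semiring_1"
  shows "(\<Prod>j<m. \<Sum>i\<in>B j. f j i) = (\<Sum>\<mu>\<in>index_box m B. \<Prod>j<m. f j (\<mu> j))"
proof (induction m)
  case (Suc m)
  have "(\<Prod>j<m. f j ((\<mu>(m := i)) j)) = (\<Prod>j<m. f j (\<mu> j))" for \<mu> :: "nat \<Rightarrow> nat" and i
    by (rule prod.cong) auto
  then show ?case
    by (simp add: sum_index_box_Suc Suc sum_product)
qed simp

lemma index_box_subset_multiindices: "index_box m B \<subseteq> multiindices"
proof
  fix \<mu> assume "\<mu> \<in> index_box m B"
  then have "{j. \<mu> j \<noteq> 0} \<subseteq> {..<m}" by (auto simp: index_box_def intro: leI)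
  then show "\<mu> \<in> multiindices" by (auto simp: multiindices_iff intro: finite_subset)
qed

abbreviation cube_indices :: "nat \<Rightarrow> nat \<Rightarrow> (nat \<Rightarrow> nat) set" where
  "cube_indices m K \<equiv> index_box m (\<lambda>_. {..K})"

lemma cube_indices_mono: "m \<le> m' \<Longrightarrow> K \<le> K' \<Longrightarrow> cube_indices m K \<subseteq> cube_indices m' K'"
proof
  fix \<mu> assume *: "m \<le> m'" "K \<le> K'" "\<mu> \<in> cube_indices m K"
  have "\<mu> j \<le> K'" for j
    using * by (cases "j < m") (auto simp: index_box_def)
  then show "\<mu> \<in> cube_indices m' K'" using * by (auto simp: index_box_def)
qed

lemma finite_multiindices_subset_cube:
  assumes "finite A" "A \<subseteq> multiindices"
  shows "\<exists>m K. A \<subseteq> cube_indices m K"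
  using assms
proof (induction A rule: finite_induct)
  case (insert \<nu> A)
  then obtain m K where mK: "A \<subseteq> cube_indices m K" by auto
  have fin: "finite {j. \<nu> j \<noteq> 0}" using insert by (simp add: multiindices_iff)
  then obtain m' where m': "{j. \<nu> j \<noteq> 0} \<subseteq> {..<m'}"
    using finite_nat_iff_bounded by blast
  define K' where "K' = (\<Sum>j<m'. \<nu> j)"
  have "\<nu> j \<le> K'" if "j < m'" for j
    unfolding K'_def using that by (intro member_le_sum) auto
  then have "\<nu> \<in> cube_indices m' K'"
    using m' by (auto simp: index_box_def)
  then have "insert \<nu> A \<subseteq> cube_indices (max m m') (max K K')"
    using mK cube_indices_mono[of m "max m m'" K "max K K'"] cube_indices_mono[of m' "max m m'" K' "max K K'"]
    by auto
  then show ?case by blast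
qed auto

section \<open>Tensor products of one-dimensional functionals\<close>

definition tensor_sum :: "nat \<Rightarrow> nat \<Rightarrow> (nat \<Rightarrow> nat \<Rightarrow> 'v) \<Rightarrow> ((nat \<Rightarrow> nat) \<Rightarrow> 'v) \<Rightarrow> 'v::comm_ring_1" where
  "tensor_sum m K c U = (\<Sum>\<mu>\<in>cube_indices m K. (\<Prod>j<m. c j (\<mu> j)) * U \<mu>)"

text \<open>Grid points that are not below \<open>\<nu>\<close> contribute nothing because
  \<open>lagrange_basis\<close> vanishes there. All tensor interpolants thus become sums over the
  same box.\<close>

lemma tensor_interpolant_eq:
  assumes \<nu>: "\<nu> \<in> cube_indices m K"
  shows "tensor_interpolant \<xi> \<nu> u y =
    tensor_sum m K (\<lambda>j i. lagrange_basis \<xi> (\<nu> j) i (y j)) (\<lambda>\<mu>. u (\<lambda>j. \<xi> (\<mu> j)))"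
proof -
  let ?A = "{\<mu>. \<mu> \<in> multiindices \<and> \<mu> \<le> \<nu>}"
  have A: "?A = {\<mu> \<in> cube_indices m K. \<mu> \<le> \<nu>}"
    using \<nu> index_box_subset_multiindices[of m "\<lambda>_. {..K}"]
    by (auto simp: index_box_def le_fun_def) (metis le_trans, metis le_zero_eq)
  have "tensor_interpolant \<xi> \<nu> u y =
      (\<Sum>\<mu>\<in>{\<mu> \<in> cube_indices m K. \<mu> \<le> \<nu>}. (\<Prod>j<m. lagrange_basis \<xi> (\<nu> j) (\<mu> j) (y j)) * u (\<lambda>j. \<xi> (\<mu> j)))"
    unfolding tensor_interpolant_def A
  proof (rule sum.cong[OF refl])
    fix \<mu> assume "\<mu> \<in> {\<mu> \<in> cube_indices m K. \<mu> \<le> \<nu>}"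
    then have \<mu>: "\<mu> \<in> cube_indices m K" "\<mu> j \<le> \<nu> j" for j by (auto simp: le_fun_def)
    have "(\<Prod>j. \<Prod>i\<in>{0..\<nu> j} - {\<mu> j}. (y j - \<xi> i) / (\<xi> (\<mu> j) - \<xi> i)) =
        (\<Prod>j<m. \<Prod>i\<in>{0..\<nu> j} - {\<mu> j}. (y j - \<xi> i) / (\<xi> (\<mu> j) - \<xi> i))"
      using \<mu> \<nu> by (intro prodinf_finite) (auto simp: index_box_def)
    also have "\<dots> = (\<Prod>j<m. lagrange_basis \<xi> (\<nu> j) (\<mu> j) (y j))"
      using \<mu> by (simp add: lagrange_basis_def)
    finally show "u (\<lambda>j. \<xi> (\<mu> j)) * (\<Prod>j. \<Prod>i\<in>{0..\<nu> j} - {\<mu> j}. (y j - \<xi> i) / (\<xi> (\<mu> j) - \<xi> i)) =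
      (\<Prod>j<m. lagrange_basis \<xi> (\<nu> j) (\<mu> j) (y j)) * u (\<lambda>j. \<xi> (\<mu> j))" by (simp add: mult.commute)
  qed
  also have "\<dots> = (\<Sum>\<mu>\<in>cube_indices m K. (\<Prod>j<m. lagrange_basis \<xi> (\<nu> j) (\<mu> j) (y j)) * u (\<lambda>j. \<xi> (\<mu> j)))"
  proof (rule sum.mono_neutral_left)
    show "\<forall>\<mu>\<in>cube_indices m K - {\<mu> \<in> cube_indices m K. \<mu> \<le> \<nu>}.
        (\<Prod>j<m. lagrange_basis \<xi> (\<nu> j) (\<mu> j) (y j)) * u (\<lambda>j. \<xi> (\<mu> j)) = 0"
    proof
      fix \<mu> assume "\<mu> \<in> cube_indices m K - {\<mu> \<in> cube_indices m K. \<mu> \<le> \<nu>}"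
      then obtain j where j: "\<nu> j < \<mu> j" and \<mu>: "\<mu> \<in> cube_indices m K"
        by (auto simp: le_fun_def not_le)
      then have "j < m" by (auto simp: index_box_def intro: ccontr)
      then have "(\<Prod>j<m. lagrange_basis \<xi> (\<nu> j) (\<mu> j) (y j)) = 0"
        using lagrange_basis_eq_0[OF j] by (intro prod_zero) auto
      then show "(\<Prod>j<m. lagrange_basis \<xi> (\<nu> j) (\<mu> j) (y j)) * u (\<lambda>j. \<xi> (\<mu> j)) = 0" by simp
    qed
  qed (auto intro: finite_index_box)
  finally show ?thesis by (simp add: tensor_sum_def)
qed

text \<open>Multilinearity of the tensor product in its one-dimensional factors.\<close>

lemma sum_tensor_sum_box:
  assumes "\<And>j. finite (B j)"
  shows "(\<Sum>e\<in>index_box m B. tensor_sum m K (\<lambda>j i. c j (e j) i) U) =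
    tensor_sum m K (\<lambda>j i. \<Sum>l\<in>B j. c j l i) U"
proof -
  have "(\<Sum>e\<in>index_box m B. tensor_sum m K (\<lambda>j i. c j (e j) i) U) =
     (\<Sum>\<mu>\<in>cube_indices m K. (\<Sum>e\<in>index_box m B. \<Prod>j<m. c j (e j) (\<mu> j)) * U \<mu>)"
    unfolding tensor_sum_def by (subst sum.swap) (simp add: sum_distrib_right)
  then show ?thesis by (simp add: tensor_sum_def prod_sum_index_box)
qed

lemma tensor_sum_scale:
  "(\<Prod>j<m. a j) * tensor_sum m K c U = tensor_sum m K (\<lambda>j i. a j * c j i) U"
  by (simp add: tensor_sum_def sum_distrib_left prod.distrib mult.assoc)

text \<open>For \<open>\<nu>\<close> in the box, \<open>m\<close> and \<open>K\<close> only fix the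
  range of summation: the weights vanish above \<nu>_j, and a coordinate with \<nu>_j = 0 is just
  evaluated at the first node.\<close>

abbreviation surplus :: "(nat \<Rightarrow> real) \<Rightarrow> nat \<Rightarrow> nat \<Rightarrow> (nat \<Rightarrow> nat) \<Rightarrow> ((nat \<Rightarrow> real) \<Rightarrow> real) \<Rightarrow> (nat \<Rightarrow> real) \<Rightarrow> real" where
  "surplus \<xi> m K \<nu> u y \<equiv>
     tensor_sum m K (\<lambda>j i. lagrange_diff \<xi> (\<nu> j) i (y j)) (\<lambda>\<mu>. u (\<lambda>j. \<xi> (\<mu> j)))"

lemma sum_surplus_cube:
  "(\<Sum>\<nu>\<in>cube_indices m K. surplus \<xi> m K \<nu> u y) =
     tensor_sum m K (\<lambda>j i. lagrange_basis \<xi> K i (y j)) (\<lambda>\<mu>. u (\<lambda>j. \<xi> (\<mu> j)))"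
  by (subst sum_tensor_sum_box[where c = "\<lambda>j l i. lagrange_diff \<xi> l i (y j)"])
     (simp_all add: sum_lagrange_diff)

text \<open>Inserting the definition of the coefficients and collecting by \<nu> + e instead of
  \<open>\<nu>\<close> leaves, for every \<open>\<nu>\<close> in the set, the alternating sum of the
  interpolants with index \<nu> - e. This sum factors into one-dimensional differences.\<close>

lemma smolyak_eq_sum_surplus:
  assumes fin: "finite \<Lambda>" and dc: "downward_closed \<Lambda>" and sub: "\<Lambda> \<subseteq> cube_indices m K"
  shows "smolyak_interpolant \<xi> \<Lambda> u y = (\<Sum>\<nu>\<in>\<Lambda>. surplus \<xi> m K \<nu> u y)"
proof -
  define E where "E = index_box m (\<lambda>_. {0, 1::nat})"
  have finE: "finite E" unfolding E_def by (rule finite_index_box) auto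
  let ?I = "\<lambda>\<nu>. tensor_interpolant \<xi> \<nu> u y"
  let ?s = "\<lambda>e::nat \<Rightarrow> nat. \<Prod>j<m. (- 1 :: real) ^ e j"
  have coeff: "smolyak_coeff \<Lambda> \<nu> = (\<Sum>e | e \<in> E \<and> (\<lambda>j. \<nu> j + e j) \<in> \<Lambda>. ?s e)" for \<nu>
  proof -
    \<comment> \<open>Membership of \<nu> + e in a subset of the box forces e to vanish from m on,
      so the sum over all 0-1 sequences is finite.\<close>
    have "{e. (\<forall>j. e j \<in> {0, 1}) \<and> (\<lambda>j. \<nu> j + e j) \<in> \<Lambda>} = {e. e \<in> E \<and> (\<lambda>j. \<nu> j + e j) \<in> \<Lambda>}"
    proof (rule Collect_cong)
      fix e
      have "e j = 0" if "(\<lambda>j. \<nu> j + e j) \<in> \<Lambda>" "m \<le> j" for j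
        using that sub by (auto simp: index_box_def)
      then show "((\<forall>j. e j \<in> {0, 1}) \<and> (\<lambda>j. \<nu> j + e j) \<in> \<Lambda>) = (e \<in> E \<and> (\<lambda>j. \<nu> j + e j) \<in> \<Lambda>)"
        by (auto simp: E_def index_box_def) (metis One_nat_def not_le)
    qed
    moreover have "(- 1 :: real) ^ (\<Sum>j. e j) = ?s e" if "e \<in> E" for e
    proof -
      have "(\<Sum>j. e j) = (\<Sum>j<m. e j)"
        using that by (intro suminf_finite) (auto simp: E_def index_box_def)
      then show ?thesis by (simp add: power_sum)
    qed
    ultimately show ?thesis unfolding smolyak_coeff_def by (intro sum.cong) auto
  qed
  have "smolyak_interpolant \<xi> \<Lambda> u y = (\<Sum>\<nu>\<in>\<Lambda>. \<Sum>e | e \<in> E \<and> (\<lambda>j. \<nu> j + e j) \<in> \<Lambda>. ?s e * ?I \<nu>)"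
    unfolding smolyak_interpolant_def coeff by (simp add: sum_distrib_right)
  also have "\<dots> = (\<Sum>(\<nu>, e)\<in>(SIGMA \<nu>:\<Lambda>. {e. e \<in> E \<and> (\<lambda>j. \<nu> j + e j) \<in> \<Lambda>}). ?s e * ?I \<nu>)"
    using fin finE by (intro sum.Sigma) auto
  \<comment> \<open>Shift by e. Downward closedness puts \<nu> - e back into the set, and e \<le>
    \<nu> makes truncated subtraction invertible.\<close>
  also have "\<dots> = (\<Sum>(\<nu>, e)\<in>(SIGMA \<nu>:\<Lambda>. {e. e \<in> E \<and> e \<le> \<nu>}). ?s e * ?I (\<lambda>j. \<nu> j - e j))"
  proof (rule sum.reindex_bij_witness[where j = "\<lambda>(\<nu>, e). (\<lambda>j. \<nu> j + e j, e)" and i = "\<lambda>(\<nu>, e). (\<lambda>j. \<nu> j - e j, e)"])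
    fix a assume a: "a \<in> (SIGMA \<nu>:\<Lambda>. {e. e \<in> E \<and> e \<le> \<nu>})"
    obtain \<nu> e where ae: "a = (\<nu>, e)" by force
    have le: "e j \<le> \<nu> j" for j using a ae by (auto simp: le_fun_def)
    have "(\<lambda>j. \<nu> j - e j) \<in> \<Lambda>"
    proof -
      have \<nu>: "\<nu> \<in> \<Lambda>" using a ae by auto
      then have "finite {j. \<nu> j \<noteq> 0}" using dc by (auto simp: downward_closed_def multiindices_iff)
      then have "(\<lambda>j. \<nu> j - e j) \<in> multiindices"
        unfolding multiindices_iff by (rule finite_subset[rotated]) auto
      moreover have "(\<lambda>j. \<nu> j - e j) \<le> \<nu>" by (auto simp: le_fun_def)
      ultimately show ?thesis using dc \<nu> by (auto simp: downward_closed_def)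
    qed
    then show "(\<lambda>(\<nu>, e). (\<lambda>j. \<nu> j - e j, e)) a \<in> (SIGMA \<nu>:\<Lambda>. {e. e \<in> E \<and> (\<lambda>j. \<nu> j + e j) \<in> \<Lambda>})"
      using a ae le by auto
    show "(\<lambda>(\<nu>, e). (\<lambda>j. \<nu> j + e j, e)) ((\<lambda>(\<nu>, e). (\<lambda>j. \<nu> j - e j, e)) a) = a"
      using le ae by auto
  qed (auto simp: le_fun_def)
  also have "\<dots> = (\<Sum>\<nu>\<in>\<Lambda>. \<Sum>e | e \<in> E \<and> e \<le> \<nu>. ?s e * ?I (\<lambda>j. \<nu> j - e j))"
    using fin finE by (intro sum.Sigma[symmetric]) auto
  also have "\<dots> = (\<Sum>\<nu>\<in>\<Lambda>. surplus \<xi> m K \<nu> u y)"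
  proof (rule sum.cong[OF refl])
    fix \<nu> assume "\<nu> \<in> \<Lambda>"
    then have \<nu>: "\<nu> \<in> cube_indices m K" using sub by auto
    \<comment> \<open>If \<nu>_j = 0 only the shift 0 occurs, which matches the convention of
      \<open>lagrange_diff\<close> in degree 0.\<close>
    define B where "B = (\<lambda>j. {..min 1 (\<nu> j)})"
    have mem: "i \<in> B j \<longleftrightarrow> i \<in> {0, 1} \<and> i \<le> \<nu> j" for i j
      by (auto simp: B_def)
    have "e \<in> E \<and> e \<le> \<nu> \<longleftrightarrow> e \<in> index_box m B" for e
    proof -
      have "e \<le> \<nu> \<longleftrightarrow> (\<forall>j<m. e j \<le> \<nu> j)" if "\<forall>j\<ge>m. e j = 0"
        using that unfolding le_fun_def by (metis le0 not_le)
      then show ?thesis unfolding E_def index_box_def mem by blast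
    qed
    then have "{e. e \<in> E \<and> e \<le> \<nu>} = index_box m B" by blast
    moreover have "?s e * ?I (\<lambda>j. \<nu> j - e j) =
        tensor_sum m K (\<lambda>j i. (- 1) ^ e j * lagrange_basis \<xi> (\<nu> j - e j) i (y j)) (\<lambda>\<mu>. u (\<lambda>j. \<xi> (\<mu> j)))" for e
    proof -
      have "\<nu> j - e j \<le> K" if "j < m" for j
        using \<nu> that by (simp add: index_box_def le_diff_conv trans_le_add1)
      then have "(\<lambda>j. \<nu> j - e j) \<in> cube_indices m K" using \<nu> by (simp add: index_box_def)
      then show ?thesis by (simp add: tensor_interpolant_eq tensor_sum_scale)
    qed
    ultimately have "(\<Sum>e | e \<in> E \<and> e \<le> \<nu>. ?s e * ?I (\<lambda>j. \<nu> j - e j)) =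
       tensor_sum m K (\<lambda>j i. \<Sum>l\<in>B j. (- 1) ^ l * lagrange_basis \<xi> (\<nu> j - l) i (y j)) (\<lambda>\<mu>. u (\<lambda>j. \<xi> (\<mu> j)))"
      using sum_tensor_sum_box[where B = B and m = m and K = K and
          c = "\<lambda>j l i. (- 1) ^ l * lagrange_basis \<xi> (\<nu> j - l) i (y j)" and U = "\<lambda>\<mu>. u (\<lambda>j. \<xi> (\<mu> j))"]
      by (simp add: B_def)
    also have "(\<lambda>j i. \<Sum>l\<in>B j. (- 1) ^ l * lagrange_basis \<xi> (\<nu> j - l) i (y j)) =
        (\<lambda>j i. lagrange_diff \<xi> (\<nu> j) i (y j))"
      by (intro ext) (auto simp: B_def lagrange_diff_def min_def Suc_le_eq)
    finally show "(\<Sum>e | e \<in> E \<and> e \<le> \<nu>. ?s e * ?I (\<lambda>j. \<nu> j - e j)) = surplus \<xi> m K \<nu> u y" .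
  qed
  finally show ?thesis .
qed

subsection \<open>Surpluses of functions of several complex variables\<close>

lemma tensor_sum_Suc:
  "tensor_sum (Suc m) K c U = (\<Sum>i\<le>K. c m i * tensor_sum m K c (\<lambda>\<mu>. U (\<mu>(m := i))))"
proof -
  have "(\<Prod>j<m. c j ((\<mu>(m := i)) j)) = (\<Prod>j<m. c j (\<mu> j))" for \<mu> :: "nat \<Rightarrow> nat" and i
    by (rule prod.cong) auto
  then have "tensor_sum (Suc m) K c U =
      (\<Sum>\<mu>\<in>cube_indices m K. \<Sum>i\<le>K. (\<Prod>j<m. c j (\<mu> j)) * c m i * U (\<mu>(m := i)))"
    by (simp add: tensor_sum_def sum_index_box_Suc)
  also have "\<dots> = (\<Sum>i\<le>K. c m i * tensor_sum m K c (\<lambda>\<mu>. U (\<mu>(m := i))))"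
    by (subst sum.swap) (simp add: tensor_sum_def sum_distrib_left mult_ac)
  finally show ?thesis .
qed

text \<open>One-dimensional operator norms multiply, by induction on the number of variables.
  Coordinates from m on stay at \<open>p 0\<close> because that is the value of every grid point
  there.\<close>

lemma tensor_functional_bound:
  fixes F :: "(nat \<Rightarrow> complex) \<Rightarrow> complex" and c :: "nat \<Rightarrow> nat \<Rightarrow> complex" and p :: "nat \<Rightarrow> complex"
  assumes "\<And>j g B. j < m \<Longrightarrow> g holomorphic_on D j \<Longrightarrow> (\<And>z. z \<in> D j \<Longrightarrow> cmod (g z) \<le> B) \<Longrightarrow>
      cmod (\<Sum>i\<le>K. c j i * g (p i)) \<le> B * \<kappa> j"
    and "\<And>i j. j < m \<Longrightarrow> p i \<in> D j"
    and "\<And>z j. (\<And>j. j < m \<Longrightarrow> z j \<in> D j) \<Longrightarrow> (\<And>j. m \<le> j \<Longrightarrow> z j = p 0) \<Longrightarrow> j < m \<Longrightarrow>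
      (\<lambda>x. F (z(j := x))) holomorphic_on D j"
    and "\<And>z. (\<And>j. j < m \<Longrightarrow> z j \<in> D j) \<Longrightarrow> (\<And>j. m \<le> j \<Longrightarrow> z j = p 0) \<Longrightarrow> cmod (F z) \<le> M"
  shows "cmod (tensor_sum m K c (\<lambda>\<mu>. F (\<lambda>j. p (\<mu> j)))) \<le> M * (\<Prod>j<m. \<kappa> j)"
  using assms
proof (induction m arbitrary: F)
  case 0
  then show ?case by (simp add: tensor_sum_def)
next
  case (Suc m)
  note fb = Suc.prems(1) and pD = Suc.prems(2) and hol = Suc.prems(3) and bd = Suc.prems(4)
  \<comment> \<open>The first m functionals are applied with the last variable left free. The result
    is holomorphic in that variable and bounded by the induction hypothesis, so the last functional
    can be applied to it.\<close>
  define g where "g = (\<lambda>x. tensor_sum m K c (\<lambda>\<mu>. F ((\<lambda>j. p (\<mu> j))(m := x))))"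
  have "(\<lambda>j. p ((\<mu>(m := i)) j)) = (\<lambda>j. p (\<mu> j))(m := p i)" for \<mu> :: "nat \<Rightarrow> nat" and i
    by auto
  then have "tensor_sum (Suc m) K c (\<lambda>\<mu>. F (\<lambda>j. p (\<mu> j))) = (\<Sum>i\<le>K. c m i * g (p i))"
    by (simp add: tensor_sum_Suc g_def)
  also have "cmod \<dots> \<le> (M * (\<Prod>j<m. \<kappa> j)) * \<kappa> m"
  proof (rule fb)
    show "g holomorphic_on D m"
      unfolding g_def tensor_sum_def
    proof (intro holomorphic_intros)
      fix \<mu> assume "\<mu> \<in> cube_indices m K"
      then show "(\<lambda>x. F ((\<lambda>j. p (\<mu> j))(m := x))) holomorphic_on D m"
        using pD by (intro hol) (auto simp: index_box_def)
    qed
  next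
    fix x assume x: "x \<in> D m"
    show "cmod (g x) \<le> M * (\<Prod>j<m. \<kappa> j)"
      unfolding g_def
    proof (rule Suc.IH[where F = "\<lambda>z. F (z(m := x))"])
      fix z j assume z: "\<And>j. j < m \<Longrightarrow> z j \<in> D j" "\<And>j. m \<le> j \<Longrightarrow> z j = p 0" "j < m"
      then have "(\<lambda>x'. F ((z(m := x))(j := x'))) holomorphic_on D j"
        using x by (intro hol) (auto simp: less_Suc_eq)
      then show "(\<lambda>x'. F ((z(j := x'))(m := x))) holomorphic_on D j"
        using z(3) by (simp add: fun_upd_twist)
    next
      fix z assume z: "\<And>j. j < m \<Longrightarrow> z j \<in> D j" "\<And>j. m \<le> j \<Longrightarrow> z j = p 0"
      then show "cmod (F (z(m := x))) \<le> M"
        using x by (intro bd) (auto simp: less_Suc_eq)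
    qed (use fb pD in auto)
  qed simp
  finally show ?case by (simp add: mult.assoc)
qed

lemma finite_support_cube: "\<nu> \<in> cube_indices m K \<Longrightarrow> finite {j. \<nu> j \<noteq> 0}"
  using index_box_subset_multiindices multiindices_iff by blast

text \<open>The \<beta>_\<nu> of the overview. The factor A * n * b_j is a constant times the
  reciprocal of the additional radius in coordinate j; one power of the geometric decay is spent on
  it, hence the exponent \<nu>_j - 1.\<close>

definition surplus_bound :: "(nat \<Rightarrow> real) \<Rightarrow> real \<Rightarrow> real \<Rightarrow> real \<Rightarrow> (nat \<Rightarrow> nat) \<Rightarrow> real" where
  "surplus_bound b A \<tau> q \<nu> =
     (\<Prod>j | \<nu> j \<noteq> 0. A * real (card {j. \<nu> j \<noteq> 0}) * b j * (1 + real (\<nu> j)) powr \<tau> * q ^ (\<nu> j - 1))"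

lemma prod_support:
  assumes "\<nu> \<in> cube_indices m K"
  shows "(\<Prod>j | \<nu> j \<noteq> 0. f j) = (\<Prod>j<m. if \<nu> j = 0 then 1 else f j)"
proof -
  have "{j. \<nu> j \<noteq> 0} \<subseteq> {..<m}" using assms by (auto simp: index_box_def intro: leI)
  then have "(\<Prod>j<m. if \<nu> j = 0 then 1 else f j) = (\<Prod>j | \<nu> j \<noteq> 0. if \<nu> j = 0 then 1 else f j)"
    by (intro prod.mono_neutral_right) auto
  also have "\<dots> = (\<Prod>j | \<nu> j \<noteq> 0. f j)" by (rule prod.cong) auto
  finally show ?thesis ..
qed

context interpolation_nodes
begin

lemma tensor_surplus_bound:
  fixes F :: "(nat \<Rightarrow> complex) \<Rightarrow> complex"
  defines "n \<equiv> \<lambda>\<nu>. real (card {j. \<nu> j \<noteq> (0::nat)})"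
  assumes y: "y \<in> cube" and \<nu>: "\<nu> \<in> cube_indices m K" and b: "\<And>j. b j > 0" and d: "d0 > 0" "e > 0"
  defines "D \<equiv> \<lambda>j. interval_nbhd (2 * (d0 + (if \<nu> j = 0 then 0 else e / (n \<nu> * b j))))"
  assumes hol: "\<And>z j. (\<And>j. j < m \<Longrightarrow> z j \<in> D j) \<Longrightarrow> (\<And>j. m \<le> j \<Longrightarrow> z j = of_real (\<xi> 0)) \<Longrightarrow> j < m \<Longrightarrow>
      (\<lambda>x. F (z(j := x))) holomorphic_on D j"
    and bd: "\<And>z. (\<And>j. j < m \<Longrightarrow> z j \<in> D j) \<Longrightarrow> (\<And>j. m \<le> j \<Longrightarrow> z j = of_real (\<xi> 0)) \<Longrightarrow> cmod (F z) \<le> M"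
  shows "cmod (tensor_sum m K (\<lambda>j i. of_real (lagrange_diff \<xi> (\<nu> j) i (y j))) (\<lambda>\<mu>. F (\<lambda>j. of_real (\<xi> (\<mu> j)))))
    \<le> M * surplus_bound b (node_const d0 / e) \<tau> (1 / (1 + d0)) \<nu>"
proof -
  define \<kappa> where "\<kappa> = (\<lambda>j. if \<nu> j = 0 then 1 else
      node_const d0 / e * n \<nu> * b j * (1 + real (\<nu> j)) powr \<tau> * (1 / (1 + d0)) ^ (\<nu> j - 1))"
  have supp: "finite {j. \<nu> j \<noteq> 0}"
    by (rule finite_support_cube[OF \<nu>])
  have nc: "0 \<le> node_const d0" using d by (simp add: node_const_def)
  have pD: "of_real (\<xi> i) \<in> D j" for i j
  proof -
    have "0 \<le> e / (n \<nu> * b j)" using d b[of j] by (simp add: n_def)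
    then show ?thesis unfolding D_def using nodes d by (intro of_real_in_interval_nbhd) (auto simp: add_pos_nonneg)
  qed
  have "cmod (tensor_sum m K (\<lambda>j i. of_real (lagrange_diff \<xi> (\<nu> j) i (y j))) (\<lambda>\<mu>. F (\<lambda>j. of_real (\<xi> (\<mu> j)))))
      \<le> M * (\<Prod>j<m. \<kappa> j)"
  proof (rule tensor_functional_bound[where D = D and p = "\<lambda>i. of_real (\<xi> i)"])
    fix j g B
    assume j: "j < m" and g: "g holomorphic_on D j" "\<And>z. z \<in> D j \<Longrightarrow> cmod (g z) \<le> B"
    have B: "0 \<le> B" using g(2)[OF pD[of 0 j]] norm_ge_zero order_trans by blast
    show "cmod (\<Sum>i\<le>K. of_real (lagrange_diff \<xi> (\<nu> j) i (y j)) * g (of_real (\<xi> i))) \<le> B * \<kappa> j"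
    proof (cases "\<nu> j = 0")
      case True
      have "(\<Sum>i\<le>K. of_real (lagrange_diff \<xi> 0 i (y j)) * g (of_real (\<xi> i))) =
          (\<Sum>i\<in>{0}. of_real (lagrange_diff \<xi> 0 i (y j)) * g (of_real (\<xi> i)))"
        by (intro sum.mono_neutral_right) (auto simp: lagrange_diff_eq_0)
      then show ?thesis
        using True g(2)[OF pD[of 0 j]] by (simp add: \<kappa>_def lagrange_diff_def lagrange_basis_def)
    next
      case False
      define d where "d = d0 + e / (n \<nu> * b j)"
      have D: "D j = interval_nbhd (2 * d)" using False by (simp add: D_def d_def)
      have "card {j. \<nu> j \<noteq> 0} > 0" using False supp by (auto simp: card_gt_0_iff)
      then have n: "n \<nu> > 0" by (simp add: n_def)
      have epos: "e / (n \<nu> * b j) > 0" using \<open>e > 0\<close> n b[of j] by simp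
      have d0d: "d0 \<le> d" using epos by (simp add: d_def)
      have "cmod (\<Sum>i\<le>K. of_real (lagrange_diff \<xi> (\<nu> j) i (y j)) * g (of_real (\<xi> i)))
          \<le> B * (node_const d0 * (1 + real (\<nu> j)) powr \<tau> / (1 + d) ^ (\<nu> j))"
        using y \<nu> j False g \<open>d0 > 0\<close> d0d
        by (intro diff_functional_bound) (auto simp: D cube_def index_box_def)
      also have "\<dots> \<le> B * \<kappa> j"
      proof (rule mult_left_mono[OF _ B])
        \<comment> \<open>One of the \<nu>_j equal factors uses the large part e / (n * b_j) of the
          radius and yields smallness in j; the others use only d0 and yield decay in
          \<nu>_j.\<close>
        have "1 / (1 + d) ^ \<nu> j = (1 / (1 + d)) * (1 / (1 + d)) ^ (\<nu> j - 1)"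
          using False by (simp add: power_one_over flip: power_Suc)
        also have "\<dots> \<le> (1 / (e / (n \<nu> * b j))) * (1 / (1 + d0)) ^ (\<nu> j - 1)"
        proof (intro mult_mono power_mono)
          show "1 / (1 + d) \<le> 1 / (e / (n \<nu> * b j))" "1 / (1 + d) \<le> 1 / (1 + d0)"
            using epos d0d \<open>d0 > 0\<close> by (intro frac_le; simp add: d_def)+
          show "0 \<le> 1 / (e / (n \<nu> * b j))" using epos by (rule divide_nonneg_pos[rotated]) simp
        qed (use \<open>d0 > 0\<close> d0d in auto)
        finally have "node_const d0 * (1 + real (\<nu> j)) powr \<tau> * (1 / (1 + d) ^ \<nu> j) \<le>
          node_const d0 * (1 + real (\<nu> j)) powr \<tau> * ((1 / (e / (n \<nu> * b j))) * (1 / (1 + d0)) ^ (\<nu> j - 1))"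
          using nc by (intro mult_left_mono) auto
        then show "node_const d0 * (1 + real (\<nu> j)) powr \<tau> / (1 + d) ^ \<nu> j \<le> \<kappa> j"
          using False by (simp add: \<kappa>_def mult_ac)
      qed
      finally show ?thesis .
    qed
  qed (use pD hol bd in \<open>auto simp del: fun_upd_apply\<close>)
  also have "(\<Prod>j<m. \<kappa> j) = surplus_bound b (node_const d0 / e) \<tau> (1 / (1 + d0)) \<nu>"
    unfolding surplus_bound_def prod_support[OF \<nu>] \<kappa>_def n_def ..
  finally show ?thesis .
qed

text \<open>The grid value of one coordinate after the other is replaced by the true value y_j.
  Convergence for fixed m suffices here; the limit in m is taken separately.\<close>

lemma tensor_interpolant_tendsto:
  fixes F :: "(nat \<Rightarrow> complex) \<Rightarrow> complex"
  assumes y: "y \<in> cube" and d: "d > 0"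
    and "\<And>z j. (\<And>j. j < m \<Longrightarrow> z j \<in> interval_nbhd (2 * d)) \<Longrightarrow> (\<And>j. m \<le> j \<Longrightarrow> z j = of_real (\<xi> 0)) \<Longrightarrow> j < m \<Longrightarrow>
      (\<lambda>x. F (z(j := x))) holomorphic_on interval_nbhd (2 * d)"
    and "\<And>z. (\<And>j. j < m \<Longrightarrow> z j \<in> interval_nbhd (2 * d)) \<Longrightarrow> (\<And>j. m \<le> j \<Longrightarrow> z j = of_real (\<xi> 0)) \<Longrightarrow> cmod (F z) \<le> M"
  shows "(\<lambda>k. tensor_sum m k (\<lambda>j i. of_real (lagrange_basis \<xi> k i (y j))) (\<lambda>\<mu>. F (\<lambda>j. of_real (\<xi> (\<mu> j)))))
    \<longlonglongrightarrow> F (\<lambda>j. of_real (if j < m then y j else \<xi> 0))"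
  using assms(3-)
proof (induction m arbitrary: F)
  case 0
  then show ?case by (simp add: tensor_sum_def)
next
  case (Suc m)
  note hol = Suc.prems(1) and bd = Suc.prems(2)
  define c :: "nat \<Rightarrow> nat \<Rightarrow> nat \<Rightarrow> complex" where "c = (\<lambda>k j i. of_real (lagrange_basis \<xi> k i (y j)))"
  define p :: "nat \<Rightarrow> complex" where "p = (\<lambda>i. of_real (\<xi> i))"
  let ?D = "interval_nbhd (2 * d)"
  have yD: "of_real (y j) \<in> ?D" for j
    using y d by (intro of_real_in_interval_nbhd) (auto simp: cube_def)
  have pD: "p i \<in> ?D" for i
    unfolding p_def using nodes d by (intro of_real_in_interval_nbhd) auto
  \<comment> \<open>Interpolation error in the last variable alone, as a function of the
    others.\<close>
  define H where "H = (\<lambda>k z. (\<Sum>i\<le>k. c k m i * F (z(m := p i))) - F (z(m := of_real (y m))))"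
  have upd: "(\<lambda>j. p ((\<mu>(m := i)) j)) = (\<lambda>j. p (\<mu> j))(m := p i)" for \<mu> :: "nat \<Rightarrow> nat" and i
    by auto
  have hol': "(\<lambda>x'. F ((z(j := x'))(m := x))) holomorphic_on ?D"
    if "x \<in> ?D" "\<And>j. j < m \<Longrightarrow> z j \<in> ?D" "\<And>j. m \<le> j \<Longrightarrow> z j = p 0" "j < m" for z j x
  proof -
    have "(\<lambda>x'. F ((z(m := x))(j := x'))) holomorphic_on ?D"
      using that by (intro hol) (auto simp: less_Suc_eq p_def)
    then show ?thesis using that(4) by (simp add: fun_upd_twist)
  qed
  have bd': "cmod (F (z(m := x))) \<le> M"
    if "x \<in> ?D" "\<And>j. j < m \<Longrightarrow> z j \<in> ?D" "\<And>j. m \<le> j \<Longrightarrow> z j = p 0" for z x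
    using that by (intro bd) (auto simp: less_Suc_eq p_def)
  have split: "tensor_sum (Suc m) k (c k) (\<lambda>\<mu>. F (\<lambda>j. p (\<mu> j))) =
      tensor_sum m k (c k) (\<lambda>\<mu>. H k (\<lambda>j. p (\<mu> j))) +
      tensor_sum m k (c k) (\<lambda>\<mu>. F ((\<lambda>j. p (\<mu> j))(m := of_real (y m))))" for k
  proof -
    have "tensor_sum (Suc m) k (c k) (\<lambda>\<mu>. F (\<lambda>j. p (\<mu> j))) =
        (\<Sum>i\<le>k. c k m i * tensor_sum m k (c k) (\<lambda>\<mu>. F ((\<lambda>j. p (\<mu> j))(m := p i))))"
      by (simp add: tensor_sum_Suc upd del: fun_upd_apply)
    also have "\<dots> = tensor_sum m k (c k) (\<lambda>\<mu>. \<Sum>i\<le>k. c k m i * F ((\<lambda>j. p (\<mu> j))(m := p i)))"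
      unfolding tensor_sum_def sum_distrib_left by (subst sum.swap) (simp add: mult_ac)
    finally show ?thesis
      by (simp add: tensor_sum_def H_def algebra_simps sum.distrib[symmetric])
  qed
  \<comment> \<open>The error in the last variable decays geometrically in k, whereas the other m
    interpolation operators amplify it only by a fixed power of 1 + k.\<close>
  have small: "cmod (tensor_sum m k (c k) (\<lambda>\<mu>. H k (\<lambda>j. p (\<mu> j)))) \<le>
      M * node_const d * ((1 + real k) powr (\<tau> * (1 + real m)) / (1 + d) ^ k)" if k: "k \<ge> 1" for k
  proof -
    have "cmod (tensor_sum m k (c k) (\<lambda>\<mu>. H k (\<lambda>j. p (\<mu> j)))) \<le>
      (M * (node_const d * (1 + real k) powr \<tau> / (1 + d) ^ k)) * (\<Prod>j<m. (1 + real k) powr \<tau>)"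
    proof (rule tensor_functional_bound[where D = "\<lambda>_. ?D" and p = p])
      fix j g B
      assume g: "\<And>z. z \<in> ?D \<Longrightarrow> cmod (g z) \<le> B"
      show "cmod (\<Sum>i\<le>k. c k j i * g (p i)) \<le> B * (1 + real k) powr \<tau>"
        unfolding c_def p_def using y d g by (intro basis_functional_bound) (auto simp: cube_def)
    next
      fix z j assume z: "\<And>j. j < m \<Longrightarrow> z j \<in> ?D" "\<And>j. m \<le> j \<Longrightarrow> z j = p 0" "j < m"
      show "(\<lambda>x. H k (z(j := x))) holomorphic_on ?D"
        unfolding H_def using z yD pD by (intro holomorphic_intros hol') auto
    next
      fix z assume z: "\<And>j. j < m \<Longrightarrow> z j \<in> ?D" "\<And>j. m \<le> j \<Longrightarrow> z j = p 0"
      show "cmod (H k z) \<le> M * (node_const d * (1 + real k) powr \<tau> / (1 + d) ^ k)"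
        unfolding H_def c_def p_def
      proof (rule interpolation_error_bound[OF _ k d, where g = "\<lambda>x. F (z(m := x))"])
        show "(\<lambda>x. F (z(m := x))) holomorphic_on ?D"
          using z pD by (intro hol) (auto simp: p_def less_Suc_eq)
      qed (use y z bd' in \<open>auto simp: cube_def\<close>)
    qed (rule pD)
    also have "\<dots> = M * node_const d * ((1 + real k) powr (\<tau> * (1 + real m)) / (1 + d) ^ k)"
      by (simp add: powr_power powr_add algebra_simps)
    finally show ?thesis .
  qed
  have "(\<lambda>k. M * node_const d * ((1 + real k) powr (\<tau> * (1 + real m)) / (1 + d) ^ k)) \<longlonglongrightarrow> M * node_const d * 0"
    using d by (intro tendsto_mult_left) real_asymp
  then have lim0: "(\<lambda>k. M * node_const d * ((1 + real k) powr (\<tau> * (1 + real m)) / (1 + d) ^ k)) \<longlonglongrightarrow> 0"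
    by simp
  have "(\<lambda>k. tensor_sum m k (c k) (\<lambda>\<mu>. H k (\<lambda>j. p (\<mu> j)))) \<longlonglongrightarrow> 0"
    by (rule Lim_null_comparison[OF _ lim0]) (use small in \<open>auto simp: eventually_sequentially\<close>)
  moreover have "(\<lambda>k. tensor_sum m k (c k) (\<lambda>\<mu>. F ((\<lambda>j. p (\<mu> j))(m := of_real (y m)))))
     \<longlonglongrightarrow> F ((\<lambda>j. of_real (if j < m then y j else \<xi> 0))(m := of_real (y m)))"
    unfolding c_def p_def
    by (rule Suc.IH[where F = "\<lambda>z. F (z(m := of_real (y m)))"])
       (auto intro!: hol' bd' yD simp: p_def simp del: fun_upd_apply)
  ultimately have "(\<lambda>k. tensor_sum (Suc m) k (c k) (\<lambda>\<mu>. F (\<lambda>j. p (\<mu> j)))) \<longlonglongrightarrow>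
     0 + F ((\<lambda>j. of_real (if j < m then y j else \<xi> 0))(m := of_real (y m)))"
    unfolding split by (rule tendsto_add)
  also have "(\<lambda>j. of_real (if j < m then y j else \<xi> 0))(m := of_real (y m)) =
      (\<lambda>j. complex_of_real (if j < Suc m then y j else \<xi> 0))"
    by (auto simp: less_Suc_eq)
  finally show ?case by (simp add: c_def p_def)
qed

end

section \<open>Summability of the surplus bounds\<close>

lemma summable_powr_times_power:
  assumes "0 < q" "q < (1::real)"
  shows "summable (\<lambda>k. (1 + real k) powr a * q ^ k)"
proof -
  define c where "c = - ln q"
  have c: "c > 0" using assms by (simp add: c_def)
  have q: "q = exp (- c)" using assms by (simp add: c_def)
  have "summable (\<lambda>k. exp (- c / 2) ^ k)" using c by (intro summable_geometric) simp
  then have "summable (\<lambda>k. norm (exp (- c / 2) ^ k))" by simp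
  moreover have "(\<lambda>k. (1 + real k) powr a * exp (- c) ^ k) \<in> O(\<lambda>k. exp (- c / 2) ^ k)"
    unfolding exp_of_nat_mult[symmetric] using c by real_asymp
  ultimately show ?thesis unfolding q by (rule summable_comparison_test_bigo)
qed

text \<open>The multiindices are grouped by the size n of their support. Each support coordinate
  carries n powr p, split as n * n powr (p - 1). The factors n enter a product over all coordinates
  that is at most exp (n * T * X), and the rest is n powr ((p - 1) * n), which wins because p <
  1.\<close>

lemma surplus_bound_summable:
  assumes b: "\<And>j. b j > 0" "summable (\<lambda>j. b j powr p)" and p: "0 < p" "p < 1"
    and A: "A > 0" and q: "0 < q" "q < 1"
  shows "\<exists>S>0. \<forall>m K. (\<Sum>\<nu>\<in>cube_indices m K. (\<Prod>j<m. 1 + real (\<nu> j)) * surplus_bound b A \<tau> q \<nu> powr p) \<le> S"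
proof -
  \<comment> \<open>The summand 1 in the exponent accommodates the weight 1 + \<nu>_j.\<close>
  define a where "a = (\<lambda>k. A powr p * ((1 + real k) powr (\<tau> * p + 1) * (q powr p) ^ (k - 1)))"
  define X where "X = (\<Sum>j. b j powr p)"
  have qp: "q powr p < 1" "0 < q powr p" using q p powr_less_mono2[of p q 1] by auto
  have suma: "summable a"
  proof (rule summable_comparison_test')
    show "summable (\<lambda>k. A powr p / (q powr p) * ((1 + real k) powr (\<tau> * p + 1) * (q powr p) ^ k))"
      using qp by (intro summable_mult summable_powr_times_power)
    fix k
    have "(q powr p) ^ (k - 1) \<le> (q powr p) ^ k / (q powr p)"
      using qp by (cases k) auto
    then have "A powr p * ((1 + real k) powr (\<tau> * p + 1) * (q powr p) ^ (k - 1)) \<le>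
        A powr p * ((1 + real k) powr (\<tau> * p + 1) * ((q powr p) ^ k / (q powr p)))"
      by (intro mult_left_mono) auto
    then show "norm (a k) \<le> A powr p / (q powr p) * ((1 + real k) powr (\<tau> * p + 1) * (q powr p) ^ k)"
      by (simp add: a_def)
  qed
  have a0: "a k \<ge> 0" for k by (simp add: a_def)
  define T where "T = suminf a"
  have T: "(\<Sum>k=1..K. a k) \<le> T" for K
    unfolding T_def using suma a0 by (intro sum_le_suminf) auto
  have T0: "T \<ge> 0" using T[of 0] by simp
  have X: "(\<Sum>j<m. b j powr p) \<le> X" for m
    unfolding X_def using b by (intro sum_le_suminf) auto
  \<comment> \<open>The bound for support size n. The base tends to 0, so the series is eventually
    dominated by powers of 1 / 2.\<close>
  define g where "g = (\<lambda>n. (exp (T * X) * real n powr (p - 1)) ^ n)"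
  have "summable g"
  proof (rule summable_comparison_test_ev)
    have "(\<lambda>n. exp (T * X) * real n powr (p - 1)) \<longlonglongrightarrow> exp (T * X) * 0"
      using p by (intro tendsto_mult_left) real_asymp
    then have "\<forall>\<^sub>F n in sequentially. exp (T * X) * real n powr (p - 1) < 1 / 2"
      by (rule order_tendstoD) simp
    then show "\<forall>\<^sub>F n in sequentially. norm (g n) \<le> (1 / 2) ^ n"
      by eventually_elim (auto simp: g_def abs_mult power_abs intro!: power_mono)
  qed (simp add: summable_geometric)
  have g0: "g n \<ge> 0" for n by (simp add: g_def)
  define \<beta> where "\<beta> = (\<lambda>\<nu>::nat \<Rightarrow> nat. surplus_bound b A \<tau> q \<nu> powr p)"
  have level: "(\<Sum>\<nu> | \<nu> \<in> cube_indices m K \<and> card {j. \<nu> j \<noteq> 0} = n. (\<Prod>j<m. 1 + real (\<nu> j)) * \<beta> \<nu>) \<le> g n" for m K n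
  proof -
    define h where "h = (\<lambda>j k. if k = 0 then 1 else real n * b j powr p * a k)"
    have h0: "h j k \<ge> 0" for j k by (simp add: h_def a0)
    \<comment> \<open>The case n = 0 is separate because \<open>0 powr 0\<close> is 0, while the
      empty product is 1.\<close>
    define C where "C = (if n = 0 then 1 else real n powr ((p - 1) * real n))"
    have C0: "C \<ge> 0" by (simp add: C_def)
    have summand: "(\<Prod>j<m. 1 + real (\<nu> j)) * \<beta> \<nu> = C * (\<Prod>j<m. h j (\<nu> j))"
      if \<nu>: "\<nu> \<in> cube_indices m K" "card {j. \<nu> j \<noteq> 0} = n" for \<nu>
    proof -
      have pos: "0 < A * real n * b j * (1 + real (\<nu> j)) powr \<tau> * q ^ (\<nu> j - 1)" if "\<nu> j \<noteq> 0" for j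
      proof -
        have "finite {j. \<nu> j \<noteq> 0}"
          by (rule finite_support_cube[OF \<nu>(1)])
        then have "n > 0" using that \<nu>(2) by (auto simp: card_gt_0_iff)
        then show ?thesis using A b q by simp
      qed
      have "(\<Prod>j<m. 1 + real (\<nu> j)) * \<beta> \<nu> = (\<Prod>j<m. 1 + real (\<nu> j)) *
        (\<Prod>j<m. if \<nu> j = 0 then 1 else A * real n * b j * (1 + real (\<nu> j)) powr \<tau> * q ^ (\<nu> j - 1)) powr p"
        unfolding \<beta>_def surplus_bound_def prod_support[OF \<nu>(1)] \<nu>(2) ..
      also have "\<dots> = (\<Prod>j<m. (1 + real (\<nu> j)) *
        (if \<nu> j = 0 then 1 else A * real n * b j * (1 + real (\<nu> j)) powr \<tau> * q ^ (\<nu> j - 1)) powr p)"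
        unfolding prod.distrib by (subst prod_powr_distrib) (use pos in \<open>auto intro!: less_imp_le\<close>)
      also have "\<dots> = (\<Prod>j<m. h j (\<nu> j) * (if \<nu> j = 0 then 1 else real n powr (p - 1)))"
      proof (rule prod.cong[OF refl])
        fix j
        show "(1 + real (\<nu> j)) * (if \<nu> j = 0 then 1 else A * real n * b j * (1 + real (\<nu> j)) powr \<tau> * q ^ (\<nu> j - 1)) powr p
          = h j (\<nu> j) * (if \<nu> j = 0 then 1 else real n powr (p - 1))"
        proof (cases "\<nu> j = 0")
          case False
          then have n: "real n > 0" using pos[OF False] by (cases "n = 0") auto
          have qk: "(q ^ k) powr p = (q powr p) ^ k" for k
            using q by (simp add: powr_power powr_powr mult.commute flip: powr_realpow)
          have "(A * real n * b j * (1 + real (\<nu> j)) powr \<tau> * q ^ (\<nu> j - 1)) powr p =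
             A powr p * (real n powr p) * b j powr p * (1 + real (\<nu> j)) powr (\<tau> * p) * (q powr p) ^ (\<nu> j - 1)"
            using A b(1)[of j] q n by (simp add: powr_mult powr_powr qk)
          moreover have "real n powr p = real n * real n powr (p - 1)"
            using n by (simp add: powr_diff)
          moreover have "(1 + real (\<nu> j)) powr (\<tau> * p + 1) = (1 + real (\<nu> j)) powr (\<tau> * p) * (1 + real (\<nu> j))"
            by (simp add: powr_add)
          ultimately show ?thesis using False by (simp add: h_def a_def mult_ac)
        qed (simp add: h_def)
      qed
      also have "\<dots> = (\<Prod>j<m. h j (\<nu> j)) * (\<Prod>j | \<nu> j \<noteq> 0. real n powr (p - 1))"
        unfolding prod.distrib prod_support[OF \<nu>(1)] ..
      also have "(\<Prod>j | \<nu> j \<noteq> 0. real n powr (p - 1)) = C"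
        by (simp only: prod_constant \<nu>(2)) (simp add: C_def powr_power mult.commute)
      finally show ?thesis by (simp add: mult.commute)
    qed
    have "(\<Sum>\<nu> | \<nu> \<in> cube_indices m K \<and> card {j. \<nu> j \<noteq> 0} = n. (\<Prod>j<m. 1 + real (\<nu> j)) * \<beta> \<nu>) =
        (\<Sum>\<nu> | \<nu> \<in> cube_indices m K \<and> card {j. \<nu> j \<noteq> 0} = n. C * (\<Prod>j<m. h j (\<nu> j)))"
      by (rule sum.cong) (auto simp: summand)
    \<comment> \<open>With n frozen inside h, the restriction on the support is dropped; only then
      does the sum factor over the coordinates.\<close>
    also have "\<dots> \<le> (\<Sum>\<nu>\<in>cube_indices m K. C * (\<Prod>j<m. h j (\<nu> j)))"
      by (intro sum_mono2 finite_index_box) (auto intro!: mult_nonneg_nonneg prod_nonneg simp: C0 h0)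
    also have "\<dots> = C * (\<Prod>j<m. \<Sum>k\<le>K. h j k)"
      by (simp add: prod_sum_index_box sum_distrib_left)
    also have "\<dots> \<le> C * (\<Prod>j<m. exp (real n * T * b j powr p))"
    proof (intro mult_left_mono prod_mono conjI C0 sum_nonneg h0)
      fix j
      have "(\<Sum>k\<le>K. h j k) = 1 + real n * b j powr p * (\<Sum>k=1..K. a k)"
        by (simp add: atMost_atLeast0 sum.atLeast_Suc_atMost h_def sum_distrib_left)
      also have "\<dots> \<le> 1 + real n * b j powr p * T"
        by (intro add_left_mono mult_left_mono T) auto
      also have "\<dots> \<le> exp (real n * T * b j powr p)"
        using exp_ge_add_one_self[of "real n * T * b j powr p"] by (simp add: mult_ac)
      finally show "(\<Sum>k\<le>K. h j k) \<le> exp (real n * T * b j powr p)" .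
    qed
    also have "\<dots> = C * exp (real n * T * (\<Sum>j<m. b j powr p))"
      by (simp add: exp_sum sum_distrib_left)
    also have "\<dots> \<le> C * exp (real n * T * X)"
      using C0 T0 X by (intro mult_left_mono) (auto intro!: mult_left_mono)
    also have "\<dots> = g n"
      by (cases "n = 0") (auto simp: C_def g_def power_mult_distrib powr_power exp_of_nat_mult[symmetric] mult_ac)
    finally show ?thesis .
  qed
  have "(\<Sum>\<nu>\<in>cube_indices m K. (\<Prod>j<m. 1 + real (\<nu> j)) * \<beta> \<nu>) \<le> suminf g + 1" for m K
  proof -
    have fin: "finite (cube_indices m K)" by (rule finite_index_box) auto
    have "(\<Sum>\<nu>\<in>cube_indices m K. (\<Prod>j<m. 1 + real (\<nu> j)) * \<beta> \<nu>) =
      (\<Sum>n\<in>(\<lambda>\<nu>. card {j. \<nu> j \<noteq> 0}) ` cube_indices m K.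
         \<Sum>\<nu> | \<nu> \<in> cube_indices m K \<and> card {j. \<nu> j \<noteq> 0} = n. (\<Prod>j<m. 1 + real (\<nu> j)) * \<beta> \<nu>)"
      by (rule sum.image_gen[OF fin])
    also have "\<dots> \<le> (\<Sum>n\<in>(\<lambda>\<nu>. card {j. \<nu> j \<noteq> 0}) ` cube_indices m K. g n)"
      by (intro sum_mono level)
    also have "\<dots> \<le> suminf g"
      using \<open>summable g\<close> fin g0 by (intro sum_le_suminf) auto
    finally show ?thesis by simp
  qed
  moreover have "suminf g + 1 > 0"
    using suminf_nonneg[OF \<open>summable g\<close>] g0 by (simp add: add_nonneg_pos)
  ultimately show ?thesis unfolding \<beta>_def by blast
qed

subsection \<open>Frames\<close>

text \<open>Stated for the sort that the Hilbert spaces of the theorem provide: a norm together with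
  \<open>complete_space\<close>.\<close>

lemma summable_Cauchy_complete:
  fixes f :: "nat \<Rightarrow> 'a::{real_normed_vector, complete_space}"
  assumes "\<And>e. e > 0 \<Longrightarrow> \<exists>N. \<forall>m\<ge>N. \<forall>n. norm (sum f {m..<n}) < e"
  shows "summable f"
proof -
  have "Cauchy (\<lambda>n. sum f {..<n})"
  proof (rule metric_CauchyI)
    fix e :: real assume "e > 0"
    then obtain N where N: "\<And>m n. m \<ge> N \<Longrightarrow> norm (sum f {m..<n}) < e" using assms by blast
    have *: "dist (sum f {..<n}) (sum f {..<m}) < e" if "m \<ge> N" "m \<le> n" for m n
      using N[OF that(1), of n] sum_diff_nat_ivl[of 0 m n f] that(2) by (simp add: dist_norm lessThan_atLeast0)
    have "dist (sum f {..<m}) (sum f {..<n}) < e" if "m \<ge> N" "n \<ge> N" for m n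
      using *[of m n] *[of n m] that by (cases "m \<le> n") (auto simp: dist_commute)
    then show "\<exists>N. \<forall>m\<ge>N. \<forall>n\<ge>N. dist (sum f {..<m}) (sum f {..<n}) < e" by blast
  qed
  then show ?thesis
    using Cauchy_convergent by (auto simp: summable_def sums_def convergent_def)
qed

lemma summable_norm_comparison_complete:
  fixes f :: "nat \<Rightarrow> 'a::{real_normed_vector, complete_space}"
  assumes f: "\<And>n. norm (f n) \<le> g n" and g: "summable g"
  shows "summable f" and "norm (suminf f - sum f {..<n}) \<le> (\<Sum>j. g (j + n))"
proof -
  have le: "norm (sum f {m..<n}) \<le> sum g {m..<n}" for m n
    using f by (rule sum_norm_le)
  show sf: "summable f"
  proof (rule summable_Cauchy_complete)
    fix e :: real assume "e > 0"
    then obtain N where N: "\<forall>m\<ge>N. \<forall>n. norm (sum g {m..<n}) < e"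
      using g unfolding summable_Cauchy by blast
    have "norm (sum f {m..<n}) < e" if "m \<ge> N" for m n
    proof -
      have "norm (sum f {m..<n}) \<le> sum g {m..<n}" by (rule le)
      also have "\<dots> \<le> norm (sum g {m..<n})" by simp
      also have "\<dots> < e" using N that by blast
      finally show ?thesis .
    qed
    then show "\<exists>N. \<forall>m\<ge>N. \<forall>n. norm (sum f {m..<n}) < e" by blast
  qed
  have g0: "0 \<le> g k" for k using f[of k] norm_ge_zero order_trans by blast
  have "norm (sum f {..<k} - sum f {..<n}) \<le> (\<Sum>j. g (j + n))" if "k \<ge> n" for k
  proof -
    have "sum f {..<k} - sum f {..<n} = sum f {n..<k}"
      using sum_diff_nat_ivl[of 0 n k f] that by (simp add: lessThan_atLeast0)
    also have "norm \<dots> \<le> sum g {n..<k}" by (rule le)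
    also have "\<dots> = (\<Sum>j<k - n. g (j + n))"
      using that by (simp add: lessThan_atLeast0 flip: sum.shift_bounds_nat_ivl)
    also have "\<dots> \<le> (\<Sum>j. g (j + n))"
      using summable_ignore_initial_segment[OF g, of n] g0 by (intro sum_le_suminf) auto
    finally show ?thesis .
  qed
  then have "\<forall>\<^sub>F k in sequentially. norm (sum f {..<k} - sum f {..<n}) \<le> (\<Sum>j. g (j + n))"
    by (auto simp: eventually_sequentially)
  moreover have "(\<lambda>k. norm (sum f {..<k} - sum f {..<n})) \<longlonglongrightarrow> norm (suminf f - sum f {..<n})"
    using summable_LIMSEQ[OF sf] by (intro tendsto_intros)
  ultimately show "norm (suminf f - sum f {..<n}) \<le> (\<Sum>j. g (j + n))"
    by (intro tendsto_upperbound[where F = sequentially]) auto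
qed

section \<open>Frame bounds and the frame operator\<close>

lemma ell2_nth_analysis_op:
  assumes "frame \<eta>"
  shows "ell2_nth (analysis_op \<eta> v) j = inner v (\<eta> j)"
  using assms by (simp add: frame_def analysis_op_def Abs_ell2_inverse)

lemma norm_ell2_square: "(norm x)\<^sup>2 = (\<Sum>j. (ell2_nth x j)\<^sup>2)"
  by (simp only: power2_norm_eq_inner inner_ell2_def) (simp add: power2_eq_square)

lemma frame_summable: "frame \<eta> \<Longrightarrow> summable (\<lambda>j. (inner v (\<eta> j))\<^sup>2)"
  by (simp add: frame_def)

lemma frame_bounds:
  fixes \<eta> :: "nat \<Rightarrow> 'a::real_inner"
  assumes fr: "frame \<eta>"
  obtains A B where "A > 0" "B > 0" "\<And>v. A * (norm v)\<^sup>2 \<le> (\<Sum>j. (inner v (\<eta> j))\<^sup>2)"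
    "\<And>v. (\<Sum>j. (inner v (\<eta> j))\<^sup>2) \<le> (B * norm v)\<^sup>2"
proof -
  have norm_sq: "(norm (analysis_op \<eta> v))\<^sup>2 = (\<Sum>j. (inner v (\<eta> j))\<^sup>2)" for v
    by (simp add: norm_ell2_square ell2_nth_analysis_op[OF fr])
  obtain B where B: "B > 0" "\<And>v. norm (analysis_op \<eta> v) \<le> norm v * B"
    using fr bounded_linear.pos_bounded unfolding frame_def by blast
  obtain K where K: "\<And>v. norm v \<le> K * norm (analysis_op \<eta> v)"
    using fr unfolding frame_def by (metis inv_f_f rangeI)
  \<comment> \<open>In the trivial space K may be zero or negative, hence a positive
    replacement.\<close>
  define K' where "K' = \<bar>K\<bar> + 1"
  have K': "norm v \<le> K' * norm (analysis_op \<eta> v)" "K' > 0" for v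
  proof -
    have "K * norm (analysis_op \<eta> v) \<le> K' * norm (analysis_op \<eta> v)"
      unfolding K'_def by (intro mult_right_mono) auto
    then show "norm v \<le> K' * norm (analysis_op \<eta> v)" using K[of v] by linarith
  qed (simp add: K'_def)
  show ?thesis
  proof (rule that)
    show "1 / K'\<^sup>2 > 0" "B > 0" using K' B by simp_all
    fix v
    have "(norm v)\<^sup>2 \<le> (K' * norm (analysis_op \<eta> v))\<^sup>2" using K' by (intro power_mono) auto
    then show "1 / K'\<^sup>2 * (norm v)\<^sup>2 \<le> (\<Sum>j. (inner v (\<eta> j))\<^sup>2)"
      using K'(2) by (simp add: norm_sq[symmetric] power_mult_distrib field_simps)
    show "(\<Sum>j. (inner v (\<eta> j))\<^sup>2) \<le> (B * norm v)\<^sup>2"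
      unfolding norm_sq[symmetric] using B by (intro power_mono) (auto simp: mult.commute)
  qed
qed

lemma norm_frame_le:
  assumes fr: "frame \<eta>" and B: "\<And>v. (\<Sum>j. (inner v (\<eta> j))\<^sup>2) \<le> (B * norm v)\<^sup>2" "B > 0"
  shows "norm (\<eta> j) \<le> B"
proof -
  have "(inner (\<eta> j) (\<eta> j))\<^sup>2 = (\<Sum>i\<in>{j}. (inner (\<eta> j) (\<eta> i))\<^sup>2)" by simp
  also have "\<dots> \<le> (\<Sum>i. (inner (\<eta> j) (\<eta> i))\<^sup>2)"
    by (rule sum_le_suminf[OF frame_summable[OF fr]]) auto
  also have "\<dots> \<le> (B * norm (\<eta> j))\<^sup>2" by (rule B)
  finally have "(norm (\<eta> j) * norm (\<eta> j))\<^sup>2 \<le> (B * norm (\<eta> j))\<^sup>2"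
    by (simp only: power2_norm_eq_inner flip: power2_eq_square)
  then have "norm (\<eta> j) * norm (\<eta> j) \<le> B * norm (\<eta> j)"
    using B(2) by (simp add: power2_le_iff_abs_le)
  then show ?thesis using B(2) by (cases "norm (\<eta> j) = 0") auto
qed

text \<open>Synthesis is adjoint to analysis and inherits its bound: the sum v is tested against
  itself and Cauchy-Schwarz is applied to the coefficients.\<close>

lemma norm_frame_sum_le:
  assumes fr: "frame \<eta>" and B: "\<And>v. (\<Sum>j. (inner v (\<eta> j))\<^sup>2) \<le> (B * norm v)\<^sup>2" "B > 0"
    and J: "finite J"
  shows "norm (\<Sum>j\<in>J. c j *\<^sub>R \<eta> j) \<le> B * L2_set c J"
proof -
  define v where "v = (\<Sum>j\<in>J. c j *\<^sub>R \<eta> j)"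
  have "L2_set (\<lambda>j. inner v (\<eta> j)) J \<le> B * norm v"
  proof -
    have "(\<Sum>j\<in>J. (inner v (\<eta> j))\<^sup>2) \<le> (B * norm v)\<^sup>2"
      using sum_le_suminf[OF frame_summable[OF fr, of v] J] B(1)[of v] by simp
    then show ?thesis
      unfolding L2_set_def using B by (intro real_le_lsqrt) (auto intro: sum_nonneg)
  qed
  have "norm v * norm v = inner v v"
    by (simp only: power2_norm_eq_inner flip: power2_eq_square)
  also have "\<dots> = (\<Sum>j\<in>J. c j * inner v (\<eta> j))"
    by (subst (2) v_def) (simp only: inner_sum_right inner_scaleR_right)
  also have "\<dots> \<le> (\<Sum>j\<in>J. \<bar>c j\<bar> * \<bar>inner v (\<eta> j)\<bar>)"
    by (intro sum_mono) (simp flip: abs_mult)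
  also have "\<dots> \<le> L2_set c J * L2_set (\<lambda>j. inner v (\<eta> j)) J" by (rule L2_set_mult_ineq)
  also have "\<dots> \<le> L2_set c J * (B * norm v)"
    by (intro mult_left_mono \<open>L2_set (\<lambda>j. inner v (\<eta> j)) J \<le> B * norm v\<close>) auto
  finally have "norm v * norm v \<le> (B * L2_set c J) * norm v" by (simp add: mult_ac)
  then show ?thesis
    using B(2) by (cases "v = 0") (auto simp: v_def[symmetric])
qed

lemma frame_synthesis:
  fixes \<eta> :: "nat \<Rightarrow> 'a::{real_inner, complete_space}"
  assumes fr: "frame \<eta>" and B: "\<And>v. (\<Sum>j. (inner v (\<eta> j))\<^sup>2) \<le> (B * norm v)\<^sup>2" "B > 0"
    and c: "summable (\<lambda>j. (c j)\<^sup>2)"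
  shows "summable (\<lambda>j. c j *\<^sub>R \<eta> j)" and "norm (\<Sum>j. c j *\<^sub>R \<eta> j) \<le> B * sqrt (\<Sum>j. (c j)\<^sup>2)"
proof -
  show s: "summable (\<lambda>j. c j *\<^sub>R \<eta> j)"
  proof (rule summable_Cauchy_complete)
    fix e :: real assume e: "e > 0"
    then have "(e / B)\<^sup>2 > 0" using B by simp
    then obtain N where N: "\<forall>m\<ge>N. \<forall>n. norm (\<Sum>j=m..<n. (c j)\<^sup>2) < (e / B)\<^sup>2"
      using c unfolding summable_Cauchy by blast
    have "norm (\<Sum>j=m..<n. c j *\<^sub>R \<eta> j) < e" if "m \<ge> N" for m n
    proof -
      have "(\<Sum>j=m..<n. (c j)\<^sup>2) < (e / B)\<^sup>2"
        using N that by (smt (verit) real_norm_def)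
      then have "L2_set c {m..<n} < e / B"
        unfolding L2_set_def using e B by (intro real_less_lsqrt) (auto intro: sum_nonneg)
      then have "B * L2_set c {m..<n} < e" using B by (simp add: field_simps)
      then show ?thesis using norm_frame_sum_le[OF fr B, of "{m..<n}" c] by simp
    qed
    then show "\<exists>N. \<forall>m\<ge>N. \<forall>n. norm (\<Sum>j=m..<n. c j *\<^sub>R \<eta> j) < e" by blast
  qed
  have "norm (\<Sum>j<n. c j *\<^sub>R \<eta> j) \<le> B * sqrt (\<Sum>j. (c j)\<^sup>2)" for n
  proof -
    have "L2_set c {..<n} \<le> sqrt (\<Sum>j. (c j)\<^sup>2)"
      unfolding L2_set_def using sum_le_suminf[OF c, of "{..<n}"] by simp
    then have "B * L2_set c {..<n} \<le> B * sqrt (\<Sum>j. (c j)\<^sup>2)"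
      using B(2) by (intro mult_left_mono) auto
    then show ?thesis
      using norm_frame_sum_le[OF fr B, of "{..<n}" c] by simp
  qed
  moreover have "(\<lambda>n. norm (\<Sum>j<n. c j *\<^sub>R \<eta> j)) \<longlonglongrightarrow> norm (\<Sum>j. c j *\<^sub>R \<eta> j)"
    using summable_LIMSEQ[OF s] by (rule tendsto_norm)
  ultimately show "norm (\<Sum>j. c j *\<^sub>R \<eta> j) \<le> B * sqrt (\<Sum>j. (c j)\<^sup>2)"
    by (intro LIMSEQ_le_const2) auto
qed

text \<open>The frame operator S is symmetric and bounded below, hence bijective, and the canonical
  dual is the image of the frame under the inverse of S. By symmetry the dual coefficients of v are
  the frame coefficients of the preimage of v, and expanding S at that preimage gives v.\<close>

lemma frame_reconstruction:
  fixes \<eta> :: "nat \<Rightarrow> 'a::{real_inner, complete_space}"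
  assumes fr: "frame \<eta>"
  shows "summable (\<lambda>j. (inner v (canonical_dual \<eta> j))\<^sup>2)"
    and "(\<lambda>j. inner v (canonical_dual \<eta> j) *\<^sub>R \<eta> j) sums v"
proof -
  obtain A B where A: "A > 0" "\<And>v. A * (norm v)\<^sup>2 \<le> (\<Sum>j. (inner v (\<eta> j))\<^sup>2)"
    and B: "\<And>v. (\<Sum>j. (inner v (\<eta> j))\<^sup>2) \<le> (B * norm v)\<^sup>2" "B > 0"
    using frame_bounds[OF fr] by metis
  define T where "T = (\<lambda>x. \<Sum>j. ell2_nth x j *\<^sub>R \<eta> j)"
  have summT: "summable (\<lambda>j. ell2_nth x j *\<^sub>R \<eta> j)" for x
    by (rule frame_synthesis(1)[OF fr B summable_ell2])
  have inner_T: "inner v (T x) = (\<Sum>j. ell2_nth x j * inner v (\<eta> j))" for v x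
    unfolding T_def using bounded_linear.suminf[OF bounded_linear_inner_right summT, of v x] by simp
  \<comment> \<open>\<open>adjoint\<close> is defined by choice; it is identified with the synthesis
    operator by uniqueness.\<close>
  have adj: "adjoint (analysis_op \<eta>) = T"
    by (rule adjoint_unique) (simp add: inner_T inner_ell2_def ell2_nth_analysis_op[OF fr] mult.commute)
  define S where "S = T \<circ> analysis_op \<eta>"
  have S_eq: "S v = (\<Sum>j. inner v (\<eta> j) *\<^sub>R \<eta> j)" for v
    by (simp add: S_def T_def ell2_nth_analysis_op[OF fr])
  have S_sums: "(\<lambda>j. inner v (\<eta> j) *\<^sub>R \<eta> j) sums S v" for v
    unfolding S_eq using summT[of "analysis_op \<eta> v"] by (simp add: ell2_nth_analysis_op[OF fr] summable_sums)
  have inner_S: "inner u (S v) = (\<Sum>j. inner v (\<eta> j) * inner u (\<eta> j))" for u v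
    by (simp add: S_def inner_T ell2_nth_analysis_op[OF fr])
  have S_sym: "inner u (S v) = inner (S u) v" for u v
    using inner_S[of v u] inner_S[of u v] by (simp add: inner_commute mult.commute)
  have S_diff: "S (u - v) = S u - S v" for u v
    by (rule sums_unique2[OF S_sums]) (use sums_diff[OF S_sums[of u] S_sums[of v]] in \<open>simp add: inner_diff_left scaleR_left_diff_distrib\<close>)
  have S_pos: "A * (norm v)\<^sup>2 \<le> inner v (S v)" for v
    using A(2)[of v] by (simp add: inner_S power2_eq_square)
  have S_bd: "norm (S v) \<le> B\<^sup>2 * norm v" for v
  proof -
    have "norm (S v) \<le> B * sqrt (\<Sum>j. (inner v (\<eta> j))\<^sup>2)"
      unfolding S_eq by (rule frame_synthesis(2)[OF fr B frame_summable[OF fr]])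
    also have "\<dots> \<le> B * (B * norm v)"
      using B by (intro mult_left_mono real_le_lsqrt) auto
    finally show ?thesis by (simp add: power2_eq_square)
  qed
  have inj: "inj S"
  proof (rule injI)
    fix u v assume "S u = S v"
    then have "A * (norm (u - v))\<^sup>2 \<le> 0" using S_pos[of "u - v"] by (simp add: S_diff)
    then show "u = v" using A(1) by (simp add: mult_le_0_iff)
  qed
  have surj: "surj S"
  proof -
    have "\<exists>x. S x = z" for z
    proof -
      \<comment> \<open>Surjectivity by a damped fixed point iteration for S x = z. This step size
        minimises the contraction factor 1 - 2 * c * A + c^2 * B^4, and q is the minimum.\<close>
      define c where "c = A / B ^ 4"
      define q where "q = 1 - A\<^sup>2 / B ^ 4"
      have c: "c > 0" using A B by (simp add: c_def)
      have contr: "(norm (x - c *\<^sub>R S x))\<^sup>2 \<le> q * (norm x)\<^sup>2" for x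
      proof -
        have "(norm (x - c *\<^sub>R S x))\<^sup>2 = (norm x)\<^sup>2 - 2 * c * inner x (S x) + c\<^sup>2 * (norm (S x))\<^sup>2"
          unfolding power2_norm_eq_inner
          by (simp only: inner_diff_left inner_diff_right inner_scaleR_left inner_scaleR_right inner_commute[of "S x" x])
             (simp add: algebra_simps power2_eq_square)
        also have "\<dots> \<le> (norm x)\<^sup>2 - 2 * c * (A * (norm x)\<^sup>2) + c\<^sup>2 * (B\<^sup>2 * norm x)\<^sup>2"
          using S_pos[of x] S_bd[of x] c by (intro add_mono diff_mono mult_left_mono power_mono) auto
        also have "\<dots> = (1 - 2 * c * A + c\<^sup>2 * B ^ 4) * (norm x)\<^sup>2"
          by (simp add: algebra_simps power2_eq_square power4_eq_xxxx)
        also have "1 - 2 * c * A + c\<^sup>2 * B ^ 4 = q"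
          using B by (simp add: c_def q_def field_simps power2_eq_square power4_eq_xxxx)
        finally show ?thesis .
      qed
      have q1: "q < 1" using A B by (simp add: q_def)
      have "\<exists>!x\<in>UNIV. x - c *\<^sub>R S x + c *\<^sub>R z = x"
      proof (rule Banach_fix)
        \<comment> \<open>A negative q is possible only in the trivial space.\<close>
        show "0 \<le> sqrt (max 0 q)" "sqrt (max 0 q) < 1" using q1 by auto
        fix x y :: 'a
        have eq: "(x - c *\<^sub>R S x + c *\<^sub>R z) - (y - c *\<^sub>R S y + c *\<^sub>R z) = (x - y) - c *\<^sub>R S (x - y)"
          by (simp add: S_diff algebra_simps)
        have "(dist (x - c *\<^sub>R S x + c *\<^sub>R z) (y - c *\<^sub>R S y + c *\<^sub>R z))\<^sup>2 \<le> q * (norm (x - y))\<^sup>2"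
          unfolding dist_norm eq by (rule contr)
        also have "\<dots> \<le> max 0 q * (norm (x - y))\<^sup>2" by (intro mult_right_mono) auto
        also have "\<dots> = (sqrt (max 0 q) * dist x y)\<^sup>2" by (simp add: power_mult_distrib dist_norm)
        finally show "dist (x - c *\<^sub>R S x + c *\<^sub>R z) (y - c *\<^sub>R S y + c *\<^sub>R z) \<le> sqrt (max 0 q) * dist x y"
          by (rule power2_le_imp_le) simp
      qed (auto simp: complete_UNIV)
      then obtain x where "x - c *\<^sub>R S x + c *\<^sub>R z = x" by blast
      then have "c *\<^sub>R (z - S x) = 0" by (simp add: algebra_simps)
      then show ?thesis using c by auto
    qed
    then show ?thesis by (metis surjI)
  qed
  define R where "R = inv S"
  have SR: "S (R v) = v" for v unfolding R_def using surj by (simp add: surj_f_inv_f)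
  have dual: "canonical_dual \<eta> j = R (\<eta> j)" for j
    by (simp add: canonical_dual_def adj S_def R_def)
  have coeff: "inner v (canonical_dual \<eta> j) = inner (R v) (\<eta> j)" for v j
    using S_sym[of "R v" "R (\<eta> j)"] by (simp add: dual SR)
  show "summable (\<lambda>j. (inner v (canonical_dual \<eta> j))\<^sup>2)"
    unfolding coeff by (rule frame_summable[OF fr])
  show "(\<lambda>j. inner v (canonical_dual \<eta> j) *\<^sub>R \<eta> j) sums v"
    unfolding coeff using S_sums[of "R v"] by (simp add: SR)
qed

subsection \<open>Complexified inputs\<close>

lemma scaleC_add: "scaleC (a + b) v = scaleC a v + scaleC b v"
  by (simp add: scaleC_def algebra_simps)

lemma scaleC_diff: "scaleC (a - b) v = scaleC a v - scaleC b v"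
  by (simp add: scaleC_def algebra_simps)

lemma norm_scaleC: "norm (scaleC c v) = cmod c * norm v"
proof (rule power2_eq_imp_eq)
  obtain x y where v: "v = (x, y)" by force
  have "(norm (scaleC c v))\<^sup>2 =
      (norm (Re c *\<^sub>R x - Im c *\<^sub>R y))\<^sup>2 + (norm (Re c *\<^sub>R y + Im c *\<^sub>R x))\<^sup>2"
    by (simp add: v scaleC_def norm_Pair)
  also have "\<dots> = ((Re c)\<^sup>2 + (Im c)\<^sup>2) * ((norm x)\<^sup>2 + (norm y)\<^sup>2)"
    unfolding power2_norm_eq_inner
    by (simp only: inner_diff_left inner_diff_right inner_add_left inner_add_right inner_scaleR_left
        inner_scaleR_right inner_commute[of y x]) (simp only: power2_eq_square algebra_simps)
  also have "\<dots> = (cmod c * norm v)\<^sup>2"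
    by (simp add: v norm_Pair power_mult_distrib cmod_power2)
  finally show "(norm (scaleC c v))\<^sup>2 = (cmod c * norm v)\<^sup>2" .
qed auto

lemma bounded_linear_scaleC: "bounded_linear (\<lambda>c. scaleC c v)"
  by (rule bounded_linear_intro[where K = "norm v"])
     (auto simp: scaleC_add norm_scaleC, simp add: scaleC_def algebra_simps)

lemma scaleC_of_real_embed: "scaleC (of_real x) (embed_real a) = embed_real (x *\<^sub>R a)"
  by (simp add: scaleC_def embed_real_def)

lemma embed_real_simps:
  "embed_real (a + b) = embed_real a + embed_real b"
  "embed_real (a - b) = embed_real a - embed_real b"
  by (simp_all add: embed_real_def)

lemma embed_real_sum: "embed_real (sum f A) = (\<Sum>x\<in>A. embed_real (f x))"
  by (induction A rule: infinite_finite_induct) (auto simp: embed_real_simps, simp_all add: embed_real_def zero_prod_def)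

lemma norm_embed_real: "norm (embed_real a) = norm a"
  by (simp add: embed_real_def norm_Pair)

lemma innerC_embed_real: "innerC (embed_real a) v = of_real (inner a v)"
  by (simp add: innerC_def embed_real_def complex_eq_iff)

lemma innerC_scaleC: "innerC (scaleC c z) v = c * innerC z v"
  by (simp add: innerC_def scaleC_def complex_eq_iff inner_diff_left inner_add_left)

lemma bounded_linear_innerC: "bounded_linear (\<lambda>z. innerC z v)"
proof (rule bounded_linear_intro[where K = "2 * norm v"])
  fix z :: "'a complexified"
  obtain x y where z: "z = (x, y)" by force
  have le: "norm x \<le> norm z" "norm y \<le> norm z"
    using norm_fst_le[of x y] norm_snd_le[of y x] by (simp_all add: z)
  have "cmod (innerC z v) \<le> \<bar>inner x v\<bar> + \<bar>inner y v\<bar>"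
    using cmod_le[of "innerC z v"] by (simp add: innerC_def z)
  also have "\<dots> \<le> norm x * norm v + norm y * norm v"
    by (intro add_mono Cauchy_Schwarz_ineq2)
  also have "\<dots> \<le> norm z * norm v + norm z * norm v"
    by (intro add_mono mult_right_mono le) auto
  finally show "norm (innerC z v) \<le> norm z * (2 * norm v)" by (simp add: mult_ac)
qed (auto simp: innerC_def complex_eq_iff inner_add_left)

text \<open>The chain rule along a complex line: complex linearity of the Frechet derivative D makes
  the scalar derivative multiplication by \<open>innerC (D v) u\<close>.\<close>

lemma holomorphic_on_innerC:
  assumes "holomorphicC_on G S" and A: "\<And>x. x \<in> A \<Longrightarrow> a + scaleC x v \<in> S"
  shows "(\<lambda>x. innerC (G (a + scaleC x v)) u) holomorphic_on A"
  unfolding holomorphic_on_def field_differentiable_def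
proof
  fix x assume "x \<in> A"
  then obtain D where D: "(G has_derivative D) (at (a + scaleC x v))"
    and lin: "\<And>c v. D (scaleC c v) = scaleC c (D v)"
    using assms unfolding holomorphicC_on_def by blast
  have "((\<lambda>x. a + scaleC x v) has_derivative (\<lambda>h. scaleC h v)) (at x within A)"
    using has_derivative_add[OF has_derivative_const bounded_linear_imp_has_derivative[OF bounded_linear_scaleC]] by simp
  then have "((\<lambda>x. G (a + scaleC x v)) has_derivative (\<lambda>h. D (scaleC h v))) (at x within A)"
    using D by (rule has_derivative_compose)
  then have "((\<lambda>x. innerC (G (a + scaleC x v)) u) has_derivative (\<lambda>h. innerC (D (scaleC h v)) u)) (at x within A)"
    by (rule bounded_linear.has_derivative[OF bounded_linear_innerC])
  then have "((\<lambda>x. innerC (G (a + scaleC x v)) u) has_field_derivative innerC (D v) u) (at x within A)"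
    unfolding has_field_derivative_def lin innerC_scaleC by (simp add: mult.commute[of _ "innerC (D v) u"])
  then show "\<exists>f'. ((\<lambda>x. innerC (G (a + scaleC x v)) u) has_field_derivative f') (at x within A)" ..
qed

text \<open>Cauchy-Schwarz after splitting 1 into w_j powr t and w_j powr (-t). The smoothness norm
  bounds all coefficients jointly, so no sum over j is lost.\<close>

lemma smooth_normC_functional_bound:
  assumes z: "z \<in> smooth_spaceC w \<eta> t" "smooth_normC w \<eta> t z \<le> M" and w: "\<And>j. w j > 0"
    and J: "finite J" and c: "L2_set (\<lambda>j. c j * w j powr t) J \<le> \<rho>"
  shows "cmod (\<Sum>j\<in>J. of_real (c j) * innerC z (canonical_dual \<eta> j)) \<le> \<rho> * M"
proof -
  define d where "d = (\<lambda>j. cmod (innerC z (canonical_dual \<eta> j)))"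
  have "summable (\<lambda>j. (d j)\<^sup>2 * w j powr (- 2 * t))"
  proof -
    obtain x y where xy: "z = (x, y)" by force
    have "(d j)\<^sup>2 = \<bar>inner x (canonical_dual \<eta> j)\<bar>\<^sup>2 + \<bar>inner y (canonical_dual \<eta> j)\<bar>\<^sup>2" for j
      by (simp add: d_def innerC_def xy cmod_power2)
    moreover have "summable (\<lambda>j. \<bar>inner x (canonical_dual \<eta> j)\<bar>\<^sup>2 * w j powr (- 2 * t) +
        \<bar>inner y (canonical_dual \<eta> j)\<bar>\<^sup>2 * w j powr (- 2 * t))"
      using z(1) by (intro summable_add) (auto simp: smooth_spaceC_def smooth_space_def xy)
    ultimately show ?thesis by (simp add: algebra_simps)
  qed
  then have "(\<Sum>j\<in>J. (d j)\<^sup>2 * w j powr (- 2 * t)) \<le> (\<Sum>j. (d j)\<^sup>2 * w j powr (- 2 * t))"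
    using J by (intro sum_le_suminf) auto
  moreover have "(\<Sum>j\<in>J. (d j)\<^sup>2 * w j powr (- 2 * t)) = (\<Sum>j\<in>J. (d j * w j powr (- t))\<^sup>2)"
    using w by (intro sum.cong) (auto simp: power_mult_distrib powr_power less_imp_neq[THEN not_sym])
  ultimately have "L2_set (\<lambda>j. d j * w j powr (- t)) J \<le> smooth_normC w \<eta> t z"
    unfolding L2_set_def smooth_normC_def d_def by simp
  then have dM: "L2_set (\<lambda>j. d j * w j powr (- t)) J \<le> M" using z(2) by simp
  have "cmod (\<Sum>j\<in>J. of_real (c j) * innerC z (canonical_dual \<eta> j)) \<le>
      (\<Sum>j\<in>J. \<bar>c j * w j powr t\<bar> * \<bar>d j * w j powr (- t)\<bar>)"
  proof (rule sum_norm_le)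
    fix j
    have "w j powr t * w j powr (- t) = 1" using w[of j] by (simp flip: powr_add)
    then show "cmod (of_real (c j) * innerC z (canonical_dual \<eta> j)) \<le> \<bar>c j * w j powr t\<bar> * \<bar>d j * w j powr (- t)\<bar>"
      by (simp add: norm_mult abs_mult d_def mult_ac)
         (metis mult.assoc mult.commute mult_1_right order_refl)
  qed
  also have "\<dots> \<le> L2_set (\<lambda>j. c j * w j powr t) J * L2_set (\<lambda>j. d j * w j powr (- t)) J"
    by (rule L2_set_mult_ineq)
  also have "\<dots> \<le> \<rho> * M"
    using c dM by (intro mult_mono) (auto intro: order_trans[OF L2_set_nonneg c])
  finally show ?thesis .
qed

section \<open>Real inputs and their finite-dimensional complex perturbations\<close>

locale affine_input =
  fixes \<psi> :: "nat \<Rightarrow> 'a::{real_inner, complete_space}" and w :: "nat \<Rightarrow> real" and r s B :: real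
  assumes psi: "norm (\<psi> j) \<le> B" and B: "B > 0" and w: "w j > 0"
    and ws: "summable (\<lambda>j. w j powr s)" and r: "r > 0"
begin

lemma sigma_summable:
  assumes y: "y \<in> cube"
  shows "summable (\<lambda>j. (w j powr s * y j) *\<^sub>R \<psi> j)"
    and "norm (sigma_map w \<psi> r s y - r *\<^sub>R (\<Sum>j<n. (w j powr s * y j) *\<^sub>R \<psi> j)) \<le> r * (B * (\<Sum>j. w (j + n) powr s))"
proof -
  have le: "norm ((w j powr s * y j) *\<^sub>R \<psi> j) \<le> B * w j powr s" for j
  proof -
    have "\<bar>y j\<bar> \<le> 1" using y by (auto simp: cube_def abs_le_iff minus_le_iff)
    then have "w j powr s * \<bar>y j\<bar> * norm (\<psi> j) \<le> w j powr s * 1 * B"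
      using psi by (intro mult_mono) auto
    then show ?thesis by (simp add: abs_mult mult_ac)
  qed
  have sw: "summable (\<lambda>j. B * w j powr s)" by (intro summable_mult ws)
  show "summable (\<lambda>j. (w j powr s * y j) *\<^sub>R \<psi> j)"
    by (rule summable_norm_comparison_complete(1)[OF le sw])
  have "norm ((\<Sum>j. (w j powr s * y j) *\<^sub>R \<psi> j) - (\<Sum>j<n. (w j powr s * y j) *\<^sub>R \<psi> j)) \<le> (\<Sum>j. B * w (j + n) powr s)"
    by (rule summable_norm_comparison_complete(2)[OF le sw])
  also have "\<dots> = B * (\<Sum>j. w (j + n) powr s)"
    using summable_ignore_initial_segment[OF ws, of n] by (rule suminf_mult)
  finally show "norm (sigma_map w \<psi> r s y - r *\<^sub>R (\<Sum>j<n. (w j powr s * y j) *\<^sub>R \<psi> j)) \<le> r * (B * (\<Sum>j. w (j + n) powr s))"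
    using r by (simp add: sigma_map_def flip: scaleR_diff_right)
qed

lemma sigma_tail_tendsto: "(\<lambda>n. r * (B * (\<Sum>j. w (j + n) powr s))) \<longlonglongrightarrow> 0"
proof -
  have "(\<lambda>n. (\<Sum>j. w (j + n) powr s)) \<longlonglongrightarrow> 0"
    using suminf_exist_split2[OF ws] by simp
  then have "(\<lambda>n. r * (B * (\<Sum>j. w (j + n) powr s))) \<longlonglongrightarrow> r * (B * 0)"
    by (intro tendsto_intros)
  then show ?thesis by simp
qed

text \<open>The cube is compact in the product topology and the input map is a uniform limit of
  finite sums that are continuous there. Compactness later gives one radius \<epsilon> that fits
  around every input.\<close>

lemma compact_sigma_cube: "compact (sigma_cube w \<psi> r s)"
proof -
  have "continuous_on cube (sigma_map w \<psi> r s)"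
  proof (rule uniform_limit_theorem)
    show "\<forall>\<^sub>F n in sequentially. continuous_on cube (\<lambda>y. r *\<^sub>R (\<Sum>j<n. (w j powr s * y j) *\<^sub>R \<psi> j))"
      by (intro always_eventually allI continuous_intros continuous_on_product_then_coordinatewise continuous_on_id)
    show "uniform_limit cube (\<lambda>n y. r *\<^sub>R (\<Sum>j<n. (w j powr s * y j) *\<^sub>R \<psi> j)) (sigma_map w \<psi> r s) sequentially"
    proof (rule uniform_limitI)
      fix e :: real assume "e > 0"
      with sigma_tail_tendsto have "\<forall>\<^sub>F n in sequentially. r * (B * (\<Sum>j. w (j + n) powr s)) < e"
        by (rule order_tendstoD)
      then show "\<forall>\<^sub>F n in sequentially. \<forall>y\<in>cube. dist (r *\<^sub>R (\<Sum>j<n. (w j powr s * y j) *\<^sub>R \<psi> j)) (sigma_map w \<psi> r s y) < e"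
        by eventually_elim (use sigma_summable(2) in \<open>auto simp: dist_norm norm_minus_commute intro: le_less_trans\<close>)
    qed
  qed simp
  moreover have "compact (cube :: (nat \<Rightarrow> real) set)"
  proof -
    have "cube = PiE UNIV (\<lambda>_. {-1..1::real})" by (auto simp: cube_def PiE_def Pi_def)
    moreover have "compactin (product_topology (\<lambda>i::nat. euclidean) UNIV) (PiE UNIV (\<lambda>_. {-1..1::real}))"
      by (simp add: compactin_PiE)
    ultimately show ?thesis by (simp add: euclidean_product_topology)
  qed
  ultimately show ?thesis unfolding sigma_cube_def by (rule compact_continuous_image)
qed

text \<open>A parameter and its truncation share the first m terms, so both images lie within the
  same tail bound of one partial sum.\<close>

lemma sigma_truncate_tendsto:
  assumes y: "y \<in> cube" and x: "x \<in> {-1..1}"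
  shows "(\<lambda>m. sigma_map w \<psi> r s (\<lambda>j. if j < m then y j else x)) \<longlonglongrightarrow> sigma_map w \<psi> r s y"
proof -
  define tr where "tr = (\<lambda>m j. if j < m then y j else x)"
  have tr: "tr m \<in> cube" for m using y x by (auto simp: tr_def cube_def)
  define b where "b = (\<lambda>n. r * (B * (\<Sum>j. w (j + n) powr s)))"
  have "norm (sigma_map w \<psi> r s (tr m) - sigma_map w \<psi> r s y) \<le> 2 * b m" for m
  proof -
    have "(\<Sum>j<m. (w j powr s * tr m j) *\<^sub>R \<psi> j) = (\<Sum>j<m. (w j powr s * y j) *\<^sub>R \<psi> j)"
      by (rule sum.cong) (auto simp: tr_def)
    then have "norm (sigma_map w \<psi> r s (tr m) - r *\<^sub>R (\<Sum>j<m. (w j powr s * y j) *\<^sub>R \<psi> j)) \<le> b m"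
      using sigma_summable(2)[OF tr[of m], of m] by (simp add: b_def)
    moreover have "norm (sigma_map w \<psi> r s y - r *\<^sub>R (\<Sum>j<m. (w j powr s * y j) *\<^sub>R \<psi> j)) \<le> b m"
      using sigma_summable(2)[OF y, of m] by (simp add: b_def)
    ultimately show ?thesis
      using norm_triangle_ineq4[of "sigma_map w \<psi> r s (tr m) - r *\<^sub>R (\<Sum>j<m. (w j powr s * y j) *\<^sub>R \<psi> j)"
          "sigma_map w \<psi> r s y - r *\<^sub>R (\<Sum>j<m. (w j powr s * y j) *\<^sub>R \<psi> j)"] by simp
  qed
  then have bd: "\<forall>\<^sub>F m in sequentially. norm (sigma_map w \<psi> r s (tr m) - sigma_map w \<psi> r s y) \<le> 2 * b m"
    by (intro always_eventually allI)
  have "(\<lambda>m. 2 * b m) \<longlonglongrightarrow> 0"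
    using tendsto_mult_left[OF sigma_tail_tendsto, of 2] by (simp add: b_def)
  with bd have "(\<lambda>m. sigma_map w \<psi> r s (tr m) - sigma_map w \<psi> r s y) \<longlonglongrightarrow> 0"
    by (rule Lim_null_comparison)
  then show ?thesis unfolding tr_def by (rule LIM_zero_cancel)
qed

definition input_dir :: "nat \<Rightarrow> 'a complexified" where
  "input_dir j = embed_real ((r * w j powr s) *\<^sub>R \<psi> j)"

text \<open>Only m coordinates become complex; all others stay at x, later the first node. The
  infinite series thus occurs only at a fixed real point, and the dependence on z is a finite affine
  sum.\<close>

definition complex_input :: "real \<Rightarrow> nat \<Rightarrow> (nat \<Rightarrow> complex) \<Rightarrow> 'a complexified" where
  "complex_input x m z =
     embed_real (sigma_map w \<psi> r s (\<lambda>_. x)) + (\<Sum>j<m. scaleC (z j - of_real x) (input_dir j))"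

lemma norm_input_dir: "norm (input_dir j) \<le> r * B * w j powr s"
proof -
  have "norm (input_dir j) = r * w j powr s * norm (\<psi> j)"
    using r by (simp add: input_dir_def norm_embed_real abs_mult)
  also have "\<dots> \<le> r * w j powr s * B" using r psi by (intro mult_left_mono) auto
  finally show ?thesis by (simp add: mult_ac)
qed

lemma complex_input_real:
  assumes y: "y \<in> cube" "\<And>j. m \<le> j \<Longrightarrow> y j = x" and x: "x \<in> {-1..1}"
  shows "complex_input x m (\<lambda>j. of_real (y j)) = embed_real (sigma_map w \<psi> r s y)"
proof -
  have cx: "(\<lambda>_. x) \<in> cube" using x by (simp add: cube_def)
  have "sigma_map w \<psi> r s y - sigma_map w \<psi> r s (\<lambda>_. x) =
      r *\<^sub>R (\<Sum>j. (w j powr s * y j) *\<^sub>R \<psi> j - (w j powr s * x) *\<^sub>R \<psi> j)"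
    unfolding sigma_map_def scaleR_diff_right[symmetric]
    by (simp only: suminf_diff[OF sigma_summable(1)[OF y(1)] sigma_summable(1)[OF cx]])
  also have "(\<Sum>j. (w j powr s * y j) *\<^sub>R \<psi> j - (w j powr s * x) *\<^sub>R \<psi> j) =
      (\<Sum>j<m. (w j powr s * y j) *\<^sub>R \<psi> j - (w j powr s * x) *\<^sub>R \<psi> j)"
    by (rule suminf_finite) (auto simp: y(2))
  also have "r *\<^sub>R \<dots> = (\<Sum>j<m. (y j - x) *\<^sub>R (r * w j powr s) *\<^sub>R \<psi> j)"
    by (simp add: scaleR_sum_right algebra_simps)
  finally have "embed_real (sigma_map w \<psi> r s y) - embed_real (sigma_map w \<psi> r s (\<lambda>_. x)) =
      (\<Sum>j<m. embed_real ((y j - x) *\<^sub>R (r * w j powr s) *\<^sub>R \<psi> j))"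
    by (simp only: embed_real_sum flip: embed_real_simps)
  also have "\<dots> = (\<Sum>j<m. scaleC (of_real (y j) - of_real x) (input_dir j))"
    by (rule sum.cong) (simp_all only: input_dir_def scaleC_of_real_embed flip: of_real_diff)
  finally show ?thesis by (simp add: complex_input_def algebra_simps)
qed

lemma complex_input_upd:
  assumes "j < m"
  shows "complex_input x m (z(j := u)) = complex_input x m (z(j := 0)) + scaleC u (input_dir j)"
proof -
  have "(\<Sum>i<m. scaleC ((z(j := v)) i - of_real x) (input_dir i)) =
     scaleC (v - of_real x) (input_dir j) + (\<Sum>i\<in>{..<m} - {j}. scaleC (z i - of_real x) (input_dir i))" for v
    using assms by (subst sum.remove[of _ j]) auto
  then show ?thesis by (simp only: complex_input_def scaleC_diff) (simp add: scaleC_def)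
qed

text \<open>Moving every z_j to a real point of the interval at distance less than e_j changes the
  input by at most the weighted sum of the e_j.\<close>

lemma complex_input_near:
  assumes z: "\<And>j. j < m \<Longrightarrow> z j \<in> interval_nbhd (e j)" and x: "x \<in> {-1..1}"
    and e: "r * B * (\<Sum>j<m. w j powr s * e j) < \<epsilon>"
  shows "\<exists>a\<in>sigma_cube w \<psi> r s. complex_input x m z \<in> ball (embed_real a) \<epsilon>"
proof -
  have "\<forall>j. \<exists>y\<in>{-1..1}. j < m \<longrightarrow> cmod (z j - of_real y) < e j"
  proof
    fix j
    show "\<exists>y\<in>{-1..1}. j < m \<longrightarrow> cmod (z j - of_real y) < e j"
      using z[of j] by (cases "j < m") (auto simp: interval_nbhd_def intro: bexI[of _ 0])
  qed
  then obtain y0 where y0: "\<And>j. y0 j \<in> {-1..1}" "\<And>j. j < m \<Longrightarrow> cmod (z j - of_real (y0 j)) < e j"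
    by metis
  define y where "y = (\<lambda>j. if j < m then y0 j else x)"
  have y: "y \<in> cube" using y0 x by (auto simp: y_def cube_def)
  have "complex_input x m z - complex_input x m (\<lambda>j. of_real (y j)) =
      (\<Sum>j<m. scaleC (z j - of_real x) (input_dir j) - scaleC (of_real (y j) - of_real x) (input_dir j))"
    by (simp add: complex_input_def sum_subtractf)
  also have "\<dots> = (\<Sum>j<m. scaleC (z j - of_real (y j)) (input_dir j))"
    by (rule sum.cong) (simp_all flip: scaleC_diff)
  also have "norm \<dots> \<le> (\<Sum>j<m. r * B * (w j powr s * e j))"
  proof (rule sum_norm_le)
    fix j assume "j \<in> {..<m}"
    then have "cmod (z j - of_real (y j)) * norm (input_dir j) \<le> e j * (r * B * w j powr s)"
      using y0(2)[of j] norm_input_dir[of j]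
      by (intro mult_mono) (auto simp: y_def intro: order.trans[OF norm_ge_zero less_imp_le])
    then show "norm (scaleC (z j - of_real (y j)) (input_dir j)) \<le> r * B * (w j powr s * e j)"
      by (simp add: norm_scaleC mult_ac)
  qed
  also have "\<dots> < \<epsilon>" using e by (simp add: sum_distrib_left)
  finally have "complex_input x m z \<in> ball (embed_real (sigma_map w \<psi> r s y)) \<epsilon>"
    using complex_input_real[OF y _ x, of m] by (simp add: y_def dist_norm norm_minus_commute)
  then show ?thesis using y unfolding sigma_cube_def by blast
qed

end

subsection \<open>Dual estimate of the interpolation error\<close>

lemma card_below:
  assumes "\<mu> \<in> cube_indices m K"
  shows "finite {\<nu> \<in> multiindices. \<nu> \<le> \<mu>}" and "real (card {\<nu> \<in> multiindices. \<nu> \<le> \<mu>}) = (\<Prod>j<m. 1 + real (\<mu> j))"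
proof -
  have eq: "{\<nu> \<in> multiindices. \<nu> \<le> \<mu>} = index_box m (\<lambda>j. {..\<mu> j})"
  proof (intro set_eqI iffI)
    fix \<nu> assume "\<nu> \<in> {\<nu> \<in> multiindices. \<nu> \<le> \<mu>}"
    then have "\<nu> j \<le> \<mu> j" for j by (auto simp: le_fun_def)
    then show "\<nu> \<in> index_box m (\<lambda>j. {..\<mu> j})"
      using assms by (auto simp: index_box_def) (metis le_zero_eq)
  next
    fix \<nu> assume \<nu>: "\<nu> \<in> index_box m (\<lambda>j. {..\<mu> j})"
    have "\<nu> j \<le> \<mu> j" for j
      using \<nu> by (cases "j < m") (auto simp: index_box_def)
    then show "\<nu> \<in> {\<nu> \<in> multiindices. \<nu> \<le> \<mu>}"
      using \<nu> index_box_subset_multiindices by (auto simp: le_fun_def)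
  qed
  show "finite {\<nu> \<in> multiindices. \<nu> \<le> \<mu>}" unfolding eq by (rule finite_index_box) auto
  have "(\<Prod>j<m. \<Sum>i\<le>\<mu> j. 1 :: real) = (\<Sum>\<nu>\<in>index_box m (\<lambda>j. {..\<mu> j}). \<Prod>j<m. 1)"
    by (rule prod_sum_index_box)
  then show "real (card {\<nu> \<in> multiindices. \<nu> \<le> \<mu>}) = (\<Prod>j<m. 1 + real (\<mu> j))"
    unfolding eq by simp
qed

text \<open>The bounds need not be monotone in \<open>\<nu>\<close>, so a superlevel set need not be
  downward closed and the closure is built in.\<close>

definition threshold_set :: "((nat \<Rightarrow> nat) \<Rightarrow> real) \<Rightarrow> real \<Rightarrow> (nat \<Rightarrow> nat) set" where
  "threshold_set \<beta> \<theta> = {\<nu> \<in> multiindices. \<exists>\<mu>\<in>multiindices. \<nu> \<le> \<mu> \<and> \<theta> \<le> \<beta> \<mu>}"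

lemma downward_closed_threshold_set: "downward_closed (threshold_set \<beta> \<theta>)"
  unfolding downward_closed_def threshold_set_def using order_trans by blast

text \<open>The weight \<open>\<Prod>j<m. 1 + \<mu> j\<close> counts the multiindices below \<open>\<mu>\<close>, so it pays for passing
  to the downward closure.\<close>

lemma card_threshold_set:
  assumes S: "\<And>m K. (\<Sum>\<nu>\<in>cube_indices m K. (\<Prod>j<m. 1 + real (\<nu> j)) * \<beta> \<nu>) \<le> S"
    and \<beta>: "\<And>\<nu>. \<beta> \<nu> \<ge> 0" and \<theta>: "\<theta> > 0"
  shows "finite (threshold_set \<beta> \<theta>)" and "real (card (threshold_set \<beta> \<theta>)) \<le> S / \<theta>"
proof -
  \<comment> \<open>First for finite subsets; a uniform bound on their cardinalities then yields
    finiteness of the whole set.\<close>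
  have bound: "real (card F) \<le> S / \<theta>" if F: "finite F" "F \<subseteq> threshold_set \<beta> \<theta>" for F
  proof -
    have "\<forall>\<nu>\<in>F. \<exists>\<mu>. \<mu> \<in> multiindices \<and> \<nu> \<le> \<mu> \<and> \<theta> \<le> \<beta> \<mu>"
      using F(2) by (auto simp: threshold_set_def)
    then obtain h where h: "\<And>\<nu>. \<nu> \<in> F \<Longrightarrow> h \<nu> \<in> multiindices \<and> \<nu> \<le> h \<nu> \<and> \<theta> \<le> \<beta> (h \<nu>)"
      by (elim bchoice[elim_format]) blast
    define F' where "F' = h ` F"
    have F': "finite F'" "F' \<subseteq> multiindices" using F h by (auto simp: F'_def)
    then obtain m K where mK: "F' \<subseteq> cube_indices m K"
      using finite_multiindices_subset_cube by blast
    have sub: "F \<subseteq> (\<Union>\<mu>\<in>F'. {\<nu> \<in> multiindices. \<nu> \<le> \<mu>})"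
      using h F(2) by (auto simp: F'_def threshold_set_def)
    have fin: "finite {\<nu> \<in> multiindices. \<nu> \<le> \<mu>}" if "\<mu> \<in> F'" for \<mu>
      using card_below(1) mK that by blast
    have "card F \<le> card (\<Union>\<mu>\<in>F'. {\<nu> \<in> multiindices. \<nu> \<le> \<mu>})"
      using F'(1) fin by (intro card_mono sub) auto
    also have "\<dots> \<le> (\<Sum>\<mu>\<in>F'. card {\<nu> \<in> multiindices. \<nu> \<le> \<mu>})"
      by (rule card_UN_le[OF F'(1)])
    finally have "real (card F) \<le> (\<Sum>\<mu>\<in>F'. real (card {\<nu> \<in> multiindices. \<nu> \<le> \<mu>}))"
      by (simp only: of_nat_le_iff flip: of_nat_sum)
    also have "\<dots> \<le> (\<Sum>\<mu>\<in>F'. (\<Prod>j<m. 1 + real (\<mu> j)) * \<beta> \<mu> / \<theta>)"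
    proof (rule sum_mono)
      fix \<mu> assume "\<mu> \<in> F'"
      then have "\<mu> \<in> cube_indices m K" "1 \<le> \<beta> \<mu> / \<theta>" using mK h \<theta> by (auto simp: F'_def)
      moreover have "0 \<le> (\<Prod>j<m. 1 + real (\<mu> j))" by (rule prod_nonneg) auto
      ultimately show "real (card {\<nu> \<in> multiindices. \<nu> \<le> \<mu>}) \<le> (\<Prod>j<m. 1 + real (\<mu> j)) * \<beta> \<mu> / \<theta>"
        using mult_left_mono[of 1 "\<beta> \<mu> / \<theta>" "\<Prod>j<m. 1 + real (\<mu> j)"] by (simp add: card_below(2))
    qed
    also have "\<dots> \<le> (\<Sum>\<mu>\<in>cube_indices m K. (\<Prod>j<m. 1 + real (\<mu> j)) * \<beta> \<mu> / \<theta>)"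
      using mK \<theta> \<beta> by (intro sum_mono2 finite_index_box) (auto intro!: divide_nonneg_pos mult_nonneg_nonneg prod_nonneg)
    also have "\<dots> \<le> S / \<theta>"
      unfolding sum_divide_distrib[symmetric] using S \<theta> by (intro divide_right_mono) auto
    finally show ?thesis .
  qed
  show fin: "finite (threshold_set \<beta> \<theta>)"
  proof (rule ccontr)
    assume "infinite (threshold_set \<beta> \<theta>)"
    then obtain F where "finite F" "card F = Suc (nat \<lceil>S / \<theta>\<rceil>)" "F \<subseteq> threshold_set \<beta> \<theta>"
      using infinite_arbitrarily_large by blast
    then show False using bound[of F] by linarith
  qed
  show "real (card (threshold_set \<beta> \<theta>)) \<le> S / \<theta>" by (rule bound[OF fin order.refl])
qed

section \<open>Linear combinations of output coefficients as scalar holomorphic functions\<close>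

locale lifted_map = affine_input \<psi> w r s B
  for \<psi> :: "nat \<Rightarrow> 'a::{real_inner, complete_space}" and w r s B +
  fixes \<eta> :: "nat \<Rightarrow> 'b::{real_inner, complete_space}" and t M \<epsilon> :: real
    and G :: "'a \<Rightarrow> 'b" and G\<^sub>C :: "'a complexified \<Rightarrow> 'b complexified" and O\<^sub>C :: "'a complexified set"
  assumes frame: "frame \<eta>" and t: "t > 0" and eps: "\<epsilon> > 0" and decr: "decseq w"
    and holo: "holomorphicC_on G\<^sub>C O\<^sub>C"
    and nbhd: "a \<in> sigma_cube w \<psi> r s \<Longrightarrow> ball (embed_real a) \<epsilon> \<subseteq> O\<^sub>C"
    and real_values: "a \<in> sigma_cube w \<psi> r s \<Longrightarrow> G\<^sub>C (embed_real a) = embed_real (G a)"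
    and smooth: "z \<in> O\<^sub>C \<Longrightarrow> G\<^sub>C z \<in> smooth_spaceC w \<eta> t \<and> smooth_normC w \<eta> t (G\<^sub>C z) \<le> M"
begin

definition coefficient :: "nat \<Rightarrow> (nat \<Rightarrow> real) \<Rightarrow> real" where
  "coefficient j y = inner (G (sigma_map w \<psi> r s y)) (canonical_dual \<eta> j)"

definition combination :: "real \<Rightarrow> nat \<Rightarrow> (nat \<Rightarrow> real) \<Rightarrow> nat set \<Rightarrow> (nat \<Rightarrow> complex) \<Rightarrow> complex" where
  "combination x m c J z =
     (\<Sum>j\<in>J. of_real (c j) * innerC (G\<^sub>C (complex_input x m z)) (canonical_dual \<eta> j))"

lemma real_in_domain: "a \<in> sigma_cube w \<psi> r s \<Longrightarrow> embed_real a \<in> O\<^sub>C"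
  using nbhd eps by (meson centre_in_ball subsetD)

lemma coefficient_functional_bound:
  assumes y: "y \<in> cube" and J: "finite J" and c: "L2_set (\<lambda>j. c j * w j powr t) J \<le> \<rho>"
  shows "\<bar>\<Sum>j\<in>J. c j * coefficient j y\<bar> \<le> \<rho> * M"
proof -
  let ?a = "sigma_map w \<psi> r s y"
  have a: "?a \<in> sigma_cube w \<psi> r s" using y by (simp add: sigma_cube_def)
  have "cmod (\<Sum>j\<in>J. of_real (c j) * innerC (G\<^sub>C (embed_real ?a)) (canonical_dual \<eta> j)) \<le> \<rho> * M"
    using smooth[OF real_in_domain[OF a]] w J c by (intro smooth_normC_functional_bound) auto
  also have "(\<Sum>j\<in>J. of_real (c j) * innerC (G\<^sub>C (embed_real ?a)) (canonical_dual \<eta> j)) =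
      of_real (\<Sum>j\<in>J. c j * coefficient j y)"
    by (simp add: real_values[OF a] innerC_embed_real coefficient_def)
  finally show ?thesis by (simp only: norm_of_real)
qed

lemma M_nonneg: "M \<ge> 0"
proof -
  have "(\<lambda>_. 0) \<in> cube" by (simp add: cube_def)
  then show ?thesis using coefficient_functional_bound[of "\<lambda>_. 0" "{}" "\<lambda>_. 0" 1] by simp
qed

context
  fixes e :: "nat \<Rightarrow> real" and x :: real and m :: nat
  assumes x: "x \<in> {-1..1}" and e: "r * B * (\<Sum>j<m. w j powr s * e j) < \<epsilon>"
begin

lemma complex_input_in_domain:
  assumes "\<And>j. j < m \<Longrightarrow> z j \<in> interval_nbhd (e j)"
  shows "complex_input x m z \<in> O\<^sub>C"
  using complex_input_near[OF assms x e] nbhd by blast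

lemma holomorphic_combination:
  assumes z: "\<And>i. i < m \<Longrightarrow> z i \<in> interval_nbhd (e i)" and j: "j < m"
  shows "(\<lambda>u. combination x m c J (z(j := u))) holomorphic_on interval_nbhd (e j)"
proof -
  define a where "a = complex_input x m (z(j := 0))"
  have eq: "complex_input x m (z(j := u)) = a + scaleC u (input_dir j)" for u
    unfolding a_def by (rule complex_input_upd[OF j])
  have "(\<lambda>u. innerC (G\<^sub>C (a + scaleC u (input_dir j))) (canonical_dual \<eta> i)) holomorphic_on interval_nbhd (e j)" for i
  proof (rule holomorphic_on_innerC[OF holo])
    fix u assume "u \<in> interval_nbhd (e j)"
    then have "complex_input x m (z(j := u)) \<in> O\<^sub>C"
      using z by (intro complex_input_in_domain) auto
    then show "a + scaleC u (input_dir j) \<in> O\<^sub>C"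
      unfolding eq .
  qed
  then show ?thesis
    unfolding combination_def eq by (intro holomorphic_on_sum holomorphic_on_mult holomorphic_on_const)
qed

lemma combination_bound:
  assumes z: "\<And>i. i < m \<Longrightarrow> z i \<in> interval_nbhd (e i)"
    and J: "finite J" and c: "L2_set (\<lambda>j. c j * w j powr t) J \<le> \<rho>"
  shows "cmod (combination x m c J z) \<le> \<rho> * M"
  unfolding combination_def
  using smooth[OF complex_input_in_domain[OF z]] w J c by (intro smooth_normC_functional_bound) auto

end

lemma combination_real:
  assumes y: "y \<in> cube" "\<And>j. m \<le> j \<Longrightarrow> y j = x" and x: "x \<in> {-1..1}"
  shows "combination x m c J (\<lambda>j. of_real (y j)) = of_real (\<Sum>j\<in>J. c j * coefficient j y)"
proof -
  have a: "sigma_map w \<psi> r s y \<in> sigma_cube w \<psi> r s" using y by (simp add: sigma_cube_def)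
  have "complex_input x m (\<lambda>j. of_real (y j)) = embed_real (sigma_map w \<psi> r s y)"
    by (rule complex_input_real[OF y x])
  then show ?thesis
    by (simp add: combination_def real_values[OF a] innerC_embed_real coefficient_def)
qed

text \<open>Continuity comes from the holomorphic extension: \<open>G\<^sub>C\<close> is
  differentiable at every embedded input, and the coefficient is read off from its real
  part.\<close>

lemma coefficient_truncate_tendsto:
  assumes y: "y \<in> cube" and x: "x \<in> {-1..1}"
  shows "(\<lambda>m. coefficient j (\<lambda>j. if j < m then y j else x)) \<longlonglongrightarrow> coefficient j y"
proof -
  let ?\<sigma> = "sigma_map w \<psi> r s"
  define tr where "tr = (\<lambda>m j. if j < m then y j else x)"
  have tr: "tr m \<in> cube" for m using y x by (auto simp: tr_def cube_def)
  have re: "inner (fst (G\<^sub>C (embed_real (?\<sigma> y')))) (canonical_dual \<eta> j) = coefficient j y'" if "y' \<in> cube" for y'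
    using that by (subst real_values) (auto simp: sigma_cube_def coefficient_def embed_real_def)
  have "(\<lambda>m. ?\<sigma> (tr m)) \<longlonglongrightarrow> ?\<sigma> y" unfolding tr_def by (rule sigma_truncate_tendsto[OF y x])
  then have "(\<lambda>m. embed_real (?\<sigma> (tr m))) \<longlonglongrightarrow> embed_real (?\<sigma> y)"
    unfolding embed_real_def by (intro tendsto_intros)
  moreover have "isCont G\<^sub>C (embed_real (?\<sigma> y))"
  proof -
    have "embed_real (?\<sigma> y) \<in> O\<^sub>C" using y by (intro real_in_domain) (auto simp: sigma_cube_def)
    then obtain D where "(G\<^sub>C has_derivative D) (at (embed_real (?\<sigma> y)))"
      using holo unfolding holomorphicC_on_def by blast
    then show ?thesis by (rule has_derivative_continuous)
  qed
  ultimately have "(\<lambda>m. G\<^sub>C (embed_real (?\<sigma> (tr m)))) \<longlonglongrightarrow> G\<^sub>C (embed_real (?\<sigma> y))"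
    by (rule isCont_tendsto_compose[rotated])
  then have "(\<lambda>m. inner (fst (G\<^sub>C (embed_real (?\<sigma> (tr m))))) (canonical_dual \<eta> j)) \<longlonglongrightarrow>
      inner (fst (G\<^sub>C (embed_real (?\<sigma> y)))) (canonical_dual \<eta> j)"
    by (intro tendsto_intros)
  then show ?thesis using y tr by (simp add: re tr_def)
qed

end

text \<open>The radii \<open>d0\<close> and \<open>e1\<close> are such that the polydiscs around the cube that are used to bound
  the surpluses are mapped into the domain of holomorphy.\<close>

locale smolyak_map = lifted_map \<psi> w r s B \<eta> t M \<epsilon> G G\<^sub>C O\<^sub>C + interpolation_nodes \<xi> \<tau>
  for \<psi> :: "nat \<Rightarrow> 'a::{real_inner, complete_space}" and w r s B
    and \<eta> :: "nat \<Rightarrow> 'b::{real_inner, complete_space}" and t M \<epsilon> G G\<^sub>C O\<^sub>C \<xi> \<tau> +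
  fixes d0 e1 :: real
  assumes d0: "d0 > 0" and e1: "e1 > 0" and radii: "r * B * (2 * d0 * (\<Sum>j. w j powr s) + 2 * e1) < \<epsilon>"
begin

abbreviation \<beta> :: "(nat \<Rightarrow> nat) \<Rightarrow> real" where
  "\<beta> \<equiv> surplus_bound (\<lambda>j. w j powr s) (node_const d0 / e1) \<tau> (1 / (1 + d0))"

lemma combination_nodes:
  assumes "\<mu> \<in> cube_indices m K"
  shows "combination (\<xi> 0) m c J (\<lambda>j. of_real (\<xi> (\<mu> j))) = of_real (\<Sum>j\<in>J. c j * coefficient j (\<lambda>j. \<xi> (\<mu> j)))"
proof (rule combination_real)
  show "(\<lambda>j. \<xi> (\<mu> j)) \<in> cube" using nodes by (simp add: cube_def)
qed (use assms nodes in \<open>auto simp: index_box_def\<close>)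

lemma tensor_sum_combination:
  "of_real (\<Sum>j\<in>J. c j * tensor_sum m K l (\<lambda>\<mu>. coefficient j (\<lambda>j. \<xi> (\<mu> j)))) =
     tensor_sum m K (\<lambda>j i. of_real (l j i)) (\<lambda>\<mu>. combination (\<xi> 0) m c J (\<lambda>j. of_real (\<xi> (\<mu> j))))"
proof -
  have "(\<Sum>j\<in>J. c j * tensor_sum m K l (\<lambda>\<mu>. coefficient j (\<lambda>j. \<xi> (\<mu> j)))) =
     (\<Sum>\<mu>\<in>cube_indices m K. (\<Prod>j<m. l j (\<mu> j)) * (\<Sum>j\<in>J. c j * coefficient j (\<lambda>j. \<xi> (\<mu> j))))"
    unfolding tensor_sum_def sum_distrib_left by (subst sum.swap) (simp add: mult_ac)
  moreover have "tensor_sum m K (\<lambda>j i. of_real (l j i)) (\<lambda>\<mu>. combination (\<xi> 0) m c J (\<lambda>j. of_real (\<xi> (\<mu> j)))) =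
     of_real (\<Sum>\<mu>\<in>cube_indices m K. (\<Prod>j<m. l j (\<mu> j)) * (\<Sum>j\<in>J. c j * coefficient j (\<lambda>j. \<xi> (\<mu> j))))"
    unfolding tensor_sum_def of_real_sum[of _ "cube_indices m K"]
    by (rule sum.cong[OF refl], subst combination_nodes) simp_all
  ultimately show ?thesis by (simp only:)
qed

text \<open>A surplus of a linear combination is the same combination of surpluses, so the scalar
  bound applies to the whole combination at once, with \<rho> * M as supremum.\<close>

lemma surplus_combination_bound:
  assumes y: "y \<in> cube" and \<nu>: "\<nu> \<in> cube_indices m K"
    and J: "finite J" and c: "L2_set (\<lambda>j. c j * w j powr t) J \<le> \<rho>"
  shows "\<bar>\<Sum>j\<in>J. c j * surplus \<xi> m K \<nu> (coefficient j) y\<bar> \<le> \<rho> * M * \<beta> \<nu>"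
proof -
  let ?n = "real (card {j. \<nu> j \<noteq> 0})"
  \<comment> \<open>The n coordinates in the support of \<open>\<nu>\<close> contribute 2 * e1 / n
    each and so at most 2 * e1 in total; the polydisc fits into the domain uniformly in
    \<open>\<nu>\<close>.\<close>
  define e where "e = (\<lambda>j. 2 * (d0 + (if \<nu> j = 0 then 0 else e1 / (?n * w j powr s))))"
  have fin: "finite {j. \<nu> j \<noteq> 0}" by (rule finite_support_cube[OF \<nu>])
  have "(\<Sum>j<m. w j powr s * e j) = (\<Sum>j<m. 2 * d0 * w j powr s + (if \<nu> j = 0 then 0 else 2 * e1 / ?n))"
  proof (rule sum.cong[OF refl])
    fix j
    have "w j powr s > 0" using w[of j] by simp
    moreover have "?n > 0" if "\<nu> j \<noteq> 0" using that fin by (auto simp: card_gt_0_iff)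
    ultimately show "w j powr s * e j = 2 * d0 * w j powr s + (if \<nu> j = 0 then 0 else 2 * e1 / ?n)"
      by (auto simp: e_def field_simps)
  qed
  also have "\<dots> = 2 * d0 * (\<Sum>j<m. w j powr s) + (\<Sum>j<m. if \<nu> j = 0 then 0 else 2 * e1 / ?n)"
    by (simp add: sum.distrib sum_distrib_left)
  also have "\<dots> \<le> 2 * d0 * (\<Sum>j. w j powr s) + 2 * e1"
  proof (intro add_mono mult_left_mono)
    show "(\<Sum>j<m. w j powr s) \<le> (\<Sum>j. w j powr s)" using ws by (intro sum_le_suminf) auto
    have "{j. \<nu> j \<noteq> 0} \<subseteq> {..<m}" using \<nu> by (auto simp: index_box_def intro: leI)
    then have "(\<Sum>j<m. if \<nu> j = 0 then 0 else 2 * e1 / ?n) = (\<Sum>j | \<nu> j \<noteq> 0. if \<nu> j = 0 then 0 else 2 * e1 / ?n)"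
      by (intro sum.mono_neutral_right) auto
    also have "\<dots> = (\<Sum>j | \<nu> j \<noteq> 0. 2 * e1 / ?n)" by (rule sum.cong) auto
    also have "\<dots> \<le> 2 * e1" using e1 by simp
    finally show "(\<Sum>j<m. if \<nu> j = 0 then 0 else 2 * e1 / ?n) \<le> 2 * e1" .
  qed (use d0 in auto)
  finally have "r * B * (\<Sum>j<m. w j powr s * e j) \<le> r * B * (2 * d0 * (\<Sum>j. w j powr s) + 2 * e1)"
    using r B by (intro mult_left_mono) auto
  then have e: "r * B * (\<Sum>j<m. w j powr s * e j) < \<epsilon>" using radii by simp
  have "cmod (tensor_sum m K (\<lambda>j i. of_real (lagrange_diff \<xi> (\<nu> j) i (y j)))
      (\<lambda>\<mu>. combination (\<xi> 0) m c J (\<lambda>j. of_real (\<xi> (\<mu> j))))) \<le> \<rho> * M * \<beta> \<nu>"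
  proof (rule tensor_surplus_bound[OF y \<nu>])
    show "w j powr s > 0" for j using w[of j] by simp
    fix z j assume "\<And>j. j < m \<Longrightarrow> z j \<in> interval_nbhd (2 * (d0 + (if \<nu> j = 0 then 0 else e1 / (?n * w j powr s))))" "j < m"
    then show "(\<lambda>x. combination (\<xi> 0) m c J (z(j := x))) holomorphic_on
        interval_nbhd (2 * (d0 + (if \<nu> j = 0 then 0 else e1 / (?n * w j powr s))))"
      using holomorphic_combination[OF nodes e, of z j] unfolding e_def by blast
  next
    fix z assume "\<And>j. j < m \<Longrightarrow> z j \<in> interval_nbhd (2 * (d0 + (if \<nu> j = 0 then 0 else e1 / (?n * w j powr s))))"
    then show "cmod (combination (\<xi> 0) m c J z) \<le> \<rho> * M"
      using combination_bound[OF nodes e _ J c, of z] unfolding e_def by blast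
  qed (rule d0 e1)+
  then show ?thesis by (simp only: norm_of_real flip: tensor_sum_combination)
qed

lemma surplus_sum_tendsto:
  assumes y: "y \<in> cube"
  shows "(\<lambda>k. \<Sum>\<nu>\<in>cube_indices m k. surplus \<xi> m k \<nu> (coefficient j) y)
    \<longlonglongrightarrow> coefficient j (\<lambda>i. if i < m then y i else \<xi> 0)"
proof -
  have "(\<Sum>j<m. w j powr s * (2 * d0)) = 2 * d0 * (\<Sum>j<m. w j powr s)"
    by (simp add: sum_distrib_left mult_ac)
  also have "\<dots> \<le> 2 * d0 * (\<Sum>j. w j powr s)"
    using d0 sum_le_suminf[OF ws, of "{..<m}"] by (intro mult_left_mono) auto
  also have "\<dots> \<le> 2 * d0 * (\<Sum>j. w j powr s) + 2 * e1" using e1 by simp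
  finally have "r * B * (\<Sum>j<m. w j powr s * (2 * d0)) \<le> r * B * (2 * d0 * (\<Sum>j. w j powr s) + 2 * e1)"
    using r B by (intro mult_left_mono) auto
  then have e: "r * B * (\<Sum>j<m. w j powr s * (2 * d0)) < \<epsilon>" using radii by simp
  let ?c = "\<lambda>_::nat. 1 :: real"
  let ?F = "combination (\<xi> 0) m ?c {j}"
  have "(\<lambda>k. tensor_sum m k (\<lambda>j i. of_real (lagrange_basis \<xi> k i (y j))) (\<lambda>\<mu>. ?F (\<lambda>j. of_real (\<xi> (\<mu> j)))))
      \<longlonglongrightarrow> ?F (\<lambda>i. of_real (if i < m then y i else \<xi> 0))"
  proof (rule tensor_interpolant_tendsto[OF y d0])
    show "(\<lambda>x. ?F (z(i := x))) holomorphic_on interval_nbhd (2 * d0)"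
      if "\<And>j. j < m \<Longrightarrow> z j \<in> interval_nbhd (2 * d0)" "i < m" for z i
      using that by (rule holomorphic_combination[OF nodes e])
    show "cmod (?F z) \<le> L2_set (\<lambda>j. ?c j * w j powr t) {j} * M" if "\<And>j. j < m \<Longrightarrow> z j \<in> interval_nbhd (2 * d0)" for z
      using that by (intro combination_bound[OF nodes e]) auto
  qed
  also have "?F (\<lambda>i. of_real (if i < m then y i else \<xi> 0)) =
      of_real (\<Sum>j\<in>{j}. ?c j * coefficient j (\<lambda>i. if i < m then y i else \<xi> 0))"
    using y nodes by (intro combination_real) (auto simp: cube_def)
  finally have "(\<lambda>k. complex_of_real (tensor_sum m k (\<lambda>j i. lagrange_basis \<xi> k i (y j)) (\<lambda>\<mu>. coefficient j (\<lambda>j. \<xi> (\<mu> j)))))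
      \<longlonglongrightarrow> of_real (coefficient j (\<lambda>i. if i < m then y i else \<xi> 0))"
    by (simp flip: tensor_sum_combination)
  then show ?thesis unfolding sum_surplus_cube tendsto_of_real_iff .
qed

text \<open>Duality: the error vector \<open>c\<close> is tested against itself, which turns the
  vector valued estimate into one for scalar functions.\<close>

lemma interpolation_error_le:
  assumes y: "y \<in> cube"
    and \<Lambda>: "\<And>j. j < N \<Longrightarrow> finite (\<Lambda> j) \<and> downward_closed (\<Lambda> j)"
    and v: "\<And>j \<nu>. j < N \<Longrightarrow> \<nu> \<in> multiindices \<Longrightarrow> \<nu> \<notin> \<Lambda> j \<Longrightarrow> w j powr t \<le> v \<nu>" "\<And>\<nu>. 0 \<le> v \<nu>"
    and Q: "\<And>m K. (\<Sum>\<nu>\<in>cube_indices m K. v \<nu> * \<beta> \<nu>) \<le> Q"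
  shows "L2_set (\<lambda>j. coefficient j y - smolyak_interpolant \<xi> (\<Lambda> j) (coefficient j) y) {..<N} \<le> M * Q"
proof -
  define I where "I = (\<lambda>j. smolyak_interpolant \<xi> (\<Lambda> j) (coefficient j) y)"
  define c where "c = (\<lambda>j. coefficient j y - I j)"
  define E where "E = L2_set c {..<N}"
  have E0: "E \<ge> 0" by (simp add: E_def)
  have "finite (\<Union>j<N. \<Lambda> j)" "(\<Union>j<N. \<Lambda> j) \<subseteq> multiindices"
    using \<Lambda> by (auto simp: downward_closed_def)
  then obtain m0 K0 where mK: "(\<Union>j<N. \<Lambda> j) \<subseteq> cube_indices m0 K0"
    using finite_multiindices_subset_cube by blast
  \<comment> \<open>On a box that contains all the index sets, the tested error consists of the
    surpluses outside \<open>\<Lambda> j\<close>. Exchanging the sums puts \<open>\<nu>\<close>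
    outside, so each \<open>\<nu>\<close> sees only the components j that omit it.\<close>
  have box: "(\<Sum>j<N. c j * ((\<Sum>\<nu>\<in>cube_indices m K. surplus \<xi> m K \<nu> (coefficient j) y) - I j)) \<le> E * (M * Q)"
    if "m \<ge> m0" "K \<ge> K0" for m K
  proof -
    let ?s = "\<lambda>\<nu> j. surplus \<xi> m K \<nu> (coefficient j) y"
    let ?C = "cube_indices m K"
    have finC: "finite ?C" by (rule finite_index_box) simp
    have sub: "\<Lambda> j \<subseteq> ?C" if "j < N" for j
      using mK cube_indices_mono[OF \<open>m \<ge> m0\<close> \<open>K \<ge> K0\<close>] that by blast
    have "(\<Sum>j<N. c j * ((\<Sum>\<nu>\<in>?C. ?s \<nu> j) - I j)) = (\<Sum>j<N. \<Sum>\<nu>\<in>?C. if \<nu> \<in> \<Lambda> j then 0 else c j * ?s \<nu> j)"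
    proof (rule sum.cong[OF refl])
      fix j assume "j \<in> {..<N}"
      then have j: "j < N" by simp
      have diff: "(\<Sum>\<nu>\<in>?C. ?s \<nu> j) - I j = (\<Sum>\<nu>\<in>?C - \<Lambda> j. ?s \<nu> j)"
        using smolyak_eq_sum_surplus[of "\<Lambda> j" m K \<xi> "coefficient j" y] \<Lambda>[OF j] sub[OF j]
        by (simp add: I_def sum_diff[OF finC])
      show "c j * ((\<Sum>\<nu>\<in>?C. ?s \<nu> j) - I j) = (\<Sum>\<nu>\<in>?C. if \<nu> \<in> \<Lambda> j then 0 else c j * ?s \<nu> j)"
        unfolding diff sum_distrib_left by (rule sum.mono_neutral_cong_left) (use finC in auto)
    qed
    also have "\<dots> = (\<Sum>\<nu>\<in>?C. \<Sum>j<N. if \<nu> \<in> \<Lambda> j then 0 else c j * ?s \<nu> j)"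
      by (rule sum.swap)
    also have "\<dots> = (\<Sum>\<nu>\<in>?C. \<Sum>j\<in>{j. j < N \<and> \<nu> \<notin> \<Lambda> j}. c j * ?s \<nu> j)"
    proof (rule sum.cong[OF refl])
      fix \<nu>
      show "(\<Sum>j<N. if \<nu> \<in> \<Lambda> j then 0 else c j * ?s \<nu> j) = (\<Sum>j\<in>{j. j < N \<and> \<nu> \<notin> \<Lambda> j}. c j * ?s \<nu> j)"
        by (rule sum.mono_neutral_cong_right) auto
    qed
    \<comment> \<open>For the components that omit \<open>\<nu>\<close>, w_j powr t is at most v
      \<nu>, so \<open>surplus_combination_bound\<close> applies with \<rho> = E * v \<nu>.\<close>
    also have "\<dots> \<le> (\<Sum>\<nu>\<in>?C. E * M * (v \<nu> * \<beta> \<nu>))"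
    proof (rule sum_mono)
      fix \<nu> assume \<nu>: "\<nu> \<in> ?C"
      then have \<nu>m: "\<nu> \<in> multiindices" using index_box_subset_multiindices by blast
      let ?J = "{j. j < N \<and> \<nu> \<notin> \<Lambda> j}"
      have "L2_set (\<lambda>j. c j * w j powr t) ?J \<le> L2_set (\<lambda>j. \<bar>c j\<bar> * v \<nu>) ?J"
      proof -
        have "L2_set (\<lambda>j. c j * w j powr t) ?J = L2_set (\<lambda>j. \<bar>c j\<bar> * w j powr t) ?J"
          by (simp add: L2_set_def power_mult_distrib)
        also have "\<dots> \<le> L2_set (\<lambda>j. \<bar>c j\<bar> * v \<nu>) ?J"
          using v(1)[OF _ \<nu>m] by (intro L2_set_mono mult_left_mono) auto
        finally show ?thesis .
      qed
      also have "\<dots> = L2_set c ?J * v \<nu>"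
        using v(2)[of \<nu>] by (simp add: L2_set_def power_mult_distrib real_sqrt_mult flip: sum_distrib_right)
      also have "\<dots> \<le> E * v \<nu>"
        unfolding E_def L2_set_def using v(2)
        by (intro mult_right_mono real_sqrt_le_mono sum_mono2) auto
      finally have "\<bar>\<Sum>j\<in>?J. c j * ?s \<nu> j\<bar> \<le> (E * v \<nu>) * M * \<beta> \<nu>"
        by (intro surplus_combination_bound[OF y \<nu>]) auto
      then show "(\<Sum>j\<in>?J. c j * ?s \<nu> j) \<le> E * M * (v \<nu> * \<beta> \<nu>)" by (simp add: mult_ac)
    qed
    also have "\<dots> = E * M * (\<Sum>\<nu>\<in>?C. v \<nu> * \<beta> \<nu>)" by (simp add: sum_distrib_left)
    also have "\<dots> \<le> E * M * Q" using E0 M_nonneg by (intro mult_left_mono Q) auto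
    finally show ?thesis by (simp add: mult.assoc)
  qed
  \<comment> \<open>The degree K goes to infinity first, for a fixed number m of active variables,
    and then m does; the bound depends on neither.\<close>
  define tr where "tr = (\<lambda>m i. if i < m then y i else \<xi> 0)"
  have trunc: "(\<Sum>j<N. c j * (coefficient j (tr m) - I j)) \<le> E * (M * Q)" if m: "m \<ge> m0" for m
  proof (rule LIMSEQ_le_const2)
    show "(\<lambda>K. \<Sum>j<N. c j * ((\<Sum>\<nu>\<in>cube_indices m K. surplus \<xi> m K \<nu> (coefficient j) y) - I j))
        \<longlonglongrightarrow> (\<Sum>j<N. c j * (coefficient j (tr m) - I j))"
      unfolding tr_def by (intro tendsto_intros surplus_sum_tendsto[OF y])
  qed (use box[OF m] in blast)
  have "(\<Sum>j<N. c j * (coefficient j y - I j)) \<le> E * (M * Q)"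
  proof (rule LIMSEQ_le_const2)
    show "(\<lambda>m. \<Sum>j<N. c j * (coefficient j (tr m) - I j)) \<longlonglongrightarrow> (\<Sum>j<N. c j * (coefficient j y - I j))"
      unfolding tr_def by (intro tendsto_intros coefficient_truncate_tendsto[OF y nodes])
  qed (use trunc in blast)
  \<comment> \<open>The test vector is the error itself, so its pairing is the squared norm and one
    factor E cancels.\<close>
  moreover have "(\<Sum>j<N. c j * (coefficient j y - I j)) = E * E"
    by (simp add: E_def L2_set_def sum_nonneg c_def power2_eq_square)
  ultimately have EE: "E * E \<le> E * (M * Q)" by simp
  have "0 \<le> Q" using Q[of 0 0] v(2) by (simp add: surplus_bound_def) (meson order_trans)
  then have "E \<le> M * Q"
    using EE E0 M_nonneg by (cases "E = 0") auto
  then show ?thesis by (simp add: E_def c_def I_def)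
qed

end

subsection \<open>Convergence rate\<close>

lemma surplus_bound_pos:
  assumes "\<And>j. b j > 0" "A > 0" "q > 0"
  shows "surplus_bound b A \<tau> q \<nu> > 0"
proof (cases "finite {j. \<nu> j \<noteq> 0}")
  case True
  then have "card {j. \<nu> j \<noteq> 0} > 0" if "\<nu> j \<noteq> 0" for j
    using that by (auto simp: card_gt_0_iff)
  then show ?thesis
    unfolding surplus_bound_def using assms by (intro prod_pos) auto
qed (simp add: surplus_bound_def)

context lifted_map
begin

text \<open>The tail is tested against itself, as in \<open>interpolation_error_le\<close>; since w
  decreases, w_N powr t bounds all weights in it.\<close>

lemma coefficient_tail_le:
  assumes y: "y \<in> cube"
  shows "L2_set (\<lambda>j. coefficient j y) {N..<n} \<le> w N powr t * M"
proof -
  let ?c = "\<lambda>j. coefficient j y"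
  define E where "E = L2_set ?c {N..<n}"
  have E0: "E \<ge> 0" by (simp add: E_def)
  have "L2_set (\<lambda>j. ?c j * w j powr t) {N..<n} = L2_set (\<lambda>j. \<bar>?c j\<bar> * w j powr t) {N..<n}"
    by (simp add: L2_set_def power_mult_distrib)
  also have "\<dots> \<le> L2_set (\<lambda>j. \<bar>?c j\<bar> * w N powr t) {N..<n}"
    using decr w t by (intro L2_set_mono mult_left_mono powr_mono2) (auto simp: decseq_def less_imp_le)
  also have "\<dots> = E * w N powr t"
    by (simp add: E_def L2_set_def power_mult_distrib real_sqrt_mult flip: sum_distrib_right)
  finally have "\<bar>\<Sum>j\<in>{N..<n}. ?c j * ?c j\<bar> \<le> (E * w N powr t) * M"
    by (intro coefficient_functional_bound[OF y]) auto
  moreover have "(\<Sum>j\<in>{N..<n}. ?c j * ?c j) = E * E"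
    by (simp add: E_def L2_set_def sum_nonneg power2_eq_square)
  ultimately have "E * E \<le> E * (w N powr t * M)" by (simp add: mult.assoc)
  then have "E \<le> w N powr t * M"
    using E0 M_nonneg by (cases "E = 0") auto
  then show ?thesis by (simp add: E_def)
qed

text \<open>The output is expanded in the frame, and the coefficient error splits at N into the
  interpolation error and the truncated tail; synthesis costs the upper frame bound.\<close>

lemma decoder_error_le:
  assumes y: "y \<in> cube"
    and B': "\<And>v. (\<Sum>j. (inner v (\<eta> j))\<^sup>2) \<le> (B' * norm v)\<^sup>2" "B' > 0"
    and X: "L2_set (\<lambda>j. coefficient j y - p j) {..<N} \<le> X"
  shows "norm (G (sigma_map w \<psi> r s y) - decoder \<eta> (zero_pad N p)) \<le> B' * (X + w N powr t * M)"
proof -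
  define c where "c = (\<lambda>j. coefficient j y - (if j < N then p j else 0))"
  note rec = frame_reconstruction[OF frame, of "G (sigma_map w \<psi> r s y)", folded coefficient_def]
  have "(\<lambda>j. ell2_nth (zero_pad N p) j *\<^sub>R \<eta> j) sums decoder \<eta> (zero_pad N p)"
    unfolding decoder_def
    by (rule summable_sums, rule summable_finite[of "{..<N}"]) (auto simp: zero_pad.rep_eq)
  from sums_diff[OF rec(2) this]
  have c_sums: "(\<lambda>j. c j *\<^sub>R \<eta> j) sums (G (sigma_map w \<psi> r s y) - decoder \<eta> (zero_pad N p))"
    by (simp add: c_def zero_pad.rep_eq algebra_simps)
  have "\<forall>\<^sub>F j in sequentially. (c j)\<^sup>2 = (coefficient j y)\<^sup>2"
    unfolding eventually_sequentially by (auto simp: c_def intro!: exI[of _ N])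
  then have c_sq: "summable (\<lambda>j. (c j)\<^sup>2)" using rec(1) by (simp add: summable_cong)
  define Y where "Y = w N powr t * M"
  have X0: "X \<ge> 0" using X L2_set_nonneg order_trans by blast
  have Y0: "Y \<ge> 0" using M_nonneg by (simp add: Y_def)
  have "(\<Sum>j<n. (c j)\<^sup>2) \<le> (X + Y)\<^sup>2" for n
  proof -
    have "(\<Sum>j<n. (c j)\<^sup>2) \<le> (\<Sum>j<N + n. (c j)\<^sup>2)" by (intro sum_mono2) auto
    also have "\<dots> = (\<Sum>j<N. (c j)\<^sup>2) + (\<Sum>j=N..<N + n. (c j)\<^sup>2)"
      using sum.atLeastLessThan_concat[of 0 N "N + n" "\<lambda>j. (c j)\<^sup>2"] by (simp add: lessThan_atLeast0)
    also have "(\<Sum>j<N. (c j)\<^sup>2) = (L2_set (\<lambda>j. coefficient j y - p j) {..<N})\<^sup>2"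
      by (simp add: L2_set_def c_def sum_nonneg)
    also have "(\<Sum>j=N..<N + n. (c j)\<^sup>2) = (L2_set (\<lambda>j. coefficient j y) {N..<N + n})\<^sup>2"
      by (simp add: L2_set_def c_def sum_nonneg)
    also have "(L2_set (\<lambda>j. coefficient j y - p j) {..<N})\<^sup>2 + \<dots> \<le> X\<^sup>2 + Y\<^sup>2"
      unfolding Y_def by (intro add_mono power_mono X coefficient_tail_le[OF y]) auto
    also have "\<dots> \<le> (X + Y)\<^sup>2" using X0 Y0 by (simp add: power2_sum)
    finally show ?thesis .
  qed
  then have "(\<Sum>j. (c j)\<^sup>2) \<le> (X + Y)\<^sup>2" by (intro suminf_le_const[OF c_sq]) auto
  then have "sqrt (\<Sum>j. (c j)\<^sup>2) \<le> X + Y" using X0 Y0 by (intro real_le_lsqrt) (auto intro: suminf_nonneg c_sq)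
  then have "B' * sqrt (\<Sum>j. (c j)\<^sup>2) \<le> B' * (X + Y)" using B'(2) by (intro mult_left_mono) auto
  then show ?thesis
    using frame_synthesis(2)[OF frame B' c_sq] sums_unique[OF c_sums] by (simp add: Y_def)
qed

end

context smolyak_map
begin

text \<open>The exponent a > 1 of the application makes the thresholds affordable: index set j
  receives the share w_j powr a / W of the budget N. The parameter \<theta> interpolates between
  output smoothness and decay of the surpluses.\<close>

lemma smolyak_rate:
  assumes p: "0 < p" "p < 1"
    and S: "S > 0" "\<And>m K. (\<Sum>\<nu>\<in>cube_indices m K. (\<Prod>j<m. 1 + real (\<nu> j)) * \<beta> \<nu> powr p) \<le> S"
    and \<theta>: "0 < \<theta>" "\<theta> * a \<le> t" "p * \<theta> \<le> 1 - p"
    and W: "summable (\<lambda>j. w j powr a)" "0 < a" and N: "N \<ge> 1"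
  defines "W \<equiv> \<Sum>j. w j powr a"
  obtains \<Lambda> where "\<forall>j<N. finite (\<Lambda> j) \<and> downward_closed (\<Lambda> j)" "(\<Sum>j<N. card (\<Lambda> j)) \<le> N"
    "\<forall>y\<in>cube. L2_set (\<lambda>j. coefficient j y - smolyak_interpolant \<xi> (\<Lambda> j) (coefficient j) y) {..<N} \<le>
      M * (w 0 powr (t - \<theta> * a) * (S * W) powr \<theta> * S powr ((1 - p * \<theta>) / p) * real N powr (- \<theta>))"
proof -
  have \<beta>: "\<beta> \<nu> > 0" for \<nu>
  proof (rule surplus_bound_pos)
    show "w j powr s > 0" for j using w[of j] by simp
  qed (use d0 e1 in \<open>auto simp: node_const_def add_pos_pos\<close>)
  have wa: "w j powr a > 0" for j using w[of j] by simp
  have Wpos: "W > 0" unfolding W_def using W(1) wa by (intro suminf_pos)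
  have W_le: "(\<Sum>j<N. w j powr a) \<le> W" unfolding W_def using W(1) by (intro sum_le_suminf) auto
  \<comment> \<open>Solves S / \<kappa>_j = N * w_j powr a / W, so that the cardinality bounds add
    up to at most N.\<close>
  define \<kappa> where "\<kappa> = (\<lambda>j. S * W / (real N * w j powr a))"
  define \<Lambda> where "\<Lambda> = (\<lambda>j. threshold_set (\<lambda>\<nu>. \<beta> \<nu> powr p) (\<kappa> j))"
  have \<kappa>: "\<kappa> j > 0" for j using S(1) Wpos wa[of j] N by (simp add: \<kappa>_def)
  note card = card_threshold_set[OF S(2) powr_ge_zero \<kappa>, folded \<Lambda>_def]
  define D where "D = w 0 powr (t - \<theta> * a)"
  \<comment> \<open>If \<open>\<nu>\<close> is omitted by component j, then w_j powr a is at most S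
    * W / (N * \<beta>_\<nu> powr p). Raising this to the power \<theta> and bounding the remaining
    w_j powr (t - \<theta> * a) by D gives v.\<close>
  define v where "v = (\<lambda>\<nu>. D * (S * W / (real N * \<beta> \<nu> powr p)) powr \<theta>)"
  have prod1: "1 \<le> (\<Prod>j<m. 1 + real (\<nu> j))" for \<nu> :: "nat \<Rightarrow> nat" and m by (intro prod_ge_1) auto
  have \<beta>_le: "\<beta> \<nu> powr p \<le> (\<Prod>j<m. 1 + real (\<nu> j)) * \<beta> \<nu> powr p" for \<nu> m
    using mult_right_mono[OF prod1[of \<nu> m], of "\<beta> \<nu> powr p"] by simp
  show thesis
  proof (rule that)
    show "\<forall>j<N. finite (\<Lambda> j) \<and> downward_closed (\<Lambda> j)"
      using card(1) downward_closed_threshold_set by (simp add: \<Lambda>_def)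
    have "real (\<Sum>j<N. card (\<Lambda> j)) \<le> (\<Sum>j<N. real N / W * w j powr a)"
      unfolding of_nat_sum
    proof (rule sum_mono)
      fix j
      have "S / \<kappa> j = real N / W * w j powr a"
        using S(1) Wpos wa[of j] N by (simp add: \<kappa>_def field_simps)
      then show "real (card (\<Lambda> j)) \<le> real N / W * w j powr a"
        using card(2)[of j] by (simp add: \<Lambda>_def)
    qed
    also have "\<dots> = real N / W * (\<Sum>j<N. w j powr a)" by (simp add: sum_distrib_left)
    also have "\<dots> \<le> real N / W * W" using Wpos W_le by (intro mult_left_mono) auto
    also have "\<dots> = real N" using Wpos by simp
    finally show "(\<Sum>j<N. card (\<Lambda> j)) \<le> N" by (simp only: of_nat_le_iff)
  next
    show "\<forall>y\<in>cube. L2_set (\<lambda>j. coefficient j y - smolyak_interpolant \<xi> (\<Lambda> j) (coefficient j) y) {..<N} \<le>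
      M * (w 0 powr (t - \<theta> * a) * (S * W) powr \<theta> * S powr ((1 - p * \<theta>) / p) * real N powr (- \<theta>))"
      unfolding D_def[symmetric]
    proof (rule ballI, rule interpolation_error_le[where v = v])
      show "finite (\<Lambda> j) \<and> downward_closed (\<Lambda> j)" for j
        using card(1) downward_closed_threshold_set by (simp add: \<Lambda>_def)
      show "0 \<le> v \<nu>" for \<nu> by (simp add: v_def D_def)
    next
      fix j \<nu> assume \<nu>: "\<nu> \<in> multiindices" "\<nu> \<notin> \<Lambda> j"
      then have "\<beta> \<nu> powr p \<le> \<kappa> j"
        unfolding \<Lambda>_def threshold_set_def using linear order_refl by blast
      then have "w j powr a \<le> S * W / (real N * \<beta> \<nu> powr p)"
        using \<beta>[of \<nu>] wa[of j] N by (simp add: \<kappa>_def field_simps)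
      then have le: "(w j powr a) powr \<theta> \<le> (S * W / (real N * \<beta> \<nu> powr p)) powr \<theta>"
        using \<theta> by (intro powr_mono2) auto
      have leD: "w j powr (t - \<theta> * a) \<le> D"
        unfolding D_def using decr w \<theta> by (intro powr_mono2) (auto simp: decseq_def less_imp_le)
      have eq: "w j powr t = w j powr (t - \<theta> * a) * (w j powr a) powr \<theta>"
        by (simp add: powr_powr mult.commute flip: powr_add)
      show "w j powr t \<le> v \<nu>"
        unfolding v_def eq by (intro mult_mono le leD) (auto simp: D_def)
    next
      fix m K
      \<comment> \<open>The product v \<nu> * \<beta> \<nu> contains \<beta>_\<nu> powr (1 - p *
        \<theta>). One factor \<beta>_\<nu> powr p is kept for summation; the remaining exponent is
        nonnegative, and that power is bounded through \<beta>_\<nu> powr p \<le> S.\<close>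
      have pow: "v \<nu> * \<beta> \<nu> \<le> (D * (S * W) powr \<theta> * real N powr (- \<theta>) * S powr ((1 - p * \<theta> - p) / p)) * \<beta> \<nu> powr p"
        if \<nu>: "\<nu> \<in> cube_indices m K" for \<nu>
      proof -
        have "\<beta> \<nu> powr p \<le> (\<Prod>j<m. 1 + real (\<nu> j)) * \<beta> \<nu> powr p" by (rule \<beta>_le)
        also have "\<dots> \<le> (\<Sum>\<nu>\<in>cube_indices m K. (\<Prod>j<m. 1 + real (\<nu> j)) * \<beta> \<nu> powr p)"
          using \<nu> by (intro member_le_sum finite_index_box) (auto intro!: mult_nonneg_nonneg prod_nonneg)
        also have "\<dots> \<le> S" by (rule S)
        finally have "(\<beta> \<nu> powr p) powr ((1 - p * \<theta> - p) / p) \<le> S powr ((1 - p * \<theta> - p) / p)"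
          using p \<theta> by (intro powr_mono2) auto
        then have le: "\<beta> \<nu> powr (1 - p * \<theta> - p) \<le> S powr ((1 - p * \<theta> - p) / p)"
          using p by (simp add: powr_powr)
        have "(S * W / (real N * \<beta> \<nu> powr p)) powr \<theta> = (S * W) powr \<theta> * real N powr (- \<theta>) * \<beta> \<nu> powr (- (p * \<theta>))"
          using S(1) Wpos N \<beta>[of \<nu>] by (simp add: powr_divide powr_mult powr_powr powr_minus field_simps)
        moreover have "\<beta> \<nu> powr (- (p * \<theta>)) * \<beta> \<nu> = \<beta> \<nu> powr (1 - p * \<theta> - p) * \<beta> \<nu> powr p"
          using \<beta>[of \<nu>] powr_add[of "\<beta> \<nu>" "- (p * \<theta>)" 1] by (simp flip: powr_add)
        ultimately have "v \<nu> * \<beta> \<nu> = (D * (S * W) powr \<theta> * real N powr (- \<theta>)) * (\<beta> \<nu> powr (1 - p * \<theta> - p) * \<beta> \<nu> powr p)"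
          by (simp add: v_def mult.assoc)
        also have "\<dots> \<le> (D * (S * W) powr \<theta> * real N powr (- \<theta>)) * (S powr ((1 - p * \<theta> - p) / p) * \<beta> \<nu> powr p)"
          by (intro mult_left_mono mult_right_mono le) (auto simp: D_def)
        finally show ?thesis by (simp add: mult.assoc)
      qed
      have "(\<Sum>\<nu>\<in>cube_indices m K. v \<nu> * \<beta> \<nu>) \<le>
          (\<Sum>\<nu>\<in>cube_indices m K. (D * (S * W) powr \<theta> * real N powr (- \<theta>) * S powr ((1 - p * \<theta> - p) / p)) * \<beta> \<nu> powr p)"
        by (intro sum_mono pow)
      also have "\<dots> = (D * (S * W) powr \<theta> * real N powr (- \<theta>) * S powr ((1 - p * \<theta> - p) / p)) * (\<Sum>\<nu>\<in>cube_indices m K. \<beta> \<nu> powr p)"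
        by (simp only: sum_distrib_left)
      also have "\<dots> \<le> (D * (S * W) powr \<theta> * real N powr (- \<theta>) * S powr ((1 - p * \<theta> - p) / p)) * S"
        by (intro mult_left_mono order.trans[OF sum_mono S(2)] \<beta>_le) (auto simp: D_def)
      also have "\<dots> = D * (S * W) powr \<theta> * S powr ((1 - p * \<theta>) / p) * real N powr (- \<theta>)"
      proof -
        have "S powr ((1 - p * \<theta> - p) / p) * S = S powr ((1 - p * \<theta> - p) / p + 1)"
          using S(1) by (simp add: powr_add)
        also have "(1 - p * \<theta> - p) / p + 1 = (1 - p * \<theta>) / p" using p by (simp add: field_simps)
        finally show ?thesis by (simp add: mult_ac)
      qed
      finally show "(\<Sum>\<nu>\<in>cube_indices m K. v \<nu> * \<beta> \<nu>) \<le> D * (S * W) powr \<theta> * S powr ((1 - p * \<theta>) / p) * real N powr (- \<theta>)" .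
    qed
  qed
qed

end

theorem theorem5p3:
  fixes \<psi> :: "nat \<Rightarrow> 'a::{real_inner, polish_space}"
    and \<eta> :: "nat \<Rightarrow> 'b::{real_inner, polish_space}"
    and w :: "nat \<Rightarrow> real"
    and r s t M \<tau> \<delta> :: real
    and S :: "'a set"
    and G :: "'a \<Rightarrow> 'b"
    and O\<^sub>C :: "'a complexified set"
    and G\<^sub>C :: "'a complexified \<Rightarrow> 'b complexified"
  assumes "frame \<psi>" and "frame \<eta>" and "weight_seq w"
    and "r > 0" and "s > 1" and "t > 0"
    and "sigma_cube w \<psi> r s \<subseteq> S"
    and "open O\<^sub>C" and "embed_real ` sigma_cube w \<psi> r s \<subseteq> O\<^sub>C"
    and "holomorphicC_on G\<^sub>C O\<^sub>C"
    and "\<And>a. a \<in> S \<Longrightarrow> embed_real a \<in> O\<^sub>C \<Longrightarrow> G\<^sub>C (embed_real a) = embed_real (G a)"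
    and "\<And>a. a \<in> O\<^sub>C \<Longrightarrow> G\<^sub>C a \<in> smooth_spaceC w \<eta> t \<and> smooth_normC w \<eta> t (G\<^sub>C a) \<le> M"
    and "\<tau> > 0" and "\<delta> > 0"
  shows "\<exists>C>0. \<forall>\<xi> :: nat \<Rightarrow> real.
    range \<xi> \<subseteq> {-1..1} \<and> inj \<xi> \<and>
    (\<forall>n. lebesgue_constant \<xi> n \<le> (1 + real n) powr \<tau>) \<longrightarrow>
    (\<forall>N\<ge>1. \<exists>\<Lambda> :: nat \<Rightarrow> (nat \<Rightarrow> nat) set.
       (\<forall>j<N. finite (\<Lambda> j) \<and> downward_closed (\<Lambda> j)) \<and>
       (\<Sum>j<N. card (\<Lambda> j)) \<le> N \<and>
       (\<forall>y\<in>cube.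
          norm (G (sigma_map w \<psi> r s y) -
                decoder \<eta> (zero_pad N (\<lambda>j.
                  smolyak_interpolant \<xi> (\<Lambda> j)
                    (\<lambda>y'. inner (G (sigma_map w \<psi> r s y')) (canonical_dual \<eta> j)) y)))
          \<le> C * real N powr (- min (s - 1) t + \<delta>)))"
proof -
  \<comment> \<open>P is below s but at least s - \<delta>; the mean (1 + s) / 2 keeps it above 1
    even for large \<delta>. Likewise a is chosen so that t / a \<ge> t - \<delta>.\<close>
  define P where "P = max (s - \<delta>) ((1 + s) / 2)"
  define p where "p = 1 / P"
  define a where "a = 1 + \<delta> / t"
  define \<theta> where "\<theta> = min (P - 1) (t / a)"
  have P: "1 < P" "P < s" using \<open>s > 1\<close> \<open>\<delta> > 0\<close> by (auto simp: P_def less_max_iff_disj)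
  have p: "0 < p" "p < 1" using P by (auto simp: p_def)
  have a: "a > 1" using \<open>\<delta> > 0\<close> \<open>t > 0\<close> by (simp add: a_def)
  have \<theta>: "0 < \<theta>" "\<theta> * a \<le> t" "p * \<theta> \<le> 1 - p"
  proof -
    show "0 < \<theta>" using P a \<open>t > 0\<close> by (simp add: \<theta>_def)
    have "\<theta> \<le> t / a" by (simp add: \<theta>_def)
    then show "\<theta> * a \<le> t" using a by (simp add: field_simps)
    have "\<theta> \<le> P - 1" by (simp add: \<theta>_def)
    then have "p * \<theta> \<le> p * (P - 1)" using p by (intro mult_left_mono) auto
    also have "\<dots> = 1 - p" using P by (simp add: p_def field_simps)
    finally show "p * \<theta> \<le> 1 - p" .
  qed
  have rate: "min (s - 1) t - \<delta> \<le> \<theta>"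
  proof -
    have "(t - \<delta>) * a \<le> t" using \<open>t > 0\<close> by (simp add: a_def field_simps)
    then have "t - \<delta> \<le> t / a" using a by (simp add: field_simps)
    moreover have "s - 1 - \<delta> \<le> P - 1" by (simp add: P_def)
    ultimately show ?thesis by (auto simp: \<theta>_def min_def)
  qed
  have w: "w j > 0" for j using \<open>weight_seq w\<close> by (simp add: weight_seq_def)
  have decr: "decseq w" using \<open>weight_seq w\<close> by (simp add: weight_seq_def)
  have sum_w: "summable (\<lambda>j. w j powr e)" if "e > 1" for e
  proof -
    have "\<forall>\<epsilon>>0. summable (\<lambda>j. w j powr (1 + \<epsilon>))"
      using \<open>weight_seq w\<close> by (simp add: weight_seq_def)
    from this[rule_format, of "e - 1"] that show ?thesis by simp
  qed
  obtain B where B: "B > 0" "\<And>v. (\<Sum>j. (inner v (\<psi> j))\<^sup>2) \<le> (B * norm v)\<^sup>2"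
    using frame_bounds[OF \<open>frame \<psi>\<close>] by metis
  obtain B' where B': "\<And>v. (\<Sum>j. (inner v (\<eta> j))\<^sup>2) \<le> (B' * norm v)\<^sup>2" "B' > 0"
    using frame_bounds[OF \<open>frame \<eta>\<close>] by metis
  interpret affine_input \<psi> w r s B
    using norm_frame_le[OF \<open>frame \<psi>\<close> B(2,1)] B(1) w sum_w[OF \<open>s > 1\<close>] \<open>r > 0\<close> by unfold_locales
  have "compact (embed_real ` sigma_cube w \<psi> r s)"
    unfolding embed_real_def by (intro compact_continuous_image compact_sigma_cube continuous_intros)
  then obtain \<epsilon> where \<epsilon>: "\<epsilon> > 0" "(\<Union>x\<in>embed_real ` sigma_cube w \<psi> r s. ball x \<epsilon>) \<subseteq> O\<^sub>C"
    using compact_subset_open_imp_ball_epsilon_subset \<open>open O\<^sub>C\<close> assms(9) by metis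
  interpret lifted_map \<psi> w r s B \<eta> t M \<epsilon> G G\<^sub>C O\<^sub>C
  proof
    fix a assume a: "a \<in> sigma_cube w \<psi> r s"
    then show "ball (embed_real a) \<epsilon> \<subseteq> O\<^sub>C" using \<epsilon>(2) by blast
    show "G\<^sub>C (embed_real a) = embed_real (G a)" using assms(7,9,11) a by blast
  qed (use assms decr \<epsilon> in blast)+
  define Ws where "Ws = (\<Sum>j. w j powr s) + 1"
  have Ws: "Ws > 0" unfolding Ws_def using sum_w[OF \<open>s > 1\<close>] by (intro add_nonneg_pos suminf_nonneg) auto
  \<comment> \<open>Each of the two terms in the radius condition becomes at most \<epsilon> /
    4.\<close>
  define d0 where "d0 = \<epsilon> / (8 * r * B * Ws)"
  define e1 where "e1 = \<epsilon> / (8 * r * B)"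
  have d0: "d0 > 0" and e1: "e1 > 0" using \<epsilon>(1) r B(1) Ws by (auto simp: d0_def e1_def)
  have radii: "r * B * (2 * d0 * (\<Sum>j. w j powr s) + 2 * e1) < \<epsilon>"
  proof -
    have "r * B * (2 * d0 * (\<Sum>j. w j powr s)) \<le> r * B * (2 * d0 * Ws)"
      using r B(1) d0 by (intro mult_left_mono) (auto simp: Ws_def)
    moreover have "r * B * (2 * d0 * Ws) = \<epsilon> / 4" using r B(1) Ws by (simp add: d0_def)
    moreover have "r * B * (2 * e1) = \<epsilon> / 4" using r B(1) by (simp add: e1_def)
    ultimately show ?thesis using \<epsilon>(1) by (simp add: distrib_left)
  qed
  have ws_p: "summable (\<lambda>j. (w j powr s) powr p)"
  proof -
    have "s * p > 1" using P by (simp add: p_def field_simps)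
    then show ?thesis using sum_w by (simp add: powr_powr)
  qed
  \<comment> \<open>The bounds involve the nodes only through \<tau>, so this constant, and with it
    C, is fixed before any node sequence is given.\<close>
  have "\<exists>S>0. \<forall>m K. (\<Sum>\<nu>\<in>cube_indices m K. (\<Prod>j<m. 1 + real (\<nu> j)) *
      surplus_bound (\<lambda>j. w j powr s) (node_const d0 / e1) \<tau> (1 / (1 + d0)) \<nu> powr p) \<le> S"
  proof (rule surplus_bound_summable[OF _ ws_p p])
    show "w j powr s > 0" for j using w[of j] by simp
  qed (use d0 e1 in \<open>auto simp: node_const_def add_pos_pos\<close>)
  then obtain S\<^sub>0 where S: "S\<^sub>0 > 0" "\<And>m K. (\<Sum>\<nu>\<in>cube_indices m K. (\<Prod>j<m. 1 + real (\<nu> j)) *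
      surplus_bound (\<lambda>j. w j powr s) (node_const d0 / e1) \<tau> (1 / (1 + d0)) \<nu> powr p) \<le> S\<^sub>0"
    by blast
  define W where "W = (\<Sum>j. w j powr a)"
  define D where "D = w 0 powr (t - \<theta> * a)"
  define C1 where "C1 = D * (S\<^sub>0 * W) powr \<theta> * S\<^sub>0 powr ((1 - p * \<theta>) / p)"
  define C2 where "C2 = D * W powr \<theta>"
  have C12: "C1 \<ge> 0" "C2 \<ge> 0" by (simp_all add: C1_def C2_def D_def)
  \<comment> \<open>The summand 1 keeps C positive even when M = 0.\<close>
  define C where "C = B' * (M * (C1 + C2)) + 1"
  have C: "C > 0" using B'(2) M_nonneg C12 by (simp add: C_def add_nonneg_pos)
  have coeff: "(\<lambda>y'. inner (G (sigma_map w \<psi> r s y')) (canonical_dual \<eta> j)) = coefficient j" for j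
    by (simp add: coefficient_def fun_eq_iff)
  show ?thesis
    unfolding coeff
  proof (intro exI[of _ C] conjI C allI impI)
    fix \<xi> :: "nat \<Rightarrow> real" and N :: nat
    assume \<xi>: "range \<xi> \<subseteq> {-1..1} \<and> inj \<xi> \<and> (\<forall>n. lebesgue_constant \<xi> n \<le> (1 + real n) powr \<tau>)"
      and N: "1 \<le> N"
    have "\<xi> i \<in> {-1..1}" for i using \<xi> by blast
    then interpret smolyak_map \<psi> w r s B \<eta> t M \<epsilon> G G\<^sub>C O\<^sub>C \<xi> \<tau> d0 e1
      using \<xi> \<open>\<tau> > 0\<close> d0 e1 radii by unfold_locales auto
    have a0: "0 < a" using a by simp
    obtain \<Lambda> where \<Lambda>: "\<forall>j<N. finite (\<Lambda> j) \<and> downward_closed (\<Lambda> j)" "(\<Sum>j<N. card (\<Lambda> j)) \<le> N"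
      "\<forall>y\<in>cube. L2_set (\<lambda>j. coefficient j y - smolyak_interpolant \<xi> (\<Lambda> j) (coefficient j) y) {..<N} \<le>
        M * (C1 * real N powr (- \<theta>))"
      by (rule smolyak_rate[OF p S \<theta> sum_w[OF a] a0 N, folded W_def, folded D_def, folded C1_def]) (rule that)
    \<comment> \<open>Monotonicity and summability give N * w_N powr a \<le> W, so truncation after
      N coefficients has the same order N powr (-\<theta>) as the interpolation error.\<close>
    have tail: "w N powr t \<le> C2 * real N powr (- \<theta>)"
    proof -
      have "real N * w N powr a = (\<Sum>j<N. w N powr a)" by simp
      also have "\<dots> \<le> (\<Sum>j<N. w j powr a)"
        using decr w a by (intro sum_mono powr_mono2) (auto simp: decseq_def less_imp_le)
      also have "\<dots> \<le> W" unfolding W_def using sum_w[OF a] by (intro sum_le_suminf) auto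
      finally have "w N powr a \<le> W / real N" using N by (simp add: field_simps)
      then have "(w N powr a) powr \<theta> \<le> (W / real N) powr \<theta>" using \<theta>(1) by (intro powr_mono2) auto
      also have "\<dots> = W powr \<theta> * real N powr (- \<theta>)"
        using N by (simp add: W_def powr_divide powr_minus_divide suminf_nonneg sum_w[OF a])
      finally have le: "(w N powr a) powr \<theta> \<le> W powr \<theta> * real N powr (- \<theta>)" .
      have "w N powr t = w N powr (t - \<theta> * a) * (w N powr a) powr \<theta>"
        by (simp add: powr_powr mult.commute flip: powr_add)
      also have "\<dots> \<le> D * (W powr \<theta> * real N powr (- \<theta>))"
        unfolding D_def using decr w \<theta>(2) le
        by (intro mult_mono powr_mono2) (auto simp: decseq_def less_imp_le)
      finally show ?thesis by (simp add: C2_def)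
    qed
    have err: "norm (G (sigma_map w \<psi> r s y) - decoder \<eta> (zero_pad N (\<lambda>j. smolyak_interpolant \<xi> (\<Lambda> j) (coefficient j) y)))
        \<le> C * real N powr (- min (s - 1) t + \<delta>)" if y: "y \<in> cube" for y
    proof -
      have "norm (G (sigma_map w \<psi> r s y) - decoder \<eta> (zero_pad N (\<lambda>j. smolyak_interpolant \<xi> (\<Lambda> j) (coefficient j) y)))
          \<le> B' * (M * (C1 * real N powr (- \<theta>)) + w N powr t * M)"
        by (rule decoder_error_le[OF y B' \<Lambda>(3)[rule_format, OF y]])
      also have "\<dots> \<le> B' * (M * (C1 * real N powr (- \<theta>)) + C2 * real N powr (- \<theta>) * M)"
        using B'(2) M_nonneg tail by (intro mult_left_mono add_left_mono mult_right_mono) auto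
      also have "\<dots> = B' * (M * (C1 + C2)) * real N powr (- \<theta>)" by (simp add: algebra_simps)
      also have "\<dots> \<le> C * real N powr (- \<theta>)" unfolding C_def by (intro mult_right_mono) auto
      also have "\<dots> \<le> C * real N powr (- min (s - 1) t + \<delta>)"
        using C N rate by (intro mult_left_mono powr_mono) auto
      finally show ?thesis .
    qed
    show "\<exists>\<Lambda>. (\<forall>j<N. finite (\<Lambda> j) \<and> downward_closed (\<Lambda> j)) \<and> (\<Sum>j<N. card (\<Lambda> j)) \<le> N \<and>
       (\<forall>y\<in>cube. norm (G (sigma_map w \<psi> r s y) - decoder \<eta> (zero_pad N (\<lambda>j. smolyak_interpolant \<xi> (\<Lambda> j) (coefficient j) y)))
          \<le> C * real N powr (- min (s - 1) t + \<delta>))"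
      using \<Lambda>(1,2) err by blast
  qed
qed

end
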